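(* Let $G$ be a topological group, $A$ a C*-algebra and $\alpha=(\{A_t\}_{t\in G},\{\alpha_t\}_{t\in G})$ a C*-partial action of $G$ on $A$. Then the following are equivalent: (1) $\alpha$ has a C*-globalization. (2) $\alpha$ has a *-globalization. (3) For all $(t,a,b)\in G\times A\times A$ there exists $u\in A_t$ such that, for all $c\in A_{t^{-1}}$, $\alpha_t(c)u=\alpha_t(ca)b$.
   Context: Topological groups are not required to be locally compact or Hausdorff. A *-algebra is a complex algebra with a conjugate linear involution satisfying $(ab)^*=b^*a^*$, $a^{**}=a$ (no topology). A *-ideal of $A$ is a subspace $I$ with $I^*=I$ and $IA\subset I$. A C*-ideal of a C*-algebra is a norm-closed two-sided ideal. A set-theoretic partial action of a group $G$ on a set $X$ is a pair $(\{X_t\}_{t\in G},\{\sigma_t\}_{t\in G})$ where $X_t\subset X$, $\sigma_t\colon X_{t^{-1}}\to X_t$ is a function, $\sigma_e=\mathrm{id}_X$, and for all $s,t\in G$, if $x\in X_{t^{-1}}$ and $\sigma_t(x)\in X_{s^{-1}}$, then $x\in X_{t^{-1}s^{-1}}$ and $\sigma_s(\sigma_t(x))=\sigma_{st}(x)$. It is global if all $X_t=X$. A *-partial action of $G$ (as a discrete group) on a *-algebra $A$ is a set-theoretic partial action $(\{A_t\},\{\alpha_t\})$ of $G$ on $A$ with each $A_t$ a *-ideal and each $\alpha_t$ a *-homomorphism. A C*-partial action of the topological group $G$ on the C*-algebra $A$ is a *-partial action $\alpha=(\{A_t\},\{\alpha_t\})$ of $G$ on $A$ such that: each $A_t$ is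 closed in $A$; $\{A_t\}_{t\in G}$ is a continuous family, i.e. for every open $U\subset A$ the set $\{t\in G\colon A_t\cap U\neq\emptyset\}$ is open in $G$; and the function $\{(t,a)\in G\times A\colon a\in A_{t^{-1}}\}\to A$, $(t,a)\mapsto\alpha_t(a)$, is continuous. A *-global (C*-global) action is a global *-partial (C*-partial) action. An isomorphism of *-partial actions from $(\{A_t\},\{\alpha_t\})$ (on $A$) to $(\{B_t\},\{\beta_t\})$ (on $B$) is a bijective *-homomorphism $f\colon A\to B$ with $f(A_t)=B_t$ and $f(\alpha_t(x))=\beta_t(f(x))$ for all $t\in G$, $x\in A_{t^{-1}}$. For a global action $\beta$ on $B$ and a *-ideal $I$ of $B$, $\beta|_I$ is the *-partial action $(\{I\cap\beta_t(I)\}_t,\{\beta_t|_{I\cap\beta_{t^{-1}}(I)}\}_t)$ of $G$ on $I$. A *-globalization of $\alpha$ is a 4-tuple $(B,\beta,I,\iota)$ where $B$ is a *-algebra, $\beta$ is a *-global action of $G$ on $B$, $I$ is a *-ideal of $B$ and $\iota\colon\alpha\to\beta|_I$ is an isomorphism of *-partial actions. A C*-globalization of $\alpha$ is a 4-tuple $(B,\beta,I,\iota)$ where $B$ is a C*-algebra, $\beta$ is a C*-global action of $G$ on $B$, $I$ is a C*-ideal of $B$ and $\iota\colon\alpha\to\beta|_I$ is an isomorphism of *-partial actions. *)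

theory Defs
  imports
    "HOL-Analysis.Analysis"
    "HOL-Algebra.Module"
    "HOL-Algebra.Algebraic_Closure_Type"
begin

section \<open>*-algebras and C*-algebras\<close>

text \<open>
  Algebras are carrier-based because a globalization quantifies existentially over algebras.
  The underlying records are those of HOL-Algebra; algebras need not be unital here, and the
  record field for the unit is never constrained nor used.
\<close>

abbreviation complex_ring :: "complex ring"
  where "complex_ring \<equiv> ring_of_type_algebra"

record 'a star_algebra = "(complex, 'a) module" +
  star :: "'a \<Rightarrow> 'a"

record 'a cstar_algebra = "'a star_algebra" +
  cnorm :: "'a \<Rightarrow> real"

locale star_algebra = Module.module complex_ring A
  for A :: "('a, 'm) star_algebra_scheme" (structure) +
  assumes mult_closed: "\<lbrakk>x \<in> carrier A; y \<in> carrier A\<rbrakk> \<Longrightarrow> x \<otimes> y \<in> carrier A"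
    and mult_assoc: "\<lbrakk>x \<in> carrier A; y \<in> carrier A; z \<in> carrier A\<rbrakk>
      \<Longrightarrow> (x \<otimes> y) \<otimes> z = x \<otimes> (y \<otimes> z)"
    and mult_l_distr: "\<lbrakk>x \<in> carrier A; y \<in> carrier A; z \<in> carrier A\<rbrakk>
      \<Longrightarrow> (x \<oplus> y) \<otimes> z = x \<otimes> z \<oplus> y \<otimes> z"
    and mult_r_distr: "\<lbrakk>x \<in> carrier A; y \<in> carrier A; z \<in> carrier A\<rbrakk>
      \<Longrightarrow> z \<otimes> (x \<oplus> y) = z \<otimes> x \<oplus> z \<otimes> y"
    and smult_mult_l: "\<lbrakk>x \<in> carrier A; y \<in> carrier A\<rbrakk> \<Longrightarrow> (k \<odot> x) \<otimes> y = k \<odot> (x \<otimes> y)"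
    and smult_mult_r: "\<lbrakk>x \<in> carrier A; y \<in> carrier A\<rbrakk> \<Longrightarrow> x \<otimes> (k \<odot> y) = k \<odot> (x \<otimes> y)"
    and star_closed: "x \<in> carrier A \<Longrightarrow> star A x \<in> carrier A"
    and star_add: "\<lbrakk>x \<in> carrier A; y \<in> carrier A\<rbrakk> \<Longrightarrow> star A (x \<oplus> y) = star A x \<oplus> star A y"
    and star_smult: "x \<in> carrier A \<Longrightarrow> star A (k \<odot> x) = cnj k \<odot> star A x"
    and star_mult: "\<lbrakk>x \<in> carrier A; y \<in> carrier A\<rbrakk> \<Longrightarrow> star A (x \<otimes> y) = star A y \<otimes> star A x"
    and star_star: "x \<in> carrier A \<Longrightarrow> star A (star A x) = x"

text \<open>The library's \<open>Metric_space\<close> wants a nonnegative, symmetric function on the whole type,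
  so the distance is cut off outside the carrier.\<close>

definition cdist :: "('a, 'm) cstar_algebra_scheme \<Rightarrow> 'a \<Rightarrow> 'a \<Rightarrow> real"
  where "cdist A x y =
    (if x \<in> carrier A \<and> y \<in> carrier A then cnorm A (x \<ominus>\<^bsub>A\<^esub> y) else 0)"

definition norm_topology :: "('a, 'm) cstar_algebra_scheme \<Rightarrow> 'a topology"
  where "norm_topology A = Metric_space.mtopology (carrier A) (cdist A)"

locale cstar_algebra = star_algebra A
  for A :: "('a, 'm) cstar_algebra_scheme" (structure) +
  assumes cnorm_nonneg: "x \<in> carrier A \<Longrightarrow> 0 \<le> cnorm A x"
    and cnorm_eq_0_iff: "x \<in> carrier A \<Longrightarrow> cnorm A x = 0 \<longleftrightarrow> x = \<zero>"
    and cnorm_add: "\<lbrakk>x \<in> carrier A; y \<in> carrier A\<rbrakk> \<Longrightarrow> cnorm A (x \<oplus> y) \<le> cnorm A x + cnorm A y"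
    and cnorm_smult: "x \<in> carrier A \<Longrightarrow> cnorm A (k \<odot> x) = cmod k * cnorm A x"
    and cnorm_mult: "\<lbrakk>x \<in> carrier A; y \<in> carrier A\<rbrakk> \<Longrightarrow> cnorm A (x \<otimes> y) \<le> cnorm A x * cnorm A y"
    and cstar_identity: "x \<in> carrier A \<Longrightarrow> cnorm A (star A x \<otimes> x) = (cnorm A x)\<^sup>2"
    and complete: "Metric_space.mcomplete (carrier A) (cdist A)"

lemma (in cstar_algebra) metric_space_cdist: "Metric_space (carrier A) (cdist A)"
proof
  have neg: "cnorm A (\<ominus> x) = cnorm A x" if "x \<in> carrier A" for x
  proof -
    have "\<ominus> x = (\<ominus>\<^bsub>complex_ring\<^esub> 1) \<odot> x" using that smult_l_minus[of 1 x] smult_one[OF that]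
      by (simp add: ring_of_type_algebra_def)
    moreover have "(\<ominus>\<^bsub>complex_ring\<^esub> 1) = (-1::complex)"
      using R.r_neg[of 1] by (simp add: ring_of_type_algebra_def add_eq_0_iff)
    ultimately show ?thesis using cnorm_smult[OF that] by simp
  qed
  show "0 \<le> cdist A x y" for x y by (auto simp: cdist_def intro: cnorm_nonneg)
  show "cdist A x y = cdist A y x" for x y
    using neg[of "x \<ominus> y"] by (auto simp: cdist_def a_minus_def M.minus_add M.a_comm)
  show "x \<in> carrier A \<Longrightarrow> y \<in> carrier A \<Longrightarrow> (cdist A x y = 0) = (x = y)" for x y
    by (auto simp: cdist_def cnorm_eq_0_iff M.r_neg a_minus_def M.add.inv_solve_right')
  show "cdist A x z \<le> cdist A x y + cdist A y z"
    if "x \<in> carrier A" "y \<in> carrier A" "z \<in> carrier A" for x y z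
  proof -
    have "x \<ominus> z = (x \<ominus> y) \<oplus> (y \<ominus> z)" using that
      by (simp add: a_minus_def M.a_assoc M.r_neg1)
    then show ?thesis using that cnorm_add[of "x \<ominus> y" "y \<ominus> z"] by (simp add: cdist_def)
  qed
qed

definition star_ideal :: "'a set \<Rightarrow> ('a, 'm) star_algebra_scheme \<Rightarrow> bool"
  where "star_ideal I A \<longleftrightarrow>
    submodule I complex_ring A \<and> star A ` I = I \<and>
    (\<forall>x\<in>I. \<forall>a\<in>carrier A. x \<otimes>\<^bsub>A\<^esub> a \<in> I)"

definition cstar_ideal :: "'a set \<Rightarrow> ('a, 'm) cstar_algebra_scheme \<Rightarrow> bool"
  where "cstar_ideal I A \<longleftrightarrow>
    submodule I complex_ring A \<and> closedin (norm_topology A) I \<and>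
    (\<forall>x\<in>I. \<forall>a\<in>carrier A. x \<otimes>\<^bsub>A\<^esub> a \<in> I \<and> a \<otimes>\<^bsub>A\<^esub> x \<in> I)"

definition star_hom ::
  "('a, 'm) star_algebra_scheme \<Rightarrow> ('b, 'n) star_algebra_scheme \<Rightarrow> ('a \<Rightarrow> 'b) \<Rightarrow> bool"
  where "star_hom A B f \<longleftrightarrow>
    f \<in> carrier A \<rightarrow> carrier B \<and>
    (\<forall>x\<in>carrier A. \<forall>y\<in>carrier A. f (x \<oplus>\<^bsub>A\<^esub> y) = f x \<oplus>\<^bsub>B\<^esub> f y) \<and>
    (\<forall>k. \<forall>x\<in>carrier A. f (k \<odot>\<^bsub>A\<^esub> x) = k \<odot>\<^bsub>B\<^esub> f x) \<and>
    (\<forall>x\<in>carrier A. \<forall>y\<in>carrier A. f (x \<otimes>\<^bsub>A\<^esub> y) = f x \<otimes>\<^bsub>B\<^esub> f y) \<and>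
    (\<forall>x\<in>carrier A. f (star A x) = star B (f x))"

section \<open>Partial actions\<close>

text \<open>
  Groups are written additively, as in the type class \<^class>\<open>topological_group_add\<close>; neither
  \<^class>\<open>group_add\<close> nor \<^class>\<open>topological_group_add\<close> assumes commutativity, and the latter
  assumes no separation axiom.  So \<open>s t\<close>, \<open>t\<^sup>-\<^sup>1\<close>, \<open>e\<close> become \<open>s + t\<close>, \<open>- t\<close>, \<open>0\<close>.
  A partial action is given by its family of domains \<open>D\<close> and its maps \<open>\<sigma>\<close>; the values of
  \<open>\<sigma> t\<close> outside \<open>D (- t)\<close> are irrelevant.
\<close>

definition set_partial_action ::
  "'a set \<Rightarrow> ('g::group_add \<Rightarrow> 'a set) \<Rightarrow> ('g \<Rightarrow> 'a \<Rightarrow> 'a) \<Rightarrow> bool"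
  where "set_partial_action S D \<sigma> \<longleftrightarrow>
    (\<forall>t. D t \<subseteq> S) \<and>
    (\<forall>t. \<sigma> t \<in> D (- t) \<rightarrow> D t) \<and>
    D 0 = S \<and> (\<forall>x\<in>S. \<sigma> 0 x = x) \<and>
    (\<forall>s t x. x \<in> D (- t) \<and> \<sigma> t x \<in> D (- s) \<longrightarrow>
      x \<in> D (- t + - s) \<and> \<sigma> s (\<sigma> t x) = \<sigma> (s + t) x)"

definition star_partial_action ::
  "('a, 'm) star_algebra_scheme \<Rightarrow> ('g::group_add \<Rightarrow> 'a set) \<Rightarrow> ('g \<Rightarrow> 'a \<Rightarrow> 'a) \<Rightarrow> bool"
  where "star_partial_action A D \<alpha> \<longleftrightarrow>
    set_partial_action (carrier A) D \<alpha> \<and>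
    (\<forall>t. star_ideal (D t) A) \<and>
    (\<forall>t. star_hom (A\<lparr>carrier := D (- t)\<rparr>) (A\<lparr>carrier := D t\<rparr>) (\<alpha> t))"

definition cstar_partial_action ::
  "('a, 'm) cstar_algebra_scheme \<Rightarrow>
    ('g::topological_group_add \<Rightarrow> 'a set) \<Rightarrow> ('g \<Rightarrow> 'a \<Rightarrow> 'a) \<Rightarrow> bool"
  where "cstar_partial_action A D \<alpha> \<longleftrightarrow>
    star_partial_action A D \<alpha> \<and>
    (\<forall>t. closedin (norm_topology A) (D t)) \<and>
    (\<forall>U. openin (norm_topology A) U \<longrightarrow> open {t. D t \<inter> U \<noteq> {}}) \<and>
    continuous_map
      (subtopology (prod_topology euclidean (norm_topology A)) {(t, a). a \<in> D (- t)})
      (norm_topology A) (\<lambda>(t, a). \<alpha> t a)"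

definition star_global_action ::
  "('a, 'm) star_algebra_scheme \<Rightarrow> ('g::group_add \<Rightarrow> 'a \<Rightarrow> 'a) \<Rightarrow> bool"
  where "star_global_action B \<beta> \<longleftrightarrow> star_partial_action B (\<lambda>_. carrier B) \<beta>"

definition cstar_global_action ::
  "('a, 'm) cstar_algebra_scheme \<Rightarrow> ('g::topological_group_add \<Rightarrow> 'a \<Rightarrow> 'a) \<Rightarrow> bool"
  where "cstar_global_action B \<beta> \<longleftrightarrow> cstar_partial_action B (\<lambda>_. carrier B) \<beta>"

definition star_partial_action_iso ::
  "('a, 'm) star_algebra_scheme \<Rightarrow> ('g::group_add \<Rightarrow> 'a set) \<Rightarrow> ('g \<Rightarrow> 'a \<Rightarrow> 'a) \<Rightarrow>
   ('b, 'n) star_algebra_scheme \<Rightarrow> ('g \<Rightarrow> 'b set) \<Rightarrow> ('g \<Rightarrow> 'b \<Rightarrow> 'b) \<Rightarrow> ('a \<Rightarrow> 'b) \<Rightarrow> bool"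
  where "star_partial_action_iso A D \<alpha> B E \<beta> f \<longleftrightarrow>
    star_hom A B f \<and> bij_betw f (carrier A) (carrier B) \<and>
    (\<forall>t. f ` D t = E t) \<and>
    (\<forall>t. \<forall>x\<in>D (- t). f (\<alpha> t x) = \<beta> t (f x))"

section \<open>Globalizations\<close>

definition restr_dom :: "('g \<Rightarrow> 'b \<Rightarrow> 'b) \<Rightarrow> 'b set \<Rightarrow> 'g \<Rightarrow> 'b set"
  where "restr_dom \<beta> I t = I \<inter> \<beta> t ` I"

definition restr_map :: "('g::group_add \<Rightarrow> 'b \<Rightarrow> 'b) \<Rightarrow> 'b set \<Rightarrow> 'g \<Rightarrow> 'b \<Rightarrow> 'b"
  where "restr_map \<beta> I t = restrict (\<beta> t) (I \<inter> \<beta> (- t) ` I)"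

definition star_globalization ::
  "('a, 'm) star_algebra_scheme \<Rightarrow> ('g::group_add \<Rightarrow> 'a set) \<Rightarrow> ('g \<Rightarrow> 'a \<Rightarrow> 'a) \<Rightarrow>
   'b star_algebra \<Rightarrow> ('g \<Rightarrow> 'b \<Rightarrow> 'b) \<Rightarrow> 'b set \<Rightarrow> ('a \<Rightarrow> 'b) \<Rightarrow> bool"
  where "star_globalization A D \<alpha> B \<beta> I \<iota> \<longleftrightarrow>
    star_algebra B \<and> star_global_action B \<beta> \<and> star_ideal I B \<and>
    star_partial_action_iso A D \<alpha> (B\<lparr>carrier := I\<rparr>) (restr_dom \<beta> I) (restr_map \<beta> I) \<iota>"

definition cstar_globalization ::
  "('a, 'm) cstar_algebra_scheme \<Rightarrow>
   ('g::topological_group_add \<Rightarrow> 'a set) \<Rightarrow> ('g \<Rightarrow> 'a \<Rightarrow> 'a) \<Rightarrow>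
   'b cstar_algebra \<Rightarrow> ('g \<Rightarrow> 'b \<Rightarrow> 'b) \<Rightarrow> 'b set \<Rightarrow> ('a \<Rightarrow> 'b) \<Rightarrow> bool"
  where "cstar_globalization A D \<alpha> B \<beta> I \<iota> \<longleftrightarrow>
    cstar_algebra B \<and> cstar_global_action B \<beta> \<and> cstar_ideal I B \<and>
    star_partial_action_iso A D \<alpha> (B\<lparr>carrier := I\<rparr>) (restr_dom \<beta> I) (restr_map \<beta> I) \<iota>"

text \<open>
  HOL cannot quantify existentially over types, so "there is a globalization" is relative to the
  type \<open>'b\<close> whose elements are available for carriers of \<open>B\<close>.
\<close>

definition has_star_globalization ::
  "'b itself \<Rightarrow> ('a, 'm) star_algebra_scheme \<Rightarrow>
   ('g::group_add \<Rightarrow> 'a set) \<Rightarrow> ('g \<Rightarrow> 'a \<Rightarrow> 'a) \<Rightarrow> bool"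
  where "has_star_globalization T A D \<alpha> \<longleftrightarrow>
    (\<exists>(B :: 'b star_algebra) \<beta> I \<iota>. star_globalization A D \<alpha> B \<beta> I \<iota>)"

definition has_cstar_globalization ::
  "'b itself \<Rightarrow> ('a, 'm) cstar_algebra_scheme \<Rightarrow>
   ('g::topological_group_add \<Rightarrow> 'a set) \<Rightarrow> ('g \<Rightarrow> 'a \<Rightarrow> 'a) \<Rightarrow> bool"
  where "has_cstar_globalization T A D \<alpha> \<longleftrightarrow>
    (\<exists>(B :: 'b cstar_algebra) \<beta> I \<iota>. cstar_globalization A D \<alpha> B \<beta> I \<iota>)"

text \<open>
  The type \<open>'g \<Rightarrow> 'a \<Rightarrow> 'a\<close> is large enough for a group \<open>'g\<close> acting partially on a C*-algebra
  with carrier in \<open>'a\<close>: given a C*-globalization \<open>(B, \<beta>, I, \<iota>)\<close>, restrict \<open>\<beta>\<close> to the closed span of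
  the ideals \<open>\<beta> t ` I\<close>; an element \<open>b\<close> of it is determined by the left multiplications
  \<open>a \<mapsto> \<iota>\<^sup>-\<^sup>1 (\<beta> t b \<cdot> \<iota> a)\<close> for all \<open>t\<close>.
\<close>

type_synonym ('g, 'a) univ = "'g \<Rightarrow> 'a \<Rightarrow> 'a"

end

theory Submission
  imports Defs "HOL-Real_Asymp.Real_Asymp"
begin

text \<open>
  Suppose that \<open>A\<close> sits as an ideal in an algebra \<open>B\<close> on which the group acts globally by \<open>\<beta>\<close> extending
  \<open>\<alpha>\<close>.  For \<open>a, b \<in> A\<close> the product \<open>u = \<beta>\<^sub>t(a) b\<close> lies in \<open>A \<inter> \<beta>\<^sub>t(A) = A\<^sub>t\<close> and satisfies
  \<open>\<alpha>\<^sub>t(c) u = \<beta>\<^sub>t(c a) b = \<alpha>\<^sub>t(c a) b\<close>.  So the product condition of the theorem is necessary for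
  purely algebraic reasons (\<open>star_globalization_products\<close>), whatever the type of \<open>B\<close>, and a C*-globalization
  becomes a *-globalization by forgetting the norm.  What remains is to construct a
  C*-globalization from the product condition.

  The element \<open>u\<close> in the product condition is unique, because \<open>A\<^sub>t u = 0\<close> implies \<open>u\<^sup>* u = 0\<close>; it is called \<open>tprod t a b\<close> and
  serves as the product \<open>\<beta>\<^sub>t(a) b\<close> before \<open>\<beta>\<close> exists.  For fixed \<open>a\<close> and \<open>t\<close> it is an adjointable operator in
  \<open>b\<close>, with adjoint \<open>tprod t a\<^sup>*\<close> (\<open>tprod_adjoint\<close>), and bounded by \<open>\<parallel>a\<parallel>\<close> (\<open>tprod_norm\<close>).  Thus \<open>a\<close> gives a bounded
  family \<open>emb a = (tprod t a)\<^sub>t\<close> of multipliers of \<open>A\<close>, an element of the C*-algebra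
  \<open>\<ell>\<^sup>\<infinity>(G, M(A))\<close>, on which \<open>G\<close> acts by translation.  The map \<open>emb\<close> is an isometric
  *-homomorphism, and the associativity law \<open>\<beta>\<^sub>r(\<beta>\<^sub>t(a) b) d = \<beta>\<^sub>r\<^sub>t(a) (\<beta>\<^sub>r(b) d)\<close> of \<open>tprod_tprod\<close> says that the
  product of a translate of \<open>emb a\<close> with \<open>emb b\<close> is \<open>emb (tprod t a b)\<close>.  Hence \<open>emb ` A\<close> is an ideal in
  the algebra \<open>glob\<close> of those families that multiply the translates of \<open>emb ` A\<close> into themselves and
  have norm-continuous orbits.  This is the algebra of the globalization.

  Three points are not formal.
  Translation restricts to \<open>\<alpha>\<close> on \<open>emb ` A\<close>: the difference of the two families
  annihilates the two ideals in whose sum it lies (\<open>tprod_transport\<close>).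
  The orbits of \<open>emb ` A\<close> are norm-continuous: near the neutral element, \<open>a\<close> is approximated by elements on
  which \<open>\<alpha>\<^sub>t\<close> is defined (\<open>orbit_continuous_emb\<close>).
  The intersection of \<open>emb ` A\<close> with its translate by \<open>t\<close> is not larger than \<open>emb ` A\<^sub>t\<close>: an
  element of it multiplies \<open>A\<close> into \<open>A\<^sub>t\<close>, and a closed ideal contains \<open>z\<close> as soon as it contains \<open>z z\<^sup>*\<close>
  (\<open>closed_star_ideal_self_mult_star\<close>).  That last fact and the contractivity of \<open>\<alpha>\<^sub>t\<close> are the only pieces of
  C*-theory used beyond the C*-identity; both get elementary proofs without spectral theory.
\<close>

section \<open>Elementary calculus in *-algebras and C*-algebras\<close>

lemma complex_ring_simps [simp]:
  "carrier complex_ring = UNIV" "a \<oplus>\<^bsub>complex_ring\<^esub> b = a + b" "a \<otimes>\<^bsub>complex_ring\<^esub> b = a * b"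
  "\<zero>\<^bsub>complex_ring\<^esub> = 0" "\<one>\<^bsub>complex_ring\<^esub> = 1"
  by (simp_all add: ring_of_type_algebra_def)

lemma cring_complex_ring: "cring complex_ring"
  by (rule cring_from_type_algebra)

context star_algebra begin

lemma smult_cl [simp, intro]: "x \<in> carrier A \<Longrightarrow> k \<odot> x \<in> carrier A"
  by (rule smult_closed) auto

declare mult_closed [simp, intro] star_closed [simp, intro] star_star [simp]

lemma smult_1 [simp]: "x \<in> carrier A \<Longrightarrow> 1 \<odot> x = x"
  using smult_one[of x] by simp

lemma smult_0 [simp]: "x \<in> carrier A \<Longrightarrow> 0 \<odot> x = \<zero>\<^bsub>A\<^esub>"
  using smult_l_null[of x] by simp

lemma minus_eq_smult: "x \<in> carrier A \<Longrightarrow> \<ominus> x = (-1) \<odot> x"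
proof -
  assume x: "x \<in> carrier A"
  have "(-1) \<odot> x \<oplus> x = ((-1) + 1) \<odot> x" using smult_l_distr[of "-1" 1 x] x by simp
  also have "\<dots> = \<zero>\<^bsub>A\<^esub>" using x by (simp del: smult_1)
  finally show ?thesis using x by (metis M.minus_equality smult_cl)
qed

lemma smult_add: "\<lbrakk>x \<in> carrier A; y \<in> carrier A\<rbrakk> \<Longrightarrow> k \<odot> (x \<oplus>\<^bsub>A\<^esub> y) = k \<odot> x \<oplus>\<^bsub>A\<^esub> k \<odot> y"
  by (rule smult_r_distr) auto

lemma add_smult: "x \<in> carrier A \<Longrightarrow> (k + l) \<odot> x = k \<odot> x \<oplus>\<^bsub>A\<^esub> l \<odot> x"
  using smult_l_distr[of k l x] by simp

lemma smult_smult: "x \<in> carrier A \<Longrightarrow> k \<odot> (l \<odot> x) = (k * l) \<odot> x"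
  using smult_assoc1[of k l x] by simp

lemma diff_eq_smult: "\<lbrakk>x \<in> carrier A; y \<in> carrier A\<rbrakk> \<Longrightarrow> x \<ominus>\<^bsub>A\<^esub> y = x \<oplus>\<^bsub>A\<^esub> (-1) \<odot> y"
  by (simp add: a_minus_def minus_eq_smult)

lemma diff_zero_iff: "\<lbrakk>x \<in> carrier A; y \<in> carrier A\<rbrakk> \<Longrightarrow> x \<ominus>\<^bsub>A\<^esub> y = \<zero>\<^bsub>A\<^esub> \<longleftrightarrow> x = y"
  by (simp add: a_minus_def M.r_neg M.add.inv_solve_right')

lemma mult_l_diff: "\<lbrakk>x \<in> carrier A; y \<in> carrier A; z \<in> carrier A\<rbrakk>
    \<Longrightarrow> (x \<ominus>\<^bsub>A\<^esub> y) \<otimes>\<^bsub>A\<^esub> z = x \<otimes>\<^bsub>A\<^esub> z \<ominus>\<^bsub>A\<^esub> y \<otimes>\<^bsub>A\<^esub> z"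
  by (simp add: diff_eq_smult mult_l_distr smult_mult_l)

lemma mult_r_diff: "\<lbrakk>x \<in> carrier A; y \<in> carrier A; z \<in> carrier A\<rbrakk>
    \<Longrightarrow> z \<otimes>\<^bsub>A\<^esub> (x \<ominus>\<^bsub>A\<^esub> y) = z \<otimes>\<^bsub>A\<^esub> x \<ominus>\<^bsub>A\<^esub> z \<otimes>\<^bsub>A\<^esub> y"
  by (simp add: diff_eq_smult mult_r_distr smult_mult_r)

lemma star_diff: "\<lbrakk>x \<in> carrier A; y \<in> carrier A\<rbrakk>
    \<Longrightarrow> star A (x \<ominus>\<^bsub>A\<^esub> y) = star A x \<ominus>\<^bsub>A\<^esub> star A y"
  by (simp add: diff_eq_smult star_add star_smult)

lemma mult_zero [simp]: "x \<in> carrier A \<Longrightarrow> x \<otimes>\<^bsub>A\<^esub> \<zero>\<^bsub>A\<^esub> = \<zero>\<^bsub>A\<^esub>"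
  using smult_mult_r[of x x 0] by (metis mult_closed smult_0)

lemma zero_mult [simp]: "x \<in> carrier A \<Longrightarrow> \<zero>\<^bsub>A\<^esub> \<otimes>\<^bsub>A\<^esub> x = \<zero>\<^bsub>A\<^esub>"
  using smult_mult_l[of x x 0] by (metis mult_closed smult_0)

lemma star_zero [simp]: "star A \<zero>\<^bsub>A\<^esub> = \<zero>\<^bsub>A\<^esub>"
  using star_smult[of "\<zero>\<^bsub>A\<^esub>" 0] by simp

lemma star_ideal_carrier: "star_ideal (carrier A) A"
  unfolding star_ideal_def
proof (intro conjI ballI)
  show "star A ` carrier A = carrier A" by (auto simp: image_iff) (metis star_closed star_star)
qed (auto simp: carrier_is_submodule)

lemma star_idealD:
  assumes "star_ideal J A"
  shows "x \<in> J \<Longrightarrow> x \<in> carrier A" and "\<zero>\<^bsub>A\<^esub> \<in> J"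
    and "\<lbrakk>x \<in> J; y \<in> J\<rbrakk> \<Longrightarrow> x \<oplus>\<^bsub>A\<^esub> y \<in> J" and "x \<in> J \<Longrightarrow> k \<odot> x \<in> J"
    and "\<lbrakk>x \<in> J; y \<in> J\<rbrakk> \<Longrightarrow> x \<ominus>\<^bsub>A\<^esub> y \<in> J"
    and "x \<in> J \<Longrightarrow> star A x \<in> J"
    and "\<lbrakk>x \<in> J; a \<in> carrier A\<rbrakk> \<Longrightarrow> x \<otimes>\<^bsub>A\<^esub> a \<in> J"
    and "\<lbrakk>x \<in> J; a \<in> carrier A\<rbrakk> \<Longrightarrow> a \<otimes>\<^bsub>A\<^esub> x \<in> J"
proof -
  have sm: "submodule J complex_ring A" and st: "star A ` J = J"
    and r: "\<forall>x\<in>J. \<forall>a\<in>carrier A. x \<otimes>\<^bsub>A\<^esub> a \<in> J"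
    using assms by (auto simp: star_ideal_def)
  note sub = submoduleE[OF sm]
  show car: "x \<in> J \<Longrightarrow> x \<in> carrier A" for x using sub(1) by auto
  show k: "x \<in> J \<Longrightarrow> k \<odot> x \<in> J" for x k using sub(4)[of k x] by auto
  show add: "\<lbrakk>x \<in> J; y \<in> J\<rbrakk> \<Longrightarrow> x \<oplus>\<^bsub>A\<^esub> y \<in> J" for x y by (rule sub(5))
  show "\<zero>\<^bsub>A\<^esub> \<in> J" using sub(2) k car smult_0 by (metis all_not_in_conv)
  show "\<lbrakk>x \<in> J; y \<in> J\<rbrakk> \<Longrightarrow> x \<ominus>\<^bsub>A\<^esub> y \<in> J" for x y
    using add[of x "(-1) \<odot> y"] k car by (simp add: diff_eq_smult)
  show s: "x \<in> J \<Longrightarrow> star A x \<in> J" for x using st by auto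
  show "\<lbrakk>x \<in> J; a \<in> carrier A\<rbrakk> \<Longrightarrow> x \<otimes>\<^bsub>A\<^esub> a \<in> J" for x a using r by auto
  then show "\<lbrakk>x \<in> J; a \<in> carrier A\<rbrakk> \<Longrightarrow> a \<otimes>\<^bsub>A\<^esub> x \<in> J" for x a
    by (metis car s star_closed star_mult star_star)
qed

end

text \<open>Completeness of the algebra of multipliers can only be discussed once its metric is known to
  be one, so the norm axioms are collected separately first.\<close>

locale pre_cstar_algebra = star_algebra A
  for A :: "('a, 'm) cstar_algebra_scheme" (structure) +
  assumes norm_nonneg [simp]: "x \<in> carrier A \<Longrightarrow> 0 \<le> cnorm A x"
    and norm_eq_0_iff: "x \<in> carrier A \<Longrightarrow> cnorm A x = 0 \<longleftrightarrow> x = \<zero>"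
    and norm_add: "\<lbrakk>x \<in> carrier A; y \<in> carrier A\<rbrakk> \<Longrightarrow> cnorm A (x \<oplus> y) \<le> cnorm A x + cnorm A y"
    and norm_smult: "x \<in> carrier A \<Longrightarrow> cnorm A (k \<odot> x) = cmod k * cnorm A x"
    and norm_mult: "\<lbrakk>x \<in> carrier A; y \<in> carrier A\<rbrakk> \<Longrightarrow> cnorm A (x \<otimes> y) \<le> cnorm A x * cnorm A y"
    and norm_star_mult: "x \<in> carrier A \<Longrightarrow> cnorm A (star A x \<otimes> x) = (cnorm A x)\<^sup>2"

sublocale cstar_algebra \<subseteq> pre_cstar_algebra
  by unfold_locales
    (auto simp: cnorm_nonneg cnorm_eq_0_iff cnorm_add cnorm_smult cnorm_mult cstar_identity)

context pre_cstar_algebra begin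

lemma norm_zero [simp]: "cnorm A \<zero>\<^bsub>A\<^esub> = 0"
  using norm_eq_0_iff by auto

lemma norm_minus [simp]: "x \<in> carrier A \<Longrightarrow> cnorm A (\<ominus>\<^bsub>A\<^esub> x) = cnorm A x"
  by (simp add: minus_eq_smult norm_smult)

lemma norm_diff: "\<lbrakk>x \<in> carrier A; y \<in> carrier A\<rbrakk> \<Longrightarrow> cnorm A (x \<ominus>\<^bsub>A\<^esub> y) \<le> cnorm A x + cnorm A y"
  using norm_add[of x "\<ominus>\<^bsub>A\<^esub> y"] by (simp add: a_minus_def)

lemma norm_diff_commute:
  "\<lbrakk>x \<in> carrier A; y \<in> carrier A\<rbrakk> \<Longrightarrow> cnorm A (x \<ominus>\<^bsub>A\<^esub> y) = cnorm A (y \<ominus>\<^bsub>A\<^esub> x)"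
  using norm_minus[of "x \<ominus>\<^bsub>A\<^esub> y"] by (simp add: a_minus_def M.minus_add M.a_comm)

lemma norm_diff_triangle:
  assumes "x \<in> carrier A" "y \<in> carrier A" "z \<in> carrier A"
  shows "cnorm A (x \<ominus>\<^bsub>A\<^esub> z) \<le> cnorm A (x \<ominus>\<^bsub>A\<^esub> y) + cnorm A (y \<ominus>\<^bsub>A\<^esub> z)"
proof -
  have "x \<ominus>\<^bsub>A\<^esub> z = (x \<ominus>\<^bsub>A\<^esub> y) \<oplus>\<^bsub>A\<^esub> (y \<ominus>\<^bsub>A\<^esub> z)"
    using assms by (simp add: a_minus_def M.a_assoc M.r_neg1)
  then show ?thesis using norm_add[of "x \<ominus>\<^bsub>A\<^esub> y" "y \<ominus>\<^bsub>A\<^esub> z"] assms by simp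
qed

lemma norm_le_diff:
  "\<lbrakk>x \<in> carrier A; y \<in> carrier A\<rbrakk> \<Longrightarrow> cnorm A x \<le> cnorm A y + cnorm A (x \<ominus>\<^bsub>A\<^esub> y)"
  using norm_add[of y "x \<ominus>\<^bsub>A\<^esub> y"] by (simp add: a_minus_def M.a_lcomm M.r_neg)

lemma norm_star [simp]: 
  assumes x: "x \<in> carrier A" shows "cnorm A (star A x) = cnorm A x"
proof -
  have le: "cnorm A y \<le> cnorm A (star A y)" if y: "y \<in> carrier A" for y
  proof (cases "cnorm A y = 0")
    case True then show ?thesis using y by simp
  next
    case False
    have "cnorm A y * cnorm A y \<le> cnorm A (star A y) * cnorm A y"
      using norm_star_mult[OF y] norm_mult[of "star A y" y] y by (simp add: power2_eq_square)
    then show ?thesis using False norm_nonneg[OF y] by simp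
  qed
  show ?thesis using le[OF x] le[of "star A x"] x by simp
qed

lemma norm_mult_star: "x \<in> carrier A \<Longrightarrow> cnorm A (x \<otimes>\<^bsub>A\<^esub> star A x) = (cnorm A x)\<^sup>2"
  using norm_star_mult[of "star A x"] by simp

lemma star_mult_self_eq_zero: "\<lbrakk>x \<in> carrier A; star A x \<otimes>\<^bsub>A\<^esub> x = \<zero>\<^bsub>A\<^esub>\<rbrakk> \<Longrightarrow> x = \<zero>\<^bsub>A\<^esub>"
  using norm_star_mult[of x] norm_eq_0_iff[of x] by simp

lemma mult_bound: "\<lbrakk>x \<in> carrier A; y \<in> carrier A; cnorm A x \<le> r; cnorm A y \<le> s\<rbrakk>
    \<Longrightarrow> cnorm A (x \<otimes>\<^bsub>A\<^esub> y) \<le> r * s"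
  using norm_mult[of x y] norm_nonneg[of x] norm_nonneg[of y]
  by (meson mult_mono order_trans)

text \<open>An element of a *-ideal is determined by its products with the ideal, because \<open>d\<^sup>* d = 0\<close> forces
  \<open>d = 0\<close>.  This replaces approximate units in most arguments below.\<close>

lemma star_ideal_eqI:
  assumes J: "star_ideal J A" and wz: "w \<in> J" "z \<in> J"
    and eq: "\<And>x. x \<in> J \<Longrightarrow> x \<otimes>\<^bsub>A\<^esub> w = x \<otimes>\<^bsub>A\<^esub> z"
  shows "w = z"
proof -
  note D = star_idealD[OF J]
  have "star A (w \<ominus>\<^bsub>A\<^esub> z) \<otimes>\<^bsub>A\<^esub> w = star A (w \<ominus>\<^bsub>A\<^esub> z) \<otimes>\<^bsub>A\<^esub> z"
    using eq wz D(5,6) by blast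
  then have "star A (w \<ominus>\<^bsub>A\<^esub> z) \<otimes>\<^bsub>A\<^esub> (w \<ominus>\<^bsub>A\<^esub> z) = \<zero>\<^bsub>A\<^esub>"
    using D(1) wz by (simp add: mult_r_diff diff_zero_iff)
  then show ?thesis
    using star_mult_self_eq_zero[of "w \<ominus>\<^bsub>A\<^esub> z"] D(1) wz by (simp add: diff_zero_iff)
qed

lemma carrier_eqI:
  "\<lbrakk>w \<in> carrier A; z \<in> carrier A; \<And>x. x \<in> carrier A \<Longrightarrow> x \<otimes>\<^bsub>A\<^esub> w = x \<otimes>\<^bsub>A\<^esub> z\<rbrakk> \<Longrightarrow> w = z"
  by (rule star_ideal_eqI[OF star_ideal_carrier])

lemma metric_space: "Metric_space (carrier A) (cdist A)"
proof
  show "0 \<le> cdist A x y" for x y by (simp add: cdist_def)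
  show "cdist A x y = cdist A y x" for x y
    using norm_diff_commute[of x y] by (simp add: cdist_def)
  show "x \<in> carrier A \<Longrightarrow> y \<in> carrier A \<Longrightarrow> (cdist A x y = 0) = (x = y)" for x y
    by (simp add: cdist_def norm_eq_0_iff diff_zero_iff)
  show "\<lbrakk>x \<in> carrier A; y \<in> carrier A; z \<in> carrier A\<rbrakk> \<Longrightarrow> cdist A x z \<le> cdist A x y + cdist A y z"
    for x y z using norm_diff_triangle[of x y z] by (simp add: cdist_def)
qed

lemma topspace_norm [simp]: "topspace (norm_topology A) = carrier A"
  unfolding norm_topology_def by (rule Metric_space.topspace_mtopology[OF metric_space])

lemma openin_norm_iff: "openin (norm_topology A) U \<longleftrightarrow> U \<subseteq> carrier A \<and>
    (\<forall>x\<in>U. \<exists>r>0. \<forall>y\<in>carrier A. cnorm A (y \<ominus>\<^bsub>A\<^esub> x) < r \<longrightarrow> y \<in> U)"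
proof -
  have ball: "Metric_space.mball (carrier A) (cdist A) x r \<subseteq> U \<longleftrightarrow>
      (\<forall>y\<in>carrier A. cnorm A (y \<ominus>\<^bsub>A\<^esub> x) < r \<longrightarrow> y \<in> U)" if "x \<in> carrier A" for x r
    unfolding Metric_space.mball_def[OF metric_space] using that
    by (auto simp: cdist_def norm_diff_commute[of x])
  show ?thesis
    unfolding norm_topology_def Metric_space.openin_mtopology[OF metric_space]
    using ball by (auto simp: subset_iff)
qed

lemma openin_norm_ball: 
  assumes x: "x \<in> carrier A"
  shows "openin (norm_topology A) {y \<in> carrier A. cnorm A (y \<ominus>\<^bsub>A\<^esub> x) < r}"
  unfolding openin_norm_iff
proof (intro conjI ballI)
  fix y assume "y \<in> {y \<in> carrier A. cnorm A (y \<ominus>\<^bsub>A\<^esub> x) < r}"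
  then have y: "y \<in> carrier A" "cnorm A (y \<ominus>\<^bsub>A\<^esub> x) < r" by auto
  show "\<exists>s>0. \<forall>z\<in>carrier A. cnorm A (z \<ominus>\<^bsub>A\<^esub> y) < s \<longrightarrow> z \<in> {y \<in> carrier A. cnorm A (y \<ominus>\<^bsub>A\<^esub> x) < r}"
  proof (intro exI[of _ "r - cnorm A (y \<ominus>\<^bsub>A\<^esub> x)"] conjI ballI impI)
    fix z assume "z \<in> carrier A" "cnorm A (z \<ominus>\<^bsub>A\<^esub> y) < r - cnorm A (y \<ominus>\<^bsub>A\<^esub> x)"
    then show "z \<in> {y \<in> carrier A. cnorm A (y \<ominus>\<^bsub>A\<^esub> x) < r}"
      using norm_diff_triangle[of z y x] x y by auto
  qed (use y in auto)
qed auto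

lemma closedin_norm_iff: "closedin (norm_topology A) J \<longleftrightarrow> J \<subseteq> carrier A \<and>
    (\<forall>x\<in>carrier A. (\<forall>r>0. \<exists>y\<in>J. cnorm A (y \<ominus>\<^bsub>A\<^esub> x) < r) \<longrightarrow> x \<in> J)"
proof -
  have "(\<forall>x\<in>carrier A - J. \<exists>r>0. \<forall>y\<in>carrier A. cnorm A (y \<ominus>\<^bsub>A\<^esub> x) < r \<longrightarrow> y \<in> carrier A - J)
     \<longleftrightarrow> (\<forall>x\<in>carrier A. (\<forall>r>0. \<exists>y\<in>J. cnorm A (y \<ominus>\<^bsub>A\<^esub> x) < r) \<longrightarrow> x \<in> J)"
    if "J \<subseteq> carrier A"
  proof (intro iffI ballI impI)
    fix x assume *: "\<forall>x\<in>carrier A - J. \<exists>r>0. \<forall>y\<in>carrier A. cnorm A (y \<ominus>\<^bsub>A\<^esub> x) < r \<longrightarrow> y \<in> carrier A - J"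
      and x: "x \<in> carrier A" "\<forall>r>0. \<exists>y\<in>J. cnorm A (y \<ominus>\<^bsub>A\<^esub> x) < r"
    show "x \<in> J"
    proof (rule ccontr)
      assume "x \<notin> J"
      then obtain r where "r > 0" and r: "\<forall>y\<in>carrier A. cnorm A (y \<ominus>\<^bsub>A\<^esub> x) < r \<longrightarrow> y \<in> carrier A - J"
        using * x(1) by auto
      then obtain y where "y \<in> J" "cnorm A (y \<ominus>\<^bsub>A\<^esub> x) < r" using x(2) by auto
      then show False using r that by auto
    qed
  next
    fix x assume *: "\<forall>x\<in>carrier A. (\<forall>r>0. \<exists>y\<in>J. cnorm A (y \<ominus>\<^bsub>A\<^esub> x) < r) \<longrightarrow> x \<in> J"
      and x: "x \<in> carrier A - J"
    then obtain r where "r > 0" "\<not> (\<exists>y\<in>J. cnorm A (y \<ominus>\<^bsub>A\<^esub> x) < r)" by blast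
    then show "\<exists>r>0. \<forall>y\<in>carrier A. cnorm A (y \<ominus>\<^bsub>A\<^esub> x) < r \<longrightarrow> y \<in> carrier A - J" by auto
  qed
  then show ?thesis
    unfolding closedin_def openin_norm_iff topspace_norm by auto
qed

end

section \<open>Closed ideals contain the elements whose squares they contain\<close>

context pre_cstar_algebra begin

text \<open>A substitute for the positivity of \<open>z\<^sup>* z\<close>: under the hypothesis the cross terms cancel in
  \<open>(z \<plusminus> i y)\<^sup>* (z \<plusminus> i y)\<close>, so both \<open>z + i y\<close> and \<open>z - i y\<close> have squared norm \<open>\<parallel>z\<^sup>* z + y\<^sup>* y\<parallel>\<close>, and
  \<open>y\<close> is half their difference up to a phase.\<close>

lemma norm_le_sum_of_squares:
  assumes z: "z \<in> carrier A" and y: "y \<in> carrier A"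
    and comm: "star A z \<otimes>\<^bsub>A\<^esub> y = star A y \<otimes>\<^bsub>A\<^esub> z"
  shows "(cnorm A y)\<^sup>2 \<le> cnorm A (star A z \<otimes>\<^bsub>A\<^esub> z \<oplus>\<^bsub>A\<^esub> star A y \<otimes>\<^bsub>A\<^esub> y)"
proof -
  let ?s = "star A z \<otimes>\<^bsub>A\<^esub> z \<oplus>\<^bsub>A\<^esub> star A y \<otimes>\<^bsub>A\<^esub> y"
  have sq: "(cnorm A (z \<oplus>\<^bsub>A\<^esub> c \<odot> y))\<^sup>2 = cnorm A ?s" if c: "cnj c = - c" "c * c = -1" for c
  proof -
    have "star A (z \<oplus>\<^bsub>A\<^esub> c \<odot> y) \<otimes>\<^bsub>A\<^esub> (z \<oplus>\<^bsub>A\<^esub> c \<odot> y)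
      = (star A z \<otimes>\<^bsub>A\<^esub> z \<oplus>\<^bsub>A\<^esub> (- c) \<odot> (star A z \<otimes>\<^bsub>A\<^esub> y))
        \<oplus>\<^bsub>A\<^esub> (c \<odot> (star A z \<otimes>\<^bsub>A\<^esub> y) \<oplus>\<^bsub>A\<^esub> star A y \<otimes>\<^bsub>A\<^esub> y)"
      using z y c by (simp add: star_add star_smult mult_l_distr mult_r_distr smult_mult_l
          smult_mult_r smult_smult smult_add comm)
    also have "\<dots> = ?s \<oplus>\<^bsub>A\<^esub> ((- c) \<odot> (star A z \<otimes>\<^bsub>A\<^esub> y) \<oplus>\<^bsub>A\<^esub> c \<odot> (star A z \<otimes>\<^bsub>A\<^esub> y))"
      using z y by (simp add: M.a_ac)
    also have "\<dots> = ?s" using z y add_smult[of "star A z \<otimes>\<^bsub>A\<^esub> y" "- c" c] by simp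
    finally show ?thesis using norm_star_mult[of "z \<oplus>\<^bsub>A\<^esub> c \<odot> y"] z y by simp
  qed
  let ?p = "z \<oplus>\<^bsub>A\<^esub> \<i> \<odot> y" and ?q = "z \<oplus>\<^bsub>A\<^esub> (- \<i>) \<odot> y"
  have "(cnorm A ?p)\<^sup>2 = (cnorm A ?q)\<^sup>2" using sq[of \<i>] sq[of "- \<i>"] by simp
  then have eq: "cnorm A ?p = cnorm A ?q" using z y by (simp add: power2_eq_iff_nonneg)
  have "?p \<ominus>\<^bsub>A\<^esub> ?q = (2 * \<i>) \<odot> y"
  proof -
    have "?p \<ominus>\<^bsub>A\<^esub> ?q = \<i> \<odot> y \<oplus>\<^bsub>A\<^esub> \<i> \<odot> y \<oplus>\<^bsub>A\<^esub> (z \<oplus>\<^bsub>A\<^esub> (-1) \<odot> z)"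
      using z y by (simp add: diff_eq_smult smult_add smult_smult M.a_ac)
    also have "z \<oplus>\<^bsub>A\<^esub> (-1) \<odot> z = \<zero>\<^bsub>A\<^esub>"
      using z by (simp add: diff_eq_smult[symmetric] diff_zero_iff)
    finally show ?thesis using z y add_smult[of y \<i> \<i>] by simp
  qed
  then have "2 * cnorm A y \<le> 2 * cnorm A ?p"
    using norm_diff[of ?p ?q] eq z y by (simp add: norm_smult norm_mult)
  then have "(cnorm A y)\<^sup>2 \<le> (cnorm A ?p)\<^sup>2" using z y by (intro power_mono) auto
  then show ?thesis using sq[of \<i>] by simp
qed

text \<open>The scalar sequence below increases to \<open>1\<close>; it majorizes the iteration for
  \<open>1 - sqrt (1 - k)\<close> in the next proof.\<close>

lemma sqrt_iteration_majorant:
  fixes s :: "nat \<Rightarrow> real"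
  assumes s0: "s 0 = 0" and s: "\<And>n. s (Suc n) = (1 + (s n)\<^sup>2) / 2"
  shows "0 \<le> s n" and "s n \<le> 1" and "(\<lambda>n. s (Suc n) - s n) \<longlonglongrightarrow> 0"
proof -
  have b: "0 \<le> s n \<and> s n \<le> 1" for n
  proof (induction n)
    case (Suc n) then show ?case using power_le_one[of "s n" 2] by (simp add: s)
  qed (simp add: s0)
  then show "0 \<le> s n" "s n \<le> 1" by auto
  have "s n \<le> s (Suc n)" for n
    using zero_le_power2[of "1 - s n"] by (simp add: s power2_eq_square algebra_simps)
  then have "incseq s" by (rule incseq_SucI)
  then obtain l where l: "s \<longlonglongrightarrow> l" using incseq_convergent[of s 1] b by blast
  show "(\<lambda>n. s (Suc n) - s n) \<longlonglongrightarrow> 0"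
    using tendsto_diff[OF LIMSEQ_Suc[OF l] l] by simp
qed

text \<open>In terms of spectra: \<open>1 - h\<^sup>2\<close> has its spectrum in \<open>[0, 1]\<close>.  Let \<open>w\<^sub>n\<close> be the fixed-point
  iteration for \<open>1 - sqrt (1 - h\<^sup>2)\<close>.  Then \<open>h \<plusminus> i (1 - w\<^sub>n)\<close> are unitary up to an error
  that tends to \<open>0\<close>, so \<open>1 - w\<^sub>n\<close> and its square, which is \<open>1 - h\<^sup>2\<close> up to an error, are almost
  contractions.\<close>

lemma norm_one_minus_square:
  assumes h: "h \<in> carrier A" and hs: "star A h = h" and h1: "cnorm A h \<le> 1"
    and x: "x \<in> carrier A"
  shows "cnorm A (x \<ominus>\<^bsub>A\<^esub> h \<otimes>\<^bsub>A\<^esub> h \<otimes>\<^bsub>A\<^esub> x) \<le> cnorm A x"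
proof -
  define k where "k = h \<otimes>\<^bsub>A\<^esub> h"
  define s :: "nat \<Rightarrow> real" where "s = rec_nat 0 (\<lambda>_ r. (1 + r\<^sup>2) / 2)"
  define w where "w = rec_nat \<zero>\<^bsub>A\<^esub> (\<lambda>_ v. (1/2) \<odot> (k \<oplus>\<^bsub>A\<^esub> v \<otimes>\<^bsub>A\<^esub> v))"
  have s0: "s 0 = 0" and sS: "s (Suc n) = (1 + (s n)\<^sup>2) / 2" for n by (simp_all add: s_def)
  have w0: "w 0 = \<zero>\<^bsub>A\<^esub>" and wS: "w (Suc n) = (1/2) \<odot> (k \<oplus>\<^bsub>A\<^esub> w n \<otimes>\<^bsub>A\<^esub> w n)" for n
    by (simp_all add: w_def)
  note s_bounds = sqrt_iteration_majorant[OF s0 sS]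
  have k: "k \<in> carrier A" and ks: "star A k = k"
    using h hs by (auto simp: k_def star_mult)
  have k1: "cnorm A k \<le> 1" using mult_bound[OF h h h1 h1] by (simp add: k_def)
  have w: "w n \<in> carrier A" for n by (induction n) (auto simp: w0 wS k)
  have ws: "star A (w n) = w n" for n
    by (induction n) (auto simp: w0 wS star_smult star_add star_mult ks k w)
  have hw: "h \<otimes>\<^bsub>A\<^esub> w n = w n \<otimes>\<^bsub>A\<^esub> h" for n
  proof (induction n)
    case (Suc n)
    have "h \<otimes>\<^bsub>A\<^esub> (w n \<otimes>\<^bsub>A\<^esub> w n) = w n \<otimes>\<^bsub>A\<^esub> w n \<otimes>\<^bsub>A\<^esub> h"
      using Suc h w by (metis mult_assoc)
    moreover have "h \<otimes>\<^bsub>A\<^esub> k = k \<otimes>\<^bsub>A\<^esub> h" using h by (simp add: k_def mult_assoc)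
    ultimately show ?case using h w k
      by (simp add: wS smult_mult_l smult_mult_r mult_l_distr mult_r_distr)
  qed (simp add: w0 h)
  have kw: "k \<otimes>\<^bsub>A\<^esub> w n = w n \<otimes>\<^bsub>A\<^esub> k" for n
    unfolding k_def using hw h w by (metis mult_assoc)
  have ww: "w (Suc n) \<otimes>\<^bsub>A\<^esub> w n = w n \<otimes>\<^bsub>A\<^esub> w (Suc n)" for n
    using k w kw by (simp add: wS smult_mult_l smult_mult_r mult_l_distr mult_r_distr mult_assoc)
  have w_le: "cnorm A (w n) \<le> s n" for n
  proof (induction n)
    case (Suc n)
    have "cnorm A (k \<oplus>\<^bsub>A\<^esub> w n \<otimes>\<^bsub>A\<^esub> w n) \<le> 1 + s n * s n"
      using norm_add[of k "w n \<otimes>\<^bsub>A\<^esub> w n"] k1 mult_bound[OF w w Suc Suc] k w by force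
    then show ?case using k w by (simp add: wS sS norm_smult norm_divide power2_eq_square)
  qed (simp add: w0 s0)
  have step_le: "cnorm A (w (Suc n) \<ominus>\<^bsub>A\<^esub> w n) \<le> s (Suc n) - s n" for n
  proof (induction n)
    case 0
    then show ?case using k k1 by (simp add: w0 wS s0 sS diff_eq_smult norm_smult norm_divide)
  next
    case (Suc n)
    let ?d = "w (Suc n) \<ominus>\<^bsub>A\<^esub> w n" and ?a = "w (Suc n) \<oplus>\<^bsub>A\<^esub> w n"
    have "?d \<otimes>\<^bsub>A\<^esub> ?a = w (Suc n) \<otimes>\<^bsub>A\<^esub> w (Suc n) \<ominus>\<^bsub>A\<^esub> w n \<otimes>\<^bsub>A\<^esub> w n"
    proof -
      have grp: "(a \<ominus>\<^bsub>A\<^esub> b) \<oplus>\<^bsub>A\<^esub> (b \<ominus>\<^bsub>A\<^esub> c) = a \<ominus>\<^bsub>A\<^esub> c"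
        if "a \<in> carrier A" "b \<in> carrier A" "c \<in> carrier A" for a b c
        using that by (simp add: a_minus_def M.minus_add M.a_ac M.r_neg1 M.r_neg2)
      have "?d \<otimes>\<^bsub>A\<^esub> ?a = (w (Suc n) \<otimes>\<^bsub>A\<^esub> w (Suc n) \<ominus>\<^bsub>A\<^esub> w n \<otimes>\<^bsub>A\<^esub> w (Suc n))
          \<oplus>\<^bsub>A\<^esub> (w n \<otimes>\<^bsub>A\<^esub> w (Suc n) \<ominus>\<^bsub>A\<^esub> w n \<otimes>\<^bsub>A\<^esub> w n)"
        using w[of n] w[of "Suc n"] by (simp add: mult_r_distr mult_l_diff ww)
      then show ?thesis using grp w by simp
    qed
    moreover have "w (Suc (Suc n)) \<ominus>\<^bsub>A\<^esub> w (Suc n)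
        = (1/2) \<odot> (w (Suc n) \<otimes>\<^bsub>A\<^esub> w (Suc n) \<ominus>\<^bsub>A\<^esub> w n \<otimes>\<^bsub>A\<^esub> w n)"
    proof -
      have grp: "(1/2) \<odot> (k \<oplus>\<^bsub>A\<^esub> a) \<ominus>\<^bsub>A\<^esub> (1/2) \<odot> (k \<oplus>\<^bsub>A\<^esub> b) = (1/2) \<odot> (a \<ominus>\<^bsub>A\<^esub> b)"
        if "a \<in> carrier A" "b \<in> carrier A" for a b
      proof -
        have "(1/2) \<odot> (k \<oplus>\<^bsub>A\<^esub> a) \<ominus>\<^bsub>A\<^esub> (1/2) \<odot> (k \<oplus>\<^bsub>A\<^esub> b) = (1/2) \<odot> ((k \<oplus>\<^bsub>A\<^esub> a) \<ominus>\<^bsub>A\<^esub> (k \<oplus>\<^bsub>A\<^esub> b))"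
          using that k by (simp add: diff_eq_smult smult_smult smult_add)
        also have "(k \<oplus>\<^bsub>A\<^esub> a) \<ominus>\<^bsub>A\<^esub> (k \<oplus>\<^bsub>A\<^esub> b) = a \<ominus>\<^bsub>A\<^esub> b"
        proof -
          have "(k \<oplus>\<^bsub>A\<^esub> a) \<ominus>\<^bsub>A\<^esub> (k \<oplus>\<^bsub>A\<^esub> b) = (k \<ominus>\<^bsub>A\<^esub> k) \<oplus>\<^bsub>A\<^esub> (a \<ominus>\<^bsub>A\<^esub> b)"
            using that k by (simp add: a_minus_def M.minus_add M.a_ac)
          then show ?thesis using that k by (simp add: a_minus_def M.r_neg)
        qed
        finally show ?thesis .
      qed
      show ?thesis unfolding wS[of "Suc n"] by (subst wS[of n]) (rule grp; use w in auto)
    qed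
    ultimately have "cnorm A (w (Suc (Suc n)) \<ominus>\<^bsub>A\<^esub> w (Suc n)) = cnorm A (?d \<otimes>\<^bsub>A\<^esub> ?a) / 2"
      using w by (simp add: norm_smult norm_divide)
    also have "\<dots> \<le> (s (Suc n) - s n) * (s (Suc n) + s n) / 2"
      using mult_bound[of ?d ?a "s (Suc n) - s n" "s (Suc n) + s n"] Suc
        norm_add[of "w (Suc n)" "w n"] w_le[of n] w_le[of "Suc n"] w by force
    also have "\<dots> = s (Suc (Suc n)) - s (Suc n)"
      by (simp only: sS[of "Suc n"]) (subst sS[of n], simp add: field_simps power2_eq_square sS)
    finally show ?case .
  qed
  \<comment> \<open>\<open>Y n\<close> is multiplication by \<open>1 - w n\<close>, and \<open>e n\<close> is the error in \<open>(1 - w n)\<^sup>2 = 1 - k + e n\<close>.\<close>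
  define e where "e n = 2 \<odot> (w (Suc n) \<ominus>\<^bsub>A\<^esub> w n)" for n
  define \<delta> where "\<delta> n = 2 * (s (Suc n) - s n)" for n
  have e: "e n \<in> carrier A" for n using w by (simp add: e_def)
  have e_le: "cnorm A (e n) \<le> \<delta> n" for n
    using step_le[of n] w by (simp add: e_def \<delta>_def norm_smult)
  have e_eq: "e n = (k \<oplus>\<^bsub>A\<^esub> w n \<otimes>\<^bsub>A\<^esub> w n) \<ominus>\<^bsub>A\<^esub> w n \<ominus>\<^bsub>A\<^esub> w n" for n
  proof -
    have "e n = (k \<oplus>\<^bsub>A\<^esub> w n \<otimes>\<^bsub>A\<^esub> w n) \<oplus>\<^bsub>A\<^esub> ((-1) + (-1)) \<odot> w n"
      using k w by (simp add: e_def wS diff_eq_smult smult_add smult_smult)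
    then show ?thesis using k w
      unfolding add_smult[OF w] by (simp add: diff_eq_smult M.a_ac)
  qed
  define Y where "Y n z = z \<ominus>\<^bsub>A\<^esub> w n \<otimes>\<^bsub>A\<^esub> z" for n z
  have Y: "z \<in> carrier A \<Longrightarrow> Y n z \<in> carrier A" for n z using w by (simp add: Y_def)
  have grp: "(a \<ominus>\<^bsub>A\<^esub> b) \<ominus>\<^bsub>A\<^esub> (b \<ominus>\<^bsub>A\<^esub> c) = (a \<ominus>\<^bsub>A\<^esub> g) \<oplus>\<^bsub>A\<^esub> (((g \<oplus>\<^bsub>A\<^esub> c) \<ominus>\<^bsub>A\<^esub> b) \<ominus>\<^bsub>A\<^esub> b)"
    if "a \<in> carrier A" "b \<in> carrier A" "c \<in> carrier A" "g \<in> carrier A" for a b c g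
  proof -
    have "(a \<ominus>\<^bsub>A\<^esub> g) \<oplus>\<^bsub>A\<^esub> (((g \<oplus>\<^bsub>A\<^esub> c) \<ominus>\<^bsub>A\<^esub> b) \<ominus>\<^bsub>A\<^esub> b)
        = (g \<ominus>\<^bsub>A\<^esub> g) \<oplus>\<^bsub>A\<^esub> ((a \<ominus>\<^bsub>A\<^esub> b) \<ominus>\<^bsub>A\<^esub> (b \<ominus>\<^bsub>A\<^esub> c))"
      using that by (simp add: a_minus_def M.minus_add M.a_ac)
    then show ?thesis using that by (simp add: a_minus_def M.r_neg)
  qed
  have YY: "Y n (Y n z) = (z \<ominus>\<^bsub>A\<^esub> k \<otimes>\<^bsub>A\<^esub> z) \<oplus>\<^bsub>A\<^esub> e n \<otimes>\<^bsub>A\<^esub> z" if z: "z \<in> carrier A" for n z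
  proof -
    have "Y n (Y n z) = (z \<ominus>\<^bsub>A\<^esub> w n \<otimes>\<^bsub>A\<^esub> z) \<ominus>\<^bsub>A\<^esub> (w n \<otimes>\<^bsub>A\<^esub> z \<ominus>\<^bsub>A\<^esub> w n \<otimes>\<^bsub>A\<^esub> w n \<otimes>\<^bsub>A\<^esub> z)"
      using z w by (simp add: Y_def mult_r_diff mult_assoc)
    also have "\<dots> = (z \<ominus>\<^bsub>A\<^esub> k \<otimes>\<^bsub>A\<^esub> z)
        \<oplus>\<^bsub>A\<^esub> (((k \<otimes>\<^bsub>A\<^esub> z \<oplus>\<^bsub>A\<^esub> w n \<otimes>\<^bsub>A\<^esub> w n \<otimes>\<^bsub>A\<^esub> z) \<ominus>\<^bsub>A\<^esub> w n \<otimes>\<^bsub>A\<^esub> z) \<ominus>\<^bsub>A\<^esub> w n \<otimes>\<^bsub>A\<^esub> z)"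
      using z w k by (intro grp) auto
    also have "((k \<otimes>\<^bsub>A\<^esub> z \<oplus>\<^bsub>A\<^esub> w n \<otimes>\<^bsub>A\<^esub> w n \<otimes>\<^bsub>A\<^esub> z) \<ominus>\<^bsub>A\<^esub> w n \<otimes>\<^bsub>A\<^esub> z) \<ominus>\<^bsub>A\<^esub> w n \<otimes>\<^bsub>A\<^esub> z = e n \<otimes>\<^bsub>A\<^esub> z"
      using z w k by (simp add: e_eq mult_l_diff mult_l_distr)
    finally show ?thesis .
  qed
  have Y_le: "(cnorm A (Y n z))\<^sup>2 \<le> (1 + \<delta> n) * (cnorm A z)\<^sup>2" if z: "z \<in> carrier A" for n z
  proof -
    have adj: "star A (Y n z) \<otimes>\<^bsub>A\<^esub> v = star A z \<otimes>\<^bsub>A\<^esub> Y n v" if "v \<in> carrier A" for v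
      using that z w by (simp add: Y_def star_diff star_mult ws mult_l_diff mult_r_diff mult_assoc)
    have "Y n (h \<otimes>\<^bsub>A\<^esub> z) = h \<otimes>\<^bsub>A\<^esub> Y n z"
      unfolding Y_def using h w z hw[of n] by (simp add: mult_r_diff flip: mult_assoc)
    then have comm: "star A (h \<otimes>\<^bsub>A\<^esub> z) \<otimes>\<^bsub>A\<^esub> Y n z = star A (Y n z) \<otimes>\<^bsub>A\<^esub> (h \<otimes>\<^bsub>A\<^esub> z)"
      using adj[of "h \<otimes>\<^bsub>A\<^esub> z"] h z Y by (simp add: star_mult hs mult_assoc)
    have "star A (h \<otimes>\<^bsub>A\<^esub> z) \<otimes>\<^bsub>A\<^esub> (h \<otimes>\<^bsub>A\<^esub> z) \<oplus>\<^bsub>A\<^esub> star A (Y n z) \<otimes>\<^bsub>A\<^esub> Y n z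
        = star A z \<otimes>\<^bsub>A\<^esub> (k \<otimes>\<^bsub>A\<^esub> z) \<oplus>\<^bsub>A\<^esub> star A z \<otimes>\<^bsub>A\<^esub> ((z \<ominus>\<^bsub>A\<^esub> k \<otimes>\<^bsub>A\<^esub> z) \<oplus>\<^bsub>A\<^esub> e n \<otimes>\<^bsub>A\<^esub> z)"
    proof -
      have "star A (h \<otimes>\<^bsub>A\<^esub> z) \<otimes>\<^bsub>A\<^esub> (h \<otimes>\<^bsub>A\<^esub> z) = star A z \<otimes>\<^bsub>A\<^esub> (k \<otimes>\<^bsub>A\<^esub> z)"
        using h z by (simp add: star_mult hs k_def mult_assoc)
      then show ?thesis unfolding adj[OF Y[OF z]] YY[OF z] by simp
    qed
    also have "\<dots> = star A z \<otimes>\<^bsub>A\<^esub> (k \<otimes>\<^bsub>A\<^esub> z \<oplus>\<^bsub>A\<^esub> ((z \<ominus>\<^bsub>A\<^esub> k \<otimes>\<^bsub>A\<^esub> z) \<oplus>\<^bsub>A\<^esub> e n \<otimes>\<^bsub>A\<^esub> z))"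
      using z k e by (simp add: mult_r_distr)
    also have "k \<otimes>\<^bsub>A\<^esub> z \<oplus>\<^bsub>A\<^esub> ((z \<ominus>\<^bsub>A\<^esub> k \<otimes>\<^bsub>A\<^esub> z) \<oplus>\<^bsub>A\<^esub> e n \<otimes>\<^bsub>A\<^esub> z) = z \<oplus>\<^bsub>A\<^esub> e n \<otimes>\<^bsub>A\<^esub> z"
    proof -
      have "k \<otimes>\<^bsub>A\<^esub> z \<oplus>\<^bsub>A\<^esub> ((z \<ominus>\<^bsub>A\<^esub> k \<otimes>\<^bsub>A\<^esub> z) \<oplus>\<^bsub>A\<^esub> e n \<otimes>\<^bsub>A\<^esub> z)
          = (k \<otimes>\<^bsub>A\<^esub> z \<ominus>\<^bsub>A\<^esub> k \<otimes>\<^bsub>A\<^esub> z) \<oplus>\<^bsub>A\<^esub> (z \<oplus>\<^bsub>A\<^esub> e n \<otimes>\<^bsub>A\<^esub> z)"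
        using z k e by (simp add: a_minus_def M.a_ac)
      then show ?thesis using z k e by (simp add: a_minus_def M.r_neg)
    qed
    finally have sum: "star A (h \<otimes>\<^bsub>A\<^esub> z) \<otimes>\<^bsub>A\<^esub> (h \<otimes>\<^bsub>A\<^esub> z) \<oplus>\<^bsub>A\<^esub> star A (Y n z) \<otimes>\<^bsub>A\<^esub> Y n z
        = star A z \<otimes>\<^bsub>A\<^esub> (z \<oplus>\<^bsub>A\<^esub> e n \<otimes>\<^bsub>A\<^esub> z)" .
    have "cnorm A (z \<oplus>\<^bsub>A\<^esub> e n \<otimes>\<^bsub>A\<^esub> z) \<le> (1 + \<delta> n) * cnorm A z"
      using norm_add[of z "e n \<otimes>\<^bsub>A\<^esub> z"] mult_bound[OF e z e_le order_refl, of n] z e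
      by (simp add: algebra_simps)
    then have "cnorm A (star A z \<otimes>\<^bsub>A\<^esub> (z \<oplus>\<^bsub>A\<^esub> e n \<otimes>\<^bsub>A\<^esub> z)) \<le> cnorm A z * ((1 + \<delta> n) * cnorm A z)"
      using z e by (intro mult_bound) auto
    then show ?thesis
      using norm_le_sum_of_squares[OF _ _ comm] h z Y sum by (simp add: power2_eq_square mult_ac)
  qed
  have \<delta>0: "0 \<le> \<delta> n" for n using e_le[of n] norm_nonneg[OF e[of n]] by linarith
  have main: "cnorm A (x \<ominus>\<^bsub>A\<^esub> k \<otimes>\<^bsub>A\<^esub> x) \<le> (1 + 2 * \<delta> n) * cnorm A x" for n
  proof -
    have "(cnorm A (Y n (Y n x)))\<^sup>2 \<le> (1 + \<delta> n) * ((1 + \<delta> n) * (cnorm A x)\<^sup>2)"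
      using Y_le[OF Y[OF x], of n n] mult_left_mono[OF Y_le[OF x, of n], of "1 + \<delta> n"] \<delta>0[of n]
      by linarith
    also have "\<dots> = ((1 + \<delta> n) * cnorm A x)\<^sup>2" by (simp add: power2_eq_square)
    finally have 1: "cnorm A (Y n (Y n x)) \<le> (1 + \<delta> n) * cnorm A x"
      by (rule power2_le_imp_le) (use \<delta>0[of n] norm_nonneg[OF x] in simp)
    have "x \<ominus>\<^bsub>A\<^esub> k \<otimes>\<^bsub>A\<^esub> x = Y n (Y n x) \<ominus>\<^bsub>A\<^esub> e n \<otimes>\<^bsub>A\<^esub> x"
      using x k e by (simp add: YY a_minus_def M.a_assoc M.r_neg)
    then have "cnorm A (x \<ominus>\<^bsub>A\<^esub> k \<otimes>\<^bsub>A\<^esub> x) \<le> cnorm A (Y n (Y n x)) + cnorm A (e n \<otimes>\<^bsub>A\<^esub> x)"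
      using x e Y by (simp add: norm_diff)
    then show ?thesis using 1 mult_bound[OF e x e_le order_refl, of n] by (simp add: algebra_simps)
  qed
  have "(\<lambda>n. (1 + 2 * \<delta> n) * cnorm A x) \<longlonglongrightarrow> (1 + 2 * (2 * 0)) * cnorm A x"
    unfolding \<delta>_def by (intro tendsto_intros s_bounds)
  then have "cnorm A (x \<ominus>\<^bsub>A\<^esub> k \<otimes>\<^bsub>A\<^esub> x) \<le> (1 + 2 * (2 * 0)) * cnorm A x"
    using main by (intro LIMSEQ_le_const) auto
  then show ?thesis by (simp add: k_def)
qed


text \<open>The sum \<open>\<Sum>j<m. (1 - k)\<^sup>j z\<close> of an ergodic mean.\<close>

primrec neumann_sum :: "'a \<Rightarrow> nat \<Rightarrow> 'a \<Rightarrow> 'a" where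
  "neumann_sum k 0 z = \<zero>\<^bsub>A\<^esub>"
| "neumann_sum k (Suc m) z = z \<oplus>\<^bsub>A\<^esub> (neumann_sum k m z \<ominus>\<^bsub>A\<^esub> k \<otimes>\<^bsub>A\<^esub> neumann_sum k m z)"

lemma neumann_sum_closed [simp]:
  "\<lbrakk>k \<in> carrier A; z \<in> carrier A\<rbrakk> \<Longrightarrow> neumann_sum k m z \<in> carrier A"
  by (induction m) auto

lemma neumann_sum_mult:
  "\<lbrakk>k \<in> carrier A; z \<in> carrier A; a \<in> carrier A\<rbrakk>
    \<Longrightarrow> neumann_sum k m z \<otimes>\<^bsub>A\<^esub> a = neumann_sum k m (z \<otimes>\<^bsub>A\<^esub> a)"
  by (induction m) (simp_all add: mult_l_distr mult_l_diff mult_assoc)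

lemma mult_neumann_sum:
  "\<lbrakk>k \<in> carrier A; z \<in> carrier A; a \<in> carrier A; a \<otimes>\<^bsub>A\<^esub> k = k \<otimes>\<^bsub>A\<^esub> a\<rbrakk>
    \<Longrightarrow> a \<otimes>\<^bsub>A\<^esub> neumann_sum k m z = neumann_sum k m (a \<otimes>\<^bsub>A\<^esub> z)"
proof (induction m)
  case (Suc m)
  let ?n = "neumann_sum k m z"
  have "a \<otimes>\<^bsub>A\<^esub> (k \<otimes>\<^bsub>A\<^esub> ?n) = k \<otimes>\<^bsub>A\<^esub> (a \<otimes>\<^bsub>A\<^esub> ?n)"
    using Suc.prems by (metis mult_assoc neumann_sum_closed)
  then show ?case using Suc by (simp add: mult_r_distr mult_r_diff)
qed simp

lemma neumann_sum_adjoint: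
  assumes k: "k \<in> carrier A" "star A k = k"
  shows "\<lbrakk>a \<in> carrier A; b \<in> carrier A\<rbrakk>
    \<Longrightarrow> star A (neumann_sum k m a) \<otimes>\<^bsub>A\<^esub> b = star A a \<otimes>\<^bsub>A\<^esub> neumann_sum k m b"
proof (induction m arbitrary: b)
  case (Suc m)
  have "k \<otimes>\<^bsub>A\<^esub> neumann_sum k m b = neumann_sum k m (k \<otimes>\<^bsub>A\<^esub> b)"
    by (rule mult_neumann_sum) (use k Suc.prems in auto)
  then show ?case using Suc k
    by (simp add: star_add star_diff star_mult mult_l_distr mult_r_distr mult_l_diff mult_r_diff
        mult_assoc neumann_sum_mult)
qed simp

lemma neumann_sum_norm:
  assumes k: "k \<in> carrier A"
    and contr: "\<And>x. x \<in> carrier A \<Longrightarrow> cnorm A (x \<ominus>\<^bsub>A\<^esub> k \<otimes>\<^bsub>A\<^esub> x) \<le> cnorm A x"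
    and z: "z \<in> carrier A"
  shows "cnorm A (neumann_sum k m z) \<le> real m * cnorm A z"
proof (induction m)
  case (Suc m)
  let ?n = "neumann_sum k m z"
  have "cnorm A (neumann_sum k (Suc m) z) \<le> cnorm A z + cnorm A (?n \<ominus>\<^bsub>A\<^esub> k \<otimes>\<^bsub>A\<^esub> ?n)"
    using k z by (simp add: norm_add)
  then show ?case using contr[of ?n] Suc k z by (simp add: algebra_simps)
qed simp

text \<open>The telescoping \<open>k \<Sum>j<m. (1 - k)\<^sup>j = 1 - (1 - k)\<^sup>m\<close>.\<close>

lemma mult_neumann_sum_norm:
  assumes k: "k \<in> carrier A"
    and contr: "\<And>x. x \<in> carrier A \<Longrightarrow> cnorm A (x \<ominus>\<^bsub>A\<^esub> k \<otimes>\<^bsub>A\<^esub> x) \<le> cnorm A x"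
    and z: "z \<in> carrier A"
  shows "cnorm A (k \<otimes>\<^bsub>A\<^esub> neumann_sum k m z) \<le> 2 * cnorm A z"
proof -
  define T where "T = (\<lambda>x. x \<ominus>\<^bsub>A\<^esub> k \<otimes>\<^bsub>A\<^esub> x)"
  have T: "(T ^^ j) z \<in> carrier A \<and> cnorm A ((T ^^ j) z) \<le> cnorm A z" for j
  proof (induction j)
    case (Suc j)
    have "cnorm A (T ((T ^^ j) z)) \<le> cnorm A ((T ^^ j) z)"
      unfolding T_def by (rule contr) (use Suc in \<open>auto simp: T_def\<close>)
    then show ?case using Suc k by (auto simp: T_def)
  qed (use z in auto)
  have eq: "k \<otimes>\<^bsub>A\<^esub> neumann_sum k m z = z \<ominus>\<^bsub>A\<^esub> (T ^^ m) z"
  proof (induction m)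
    case 0 then show ?case using k z by (simp add: a_minus_def M.r_neg)
  next
    case (Suc m)
    let ?n = "neumann_sum k m z" and ?t = "(T ^^ m) z"
    note c = k z T[of m, THEN conjunct1]
    have "k \<otimes>\<^bsub>A\<^esub> neumann_sum k (Suc m) z
        = k \<otimes>\<^bsub>A\<^esub> z \<oplus>\<^bsub>A\<^esub> ((z \<ominus>\<^bsub>A\<^esub> ?t) \<ominus>\<^bsub>A\<^esub> k \<otimes>\<^bsub>A\<^esub> (z \<ominus>\<^bsub>A\<^esub> ?t))"
      using c Suc by (simp add: mult_r_distr mult_r_diff)
    also have "\<dots> = z \<ominus>\<^bsub>A\<^esub> (?t \<ominus>\<^bsub>A\<^esub> k \<otimes>\<^bsub>A\<^esub> ?t)"
      unfolding mult_r_diff[OF c(2,3,1)]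
      using c by (simp add: a_minus_def M.minus_add M.a_ac M.r_neg1 M.r_neg2)
    finally show ?case by (simp add: T_def)
  qed
  show ?thesis
    unfolding eq using norm_diff[of z "(T ^^ m) z"] T[of m] z by auto
qed

text \<open>Let \<open>h = z z\<^sup>*\<close> and \<open>k = h\<^sup>2\<close>, and let \<open>p\<^sub>m\<close> be the ergodic mean of the first \<open>m\<close> powers of \<open>1 - k\<close>,
  which is a contraction by \<open>norm_one_minus_square\<close>.  Then \<open>z - p\<^sub>m z\<close> is a multiple of \<open>k\<close> and thus
  lies in \<open>J\<close>, and telescoping gives \<open>\<parallel>k p\<^sub>m\<parallel> \<le> 2/m\<close>.  Since \<open>\<parallel>p\<^sub>m h\<parallel>\<^sup>2 \<le> \<parallel>k p\<^sub>m\<parallel>\<close> and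
  \<open>\<parallel>p\<^sub>m z\<parallel>\<^sup>2 \<le> \<parallel>p\<^sub>m h\<parallel>\<close>, the elements \<open>p\<^sub>m z\<close> tend to \<open>0\<close>, and \<open>z\<close> is a limit of elements of \<open>J\<close>.\<close>

lemma closed_star_ideal_self_mult_star:
  assumes J: "star_ideal J A" and cl: "closedin (norm_topology A) J"
    and z: "z \<in> carrier A" and zz: "z \<otimes>\<^bsub>A\<^esub> star A z \<in> J"
  shows "z \<in> J"
proof -
  note D = star_idealD[OF J]
  have unit: "v \<in> J"
    if v: "v \<in> carrier A" and vv: "v \<otimes>\<^bsub>A\<^esub> star A v \<in> J" and v1: "cnorm A v \<le> 1" for v
  proof -
    define h where "h = v \<otimes>\<^bsub>A\<^esub> star A v"
    define k where "k = h \<otimes>\<^bsub>A\<^esub> h"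
    define Q where "Q = neumann_sum k"
    have h: "h \<in> carrier A" "star A h = h" using v by (auto simp: h_def star_mult)
    have h1: "cnorm A h \<le> 1"
      using mult_bound[of v "star A v" 1 1] v v1 by (simp add: h_def)
    have k: "k \<in> carrier A" "star A k = k" using h by (auto simp: k_def star_mult)
    have kJ: "k \<in> J" using D(7)[OF vv] h by (simp add: k_def h_def)
    have contr: "cnorm A (x \<ominus>\<^bsub>A\<^esub> k \<otimes>\<^bsub>A\<^esub> x) \<le> cnorm A x" if "x \<in> carrier A" for x
      unfolding k_def using norm_one_minus_square[OF h h1 that] .
    have Qc: "x \<in> carrier A \<Longrightarrow> Q m x \<in> carrier A" for m x
      unfolding Q_def using k by simp
    have Qm: "x \<in> carrier A \<Longrightarrow> a \<in> carrier A \<Longrightarrow> Q m x \<otimes>\<^bsub>A\<^esub> a = Q m (x \<otimes>\<^bsub>A\<^esub> a)" for m x a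
      unfolding Q_def using k by (simp add: neumann_sum_mult)
    have Qa: "a \<in> carrier A \<Longrightarrow> b \<in> carrier A \<Longrightarrow> star A (Q m a) \<otimes>\<^bsub>A\<^esub> b = star A a \<otimes>\<^bsub>A\<^esub> Q m b"
      for m a b unfolding Q_def using neumann_sum_adjoint[OF k] by simp
    have Qn: "x \<in> carrier A \<Longrightarrow> cnorm A (Q m x) \<le> real m * cnorm A x" for m x
      unfolding Q_def by (rule neumann_sum_norm[OF k(1) contr])
    have Qk: "x \<in> carrier A \<Longrightarrow> cnorm A (Q m (k \<otimes>\<^bsub>A\<^esub> x)) \<le> 2 * cnorm A x" for m x
      using mult_neumann_sum_norm[OF k(1) contr, of x m] mult_neumann_sum[OF k(1) _ k(1), of x m]
      by (simp add: Q_def)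
    have Qk2: "cnorm A (Q m k) \<le> 2" for m
    proof (cases "cnorm A (Q m k) = 0")
      case False
      let ?y = "Q m k"
      have "cnorm A ?y * cnorm A ?y = cnorm A (Q m (k \<otimes>\<^bsub>A\<^esub> star A ?y))"
        using norm_mult_star[of ?y] Qm[of k "star A ?y" m] Qc k by (simp add: power2_eq_square)
      also have "\<dots> \<le> 2 * cnorm A ?y" using Qk[of "star A ?y" m] Qc k by simp
      finally show ?thesis using False norm_nonneg[OF Qc[OF k(1)], of m] by simp
    qed simp
    have Qh: "(cnorm A (Q m h))\<^sup>2 \<le> real m * 2" for m
    proof -
      have "h \<otimes>\<^bsub>A\<^esub> Q m x = Q m (h \<otimes>\<^bsub>A\<^esub> x)" if "x \<in> carrier A" for x
        unfolding Q_def using that h k by (intro mult_neumann_sum) (auto simp: k_def mult_assoc)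
      then have "star A (Q m h) \<otimes>\<^bsub>A\<^esub> Q m h = Q m (Q m k)"
        using Qa[of h "Q m h" m] Qc h by (simp add: k_def)
      then have "(cnorm A (Q m h))\<^sup>2 = cnorm A (Q m (Q m k))"
        using norm_star_mult[of "Q m h"] Qc h by simp
      also have "\<dots> \<le> real m * 2"
        using Qn[OF Qc[OF k(1)], of m m] mult_left_mono[OF Qk2[of m], of "real m"] by linarith
      finally show ?thesis .
    qed
    have Qv: "(cnorm A (Q m v))\<^sup>2 \<le> real m * sqrt (real m * 2)" for m
    proof -
      have "v \<otimes>\<^bsub>A\<^esub> star A (Q m v) = star A (Q m h)"
        using Qm[of v "star A v" m, symmetric] v Qc by (simp add: h_def star_mult)
      then have "Q m v \<otimes>\<^bsub>A\<^esub> star A (Q m v) = Q m (star A (Q m h))"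
        using Qm[of v "star A (Q m v)" m] v Qc by simp
      then have "(cnorm A (Q m v))\<^sup>2 = cnorm A (Q m (star A (Q m h)))"
        using norm_mult_star[of "Q m v"] Qc v by simp
      also have "\<dots> \<le> real m * cnorm A (Q m h)"
        using Qn[of "star A (Q m h)" m] Qc h by simp
      also have "\<dots> \<le> real m * sqrt (real m * 2)"
        using real_le_rsqrt[OF Qh] by (intro mult_left_mono) auto
      finally show ?thesis .
    qed
    have QJ: "real m \<odot> v \<ominus>\<^bsub>A\<^esub> Q m v \<in> J" for m
    proof (induction m)
      case 0 then show ?case using D(2) v by (simp add: Q_def diff_eq_smult)
    next
      case (Suc m)
      have "complex_of_real (real (Suc m)) \<odot> v = v \<oplus>\<^bsub>A\<^esub> real m \<odot> v"
        using add_smult[OF v, of 1 "real m"] v by simp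
      then have "real (Suc m) \<odot> v \<ominus>\<^bsub>A\<^esub> Q (Suc m) v
          = (real m \<odot> v \<ominus>\<^bsub>A\<^esub> Q m v) \<oplus>\<^bsub>A\<^esub> k \<otimes>\<^bsub>A\<^esub> Q m v"
        using v k Qc by (simp add: Q_def a_minus_def M.minus_add M.a_ac M.r_neg1 M.r_neg2)
      then show ?case using Suc D(3) D(7)[OF kJ Qc[OF v]] by simp
    qed
    show ?thesis
    proof (rule closedin_norm_iff[THEN iffD1, OF cl, THEN conjunct2, rule_format, OF v])
      fix r :: real assume r: "r > 0"
      have "(\<lambda>m. sqrt (real m * 2) / real m) \<longlonglongrightarrow> 0" by real_asymp
      then have "\<forall>\<^sub>F m in sequentially. sqrt (real m * 2) / real m < r\<^sup>2"
        using r by (intro order_tendstoD) auto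
      then have "\<forall>\<^sub>F m in sequentially. 0 < m \<and> sqrt (real m * 2) / real m < r\<^sup>2"
        using eventually_gt_at_top[of 0] by (rule eventually_conj[rotated])
      then obtain m where m: "m > 0" "sqrt (real m * 2) / real m < r\<^sup>2"
        using eventually_happens'[OF sequentially_bot] by blast
      let ?y = "complex_of_real (1 / real m) \<odot> (real m \<odot> v \<ominus>\<^bsub>A\<^esub> Q m v)"
      have "?y = v \<ominus>\<^bsub>A\<^esub> complex_of_real (1 / real m) \<odot> Q m v"
        using m v Qc by (simp add: diff_eq_smult smult_add smult_smult)
      then have "?y \<ominus>\<^bsub>A\<^esub> v = \<ominus>\<^bsub>A\<^esub> (complex_of_real (1 / real m) \<odot> Q m v)"
        using v Qc by (simp add: a_minus_def M.a_ac M.r_neg M.r_neg1 M.r_neg2)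
      then have nrm: "cnorm A (?y \<ominus>\<^bsub>A\<^esub> v) = cnorm A (Q m v) / real m"
        using v Qc by (simp add: norm_smult norm_divide)
      have "(cnorm A (Q m v) / real m)\<^sup>2 \<le> real m * sqrt (real m * 2) / (real m)\<^sup>2"
        using Qv[of m] by (simp add: power_divide divide_right_mono)
      also have "\<dots> = sqrt (real m * 2) / real m" using m by (simp add: power2_eq_square)
      also have "\<dots> < r\<^sup>2" by (rule m)
      finally have "cnorm A (Q m v) / real m < r" using r by (simp add: power2_less_imp_less)
      then show "\<exists>y\<in>J. cnorm A (y \<ominus>\<^bsub>A\<^esub> v) < r"
        using D(4)[OF QJ[of m]] nrm by (intro bexI[of _ ?y]) auto
    qed
  qed
  \<comment> \<open>The general case follows by scaling \<open>z\<close> into the unit ball.\<close>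
  define c where "c = complex_of_real (1 / (1 + cnorm A z))"
  have pos: "0 < 1 + cnorm A z" using norm_nonneg[OF z] by linarith
  have "c \<odot> z \<in> J"
  proof (rule unit)
    show "c \<odot> z \<otimes>\<^bsub>A\<^esub> star A (c \<odot> z) \<in> J"
      using z D(4)[OF zz] by (simp add: star_smult smult_mult_l smult_mult_r smult_smult)
    show "cnorm A (c \<odot> z) \<le> 1"
      using z pos by (simp add: norm_smult c_def norm_divide del: of_real_add)
  qed (use z in auto)
  then have "inverse c \<odot> (c \<odot> z) \<in> J" by (rule D(4))
  moreover have "c \<noteq> 0" using pos by (simp add: c_def del: of_real_add)
  ultimately show ?thesis using z by (simp add: smult_smult)
qed

end

section \<open>The C*-algebra of bounded families of multipliers\<close>

context pre_cstar_algebra begin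

lemma mcomplete_iff: "Metric_space.mcomplete (carrier A) (cdist A) \<longleftrightarrow>
    (\<forall>\<xi>. (\<forall>n. \<xi> n \<in> carrier A) \<longrightarrow> (\<forall>e>0. \<exists>N. \<forall>m\<ge>N. \<forall>n\<ge>N. cnorm A (\<xi> m \<ominus>\<^bsub>A\<^esub> \<xi> n) < e) \<longrightarrow>
      (\<exists>l\<in>carrier A. (\<lambda>n. cnorm A (\<xi> n \<ominus>\<^bsub>A\<^esub> l)) \<longlonglongrightarrow> 0))" (is "_ \<longleftrightarrow> (\<forall>\<xi>. ?S \<xi>)")
proof -
  interpret ms: Metric_space "carrier A" "cdist A" by (rule metric_space)
  have lim: "(\<exists>l. limitin ms.mtopology \<xi> l sequentially) \<longleftrightarrow>
      (\<exists>l\<in>carrier A. (\<lambda>n. cnorm A (\<xi> n \<ominus>\<^bsub>A\<^esub> l)) \<longlonglongrightarrow> 0)" if "\<forall>n. \<xi> n \<in> carrier A" for \<xi>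
    using that by (auto simp: ms.limitin_metric_dist_null cdist_def)
  have cau: "ms.MCauchy \<xi> \<longleftrightarrow> (\<forall>n. \<xi> n \<in> carrier A) \<and>
      (\<forall>e>0. \<exists>N. \<forall>m\<ge>N. \<forall>n\<ge>N. cnorm A (\<xi> m \<ominus>\<^bsub>A\<^esub> \<xi> n) < e)" for \<xi>
  proof (cases "\<forall>n. \<xi> n \<in> carrier A")
    case True then show ?thesis unfolding ms.MCauchy_def cdist_def by (auto simp: image_subset_iff)
  next
    case False then show ?thesis unfolding ms.MCauchy_def by (auto simp: image_subset_iff)
  qed
  have "(ms.MCauchy \<xi> \<longrightarrow> (\<exists>l. limitin ms.mtopology \<xi> l sequentially)) \<longleftrightarrow> ?S \<xi>" for \<xi>
    using cau[of \<xi>] lim[of \<xi>] by blast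
  then show ?thesis unfolding ms.mcomplete_def by simp
qed

end

context cstar_algebra begin

lemma cauchy_limit:
  assumes "\<And>n. \<xi> n \<in> carrier A"
    and "\<And>e. e > 0 \<Longrightarrow> \<exists>N. \<forall>m\<ge>N. \<forall>n\<ge>N. cnorm A (\<xi> m \<ominus>\<^bsub>A\<^esub> \<xi> n) < e"
  obtains l where "l \<in> carrier A" "(\<lambda>n. cnorm A (\<xi> n \<ominus>\<^bsub>A\<^esub> l)) \<longlonglongrightarrow> 0"
  using complete assms unfolding mcomplete_iff by blast

lemma closed_subalgebra:
  assumes sub: "submodule S complex_ring A" and cl: "closedin (norm_topology A) S"
    and mult: "\<And>x y. \<lbrakk>x \<in> S; y \<in> S\<rbrakk> \<Longrightarrow> x \<otimes>\<^bsub>A\<^esub> y \<in> S" and star: "\<And>x. x \<in> S \<Longrightarrow> star A x \<in> S"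
  shows "cstar_algebra (A\<lparr>carrier := S\<rparr>)"
proof -
  let ?S = "A\<lparr>carrier := S\<rparr>"
  have SA: "x \<in> carrier A" if "x \<in> S" for x using submoduleE(1)[OF sub] that by auto
  have mod: "Module.module complex_ring ?S"
    by (rule submodule.submodule_is_module[OF sub]) (rule module_axioms)
  interpret S: pre_cstar_algebra ?S
  proof (intro pre_cstar_algebra.intro star_algebra.intro mod)
    show "star_algebra_axioms ?S"
      by unfold_locales (auto simp: SA mult star mult_assoc mult_l_distr mult_r_distr
          smult_mult_l smult_mult_r star_add star_smult star_mult)
    show "pre_cstar_algebra_axioms ?S"
      by unfold_locales (auto simp: SA norm_eq_0_iff norm_add norm_smult norm_mult norm_star_mult)
  qed
  have diff: "x \<ominus>\<^bsub>?S\<^esub> y = x \<ominus>\<^bsub>A\<^esub> y" if "x \<in> S" "y \<in> S" for x y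
    using S.diff_eq_smult[of x y] diff_eq_smult[of x y] that SA by simp
  have "Metric_space.mcomplete (carrier ?S) (cdist ?S)"
    unfolding S.mcomplete_iff
  proof (intro allI impI)
    fix \<xi> :: "nat \<Rightarrow> 'a"
    assume \<xi>: "\<forall>n. \<xi> n \<in> carrier ?S"
      and cau: "\<forall>e>0. \<exists>N. \<forall>m\<ge>N. \<forall>n\<ge>N. cnorm ?S (\<xi> m \<ominus>\<^bsub>?S\<^esub> \<xi> n) < e"
    then have \<xi>S: "\<xi> n \<in> S" for n by auto
    obtain l where l: "l \<in> carrier A" "(\<lambda>n. cnorm A (\<xi> n \<ominus>\<^bsub>A\<^esub> l)) \<longlonglongrightarrow> 0"
      by (rule cauchy_limit[of \<xi>]) (use \<xi>S SA cau diff in auto)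
    have "l \<in> S"
    proof (rule closedin_norm_iff[THEN iffD1, OF cl, THEN conjunct2, rule_format, OF l(1)])
      fix r :: real assume "r > 0"
      then have "\<forall>\<^sub>F n in sequentially. cnorm A (\<xi> n \<ominus>\<^bsub>A\<^esub> l) < r"
        using l(2) by (intro order_tendstoD)
      then show "\<exists>y\<in>S. cnorm A (y \<ominus>\<^bsub>A\<^esub> l) < r"
        using \<xi>S eventually_happens'[OF sequentially_bot] by blast
    qed
    then show "\<exists>l\<in>carrier ?S. (\<lambda>n. cnorm ?S (\<xi> n \<ominus>\<^bsub>?S\<^esub> l)) \<longlonglongrightarrow> 0"
      using l(2) \<xi>S diff by (intro bexI[of _ l]) auto
  qed
  then show ?thesis
    by (intro cstar_algebra.intro cstar_algebra_axioms.intro S.star_algebra_axioms)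
      (auto simp: SA norm_eq_0_iff norm_add norm_smult norm_mult norm_star_mult)
qed

end

definition is_adjoint :: "('a, 'm) cstar_algebra_scheme \<Rightarrow> ('a \<Rightarrow> 'a) \<Rightarrow> ('a \<Rightarrow> 'a) \<Rightarrow> bool"
  where "is_adjoint A T T' \<longleftrightarrow> T \<in> carrier A \<rightarrow> carrier A \<and> T' \<in> carrier A \<rightarrow> carrier A \<and>
    (\<forall>a\<in>carrier A. \<forall>b\<in>carrier A. star A (T a) \<otimes>\<^bsub>A\<^esub> b = star A a \<otimes>\<^bsub>A\<^esub> T' b)"

definition adjoint :: "('a, 'm) cstar_algebra_scheme \<Rightarrow> ('a \<Rightarrow> 'a) \<Rightarrow> ('a \<Rightarrow> 'a)"
  where "adjoint A T = restrict (SOME T'. is_adjoint A T T') (carrier A)"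

definition family_bound ::
  "('a, 'm) cstar_algebra_scheme \<Rightarrow> ('i \<Rightarrow> 'a \<Rightarrow> 'a) \<Rightarrow> real \<Rightarrow> bool"
  where "family_bound A F K \<longleftrightarrow> 0 \<le> K \<and> (\<forall>t. \<forall>b\<in>carrier A. cnorm A (F t b) \<le> K * cnorm A b)"

text \<open>A multiplier of \<open>A\<close> is encoded as an adjointable operator on \<open>A\<close>, viewed as a right Hilbert
  module over itself; such operators are automatically linear.  Values outside the carrier are
  fixed by extensionality, so that equality of families is equality of functions.\<close>

definition multiplier_families :: "('a, 'm) cstar_algebra_scheme \<Rightarrow> ('i \<Rightarrow> 'a \<Rightarrow> 'a) set"
  where "multiplier_families A = {F. (\<forall>t. F t \<in> extensional (carrier A)) \<and>
    (\<forall>t. \<exists>T'. is_adjoint A (F t) T') \<and> (\<exists>K. family_bound A F K)}"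

text \<open>This is \<open>\<ell>\<^sup>\<infinity>(I, M(A))\<close> with pointwise operations and the supremum norm.\<close>

definition multiplier_algebra :: "('a, 'm) cstar_algebra_scheme \<Rightarrow> ('i \<Rightarrow> 'a \<Rightarrow> 'a) cstar_algebra"
  where "multiplier_algebra A = \<lparr>
    carrier = multiplier_families A,
    monoid.mult = (\<lambda>F G t. \<lambda>b\<in>carrier A. F t (G t b)),
    one = (\<lambda>t. \<lambda>b\<in>carrier A. b),
    zero = (\<lambda>t. \<lambda>b\<in>carrier A. \<zero>\<^bsub>A\<^esub>),
    add = (\<lambda>F G t. \<lambda>b\<in>carrier A. F t b \<oplus>\<^bsub>A\<^esub> G t b),
    smult = (\<lambda>k F t. \<lambda>b\<in>carrier A. k \<odot>\<^bsub>A\<^esub> F t b),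
    star = (\<lambda>F t. adjoint A (F t)),
    cnorm = (\<lambda>F. Inf {K. family_bound A F K})\<rparr>"

lemma multiplier_algebra_simps [simp]:
  "carrier (multiplier_algebra A) = multiplier_families A"
  "b \<in> carrier A \<Longrightarrow> (F \<otimes>\<^bsub>multiplier_algebra A\<^esub> G) t b = F t (G t b)"
  "b \<in> carrier A \<Longrightarrow> \<zero>\<^bsub>multiplier_algebra A\<^esub> t b = \<zero>\<^bsub>A\<^esub>"
  "b \<in> carrier A \<Longrightarrow> (F \<oplus>\<^bsub>multiplier_algebra A\<^esub> G) t b = F t b \<oplus>\<^bsub>A\<^esub> G t b"
  "b \<in> carrier A \<Longrightarrow> (k \<odot>\<^bsub>multiplier_algebra A\<^esub> F) t b = k \<odot>\<^bsub>A\<^esub> F t b"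
  "star (multiplier_algebra A) F t = adjoint A (F t)"
  by (simp_all add: multiplier_algebra_def)

lemma multiplier_algebra_extensional:
  "(F \<otimes>\<^bsub>multiplier_algebra A\<^esub> G) t \<in> extensional (carrier A)"
  "\<zero>\<^bsub>multiplier_algebra A\<^esub> t \<in> extensional (carrier A)"
  "(F \<oplus>\<^bsub>multiplier_algebra A\<^esub> G) t \<in> extensional (carrier A)"
  "(k \<odot>\<^bsub>multiplier_algebra A\<^esub> F) t \<in> extensional (carrier A)"
  "star (multiplier_algebra A) F t \<in> extensional (carrier A)"
  by (simp_all add: multiplier_algebra_def adjoint_def)

context pre_cstar_algebra begin

lemma is_adjoint_unique:
  assumes T: "is_adjoint A T T1" "is_adjoint A T T2" and b: "b \<in> carrier A"
  shows "T1 b = T2 b"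
proof (rule carrier_eqI)
  fix x assume x: "x \<in> carrier A"
  have "star A (star A x) \<otimes>\<^bsub>A\<^esub> T1 b = star A (star A x) \<otimes>\<^bsub>A\<^esub> T2 b"
    using T b x unfolding is_adjoint_def by (metis star_closed)
  then show "x \<otimes>\<^bsub>A\<^esub> T1 b = x \<otimes>\<^bsub>A\<^esub> T2 b" using x by simp
qed (use T b in \<open>auto simp: is_adjoint_def\<close>)

lemma is_adjoint_sym: "is_adjoint A T T' \<Longrightarrow> is_adjoint A T' T"
proof -
  assume *: "is_adjoint A T T'"
  have "star A (T' a) \<otimes>\<^bsub>A\<^esub> b = star A a \<otimes>\<^bsub>A\<^esub> T b" if ab: "a \<in> carrier A" "b \<in> carrier A" for a b
  proof -
    have c: "T b \<in> carrier A" "T' a \<in> carrier A" using * ab by (auto simp: is_adjoint_def)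
    have "star A (star A (T b) \<otimes>\<^bsub>A\<^esub> a) = star A (star A b \<otimes>\<^bsub>A\<^esub> T' a)"
      using * ab by (simp add: is_adjoint_def)
    then show ?thesis using ab c by (simp add: star_mult)
  qed
  then show ?thesis using * by (auto simp: is_adjoint_def)
qed

text \<open>Moving an adjointable operator to the other factor shows that it commutes with everything that
  acts on the right factor; this is all that linearity needs.\<close>

lemma mult_adjointable:
  assumes T: "is_adjoint A T T'" and c: "x \<in> carrier A" "b \<in> carrier A"
  shows "x \<otimes>\<^bsub>A\<^esub> T b = star A (T' (star A x)) \<otimes>\<^bsub>A\<^esub> b"
  using is_adjoint_sym[OF T] c unfolding is_adjoint_def by auto

lemma adjointable_linear:
  assumes T: "is_adjoint A T T'"
  shows "\<lbrakk>a \<in> carrier A; b \<in> carrier A\<rbrakk> \<Longrightarrow> T (a \<oplus>\<^bsub>A\<^esub> b) = T a \<oplus>\<^bsub>A\<^esub> T b"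
    and "a \<in> carrier A \<Longrightarrow> T (k \<odot> a) = k \<odot> T a"
    and "\<lbrakk>a \<in> carrier A; b \<in> carrier A\<rbrakk> \<Longrightarrow> T (a \<otimes>\<^bsub>A\<^esub> b) = T a \<otimes>\<^bsub>A\<^esub> b"
    and "\<lbrakk>a \<in> carrier A; b \<in> carrier A\<rbrakk> \<Longrightarrow> T (a \<ominus>\<^bsub>A\<^esub> b) = T a \<ominus>\<^bsub>A\<^esub> T b"
proof -
  have c: "T a \<in> carrier A" "T' a \<in> carrier A" if "a \<in> carrier A" for a
    using T that by (auto simp: is_adjoint_def)
  note m = mult_adjointable[OF T]
  show add: "T (a \<oplus>\<^bsub>A\<^esub> b) = T a \<oplus>\<^bsub>A\<^esub> T b" if "a \<in> carrier A" "b \<in> carrier A" for a b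
    by (rule carrier_eqI) (use that c in \<open>simp_all add: m mult_r_distr\<close>)
  show k: "T (k \<odot> a) = k \<odot> T a" if "a \<in> carrier A" for a k
    by (rule carrier_eqI) (use that c in \<open>simp_all add: m smult_mult_r\<close>)
  show "T (a \<otimes>\<^bsub>A\<^esub> b) = T a \<otimes>\<^bsub>A\<^esub> b" if "a \<in> carrier A" "b \<in> carrier A" for a b
    by (rule carrier_eqI) (use that c in \<open>simp_all add: m flip: mult_assoc\<close>)
  show "T (a \<ominus>\<^bsub>A\<^esub> b) = T a \<ominus>\<^bsub>A\<^esub> T b" if "a \<in> carrier A" "b \<in> carrier A" for a b
    using that c by (simp add: diff_eq_smult add k)
qed

lemma is_adjoint_adjoint:
  assumes "is_adjoint A T T'" shows "is_adjoint A T (adjoint A T)"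
proof -
  have "is_adjoint A T (SOME T'. is_adjoint A T T')" by (rule someI[of "is_adjoint A T", OF assms])
  then show ?thesis by (auto simp: adjoint_def is_adjoint_def)
qed

lemma adjoint_eq: "\<lbrakk>is_adjoint A T T'; b \<in> carrier A\<rbrakk> \<Longrightarrow> adjoint A T b = T' b"
  using is_adjoint_unique is_adjoint_adjoint by blast

lemma family_adjoint:
  "F \<in> multiplier_families A \<Longrightarrow> is_adjoint A (F t) (adjoint A (F t))"
  unfolding multiplier_families_def using is_adjoint_adjoint by blast

lemma family_closed [simp, intro]:
  assumes "F \<in> multiplier_families A" "b \<in> carrier A"
  shows "F t b \<in> carrier A" and "adjoint A (F t) b \<in> carrier A"
  using family_adjoint[OF assms(1), of t] assms(2) by (auto simp: is_adjoint_def)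

lemmas family_linear = adjointable_linear[OF family_adjoint]

lemma family_ext:
  assumes "F \<in> multiplier_families A" "G \<in> multiplier_families A"
    and "\<And>t b. b \<in> carrier A \<Longrightarrow> F t b = G t b"
  shows "F = G"
proof (intro ext)
  fix t b show "F t b = G t b"
    using assms by (cases "b \<in> carrier A") (auto simp: multiplier_families_def extensional_def)
qed

lemma multiplier_familiesI:
  assumes "\<And>t. F t \<in> extensional (carrier A)" "\<And>t. is_adjoint A (F t) (F' t)" "family_bound A F K"
  shows "F \<in> multiplier_families A"
  using assms unfolding multiplier_families_def by blast

abbreviation fnorm :: "('i \<Rightarrow> 'a \<Rightarrow> 'a) \<Rightarrow> real"
  where "fnorm F \<equiv> cnorm (multiplier_algebra A) F"

lemma fnorm_le: "family_bound A F K \<Longrightarrow> fnorm F \<le> K"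
  unfolding multiplier_algebra_def
  by (auto intro!: cInf_lower bdd_belowI[of _ 0] simp: family_bound_def)

lemma fnorm_bound:
  assumes F: "F \<in> multiplier_families A" shows "family_bound A F (fnorm F)"
proof -
  obtain K where K: "family_bound A F K" using F by (auto simp: multiplier_families_def)
  have N: "fnorm F = Inf {K. family_bound A F K}" by (simp add: multiplier_algebra_def)
  have ge: "0 \<le> fnorm F"
    unfolding N using K by (intro cInf_greatest) (auto simp: family_bound_def)
  moreover have "cnorm A (F t b) \<le> fnorm F * cnorm A b" if b: "b \<in> carrier A" for t b
  proof (cases "cnorm A b = 0")
    case True
    then show ?thesis using K b by (auto simp: family_bound_def) (metis mult_zero_right)
  next
    case False
    then have pos: "cnorm A b > 0" using b norm_nonneg by (simp add: less_le)
    have "cnorm A (F t b) / cnorm A b \<le> fnorm F"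
      unfolding N using K b pos
      by (intro cInf_greatest) (auto simp: family_bound_def field_simps)
    then show ?thesis using pos by (simp add: field_simps)
  qed
  ultimately show ?thesis by (auto simp: family_bound_def)
qed

lemma fnorm_nonneg: "F \<in> multiplier_families A \<Longrightarrow> 0 \<le> fnorm F"
  using fnorm_bound by (auto simp: family_bound_def)

lemma fnorm_apply:
  "\<lbrakk>F \<in> multiplier_families A; b \<in> carrier A\<rbrakk> \<Longrightarrow> cnorm A (F t b) \<le> fnorm F * cnorm A b"
  using fnorm_bound by (auto simp: family_bound_def)

text \<open>\<open>\<parallel>T\<^sup>* b\<parallel>\<^sup>2 = \<parallel>b\<^sup>* T (T\<^sup>* b)\<parallel>\<close> bounds the adjoint.\<close>

lemma family_adjoint_bound:
  assumes F: "F \<in> multiplier_families A"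
  shows "family_bound A (\<lambda>t. adjoint A (F t)) (fnorm F)"
  unfolding family_bound_def
proof (intro conjI allI ballI)
  fix t b assume b: "b \<in> carrier A"
  let ?y = "adjoint A (F t) b"
  have y: "?y \<in> carrier A" using F b by auto
  show "cnorm A ?y \<le> fnorm F * cnorm A b"
  proof (cases "cnorm A ?y = 0")
    case True then show ?thesis using fnorm_nonneg[OF F] b by simp
  next
    case False
    have "star A ?y \<otimes>\<^bsub>A\<^esub> ?y = star A b \<otimes>\<^bsub>A\<^esub> F t ?y"
      using is_adjoint_sym[OF family_adjoint[OF F, of t]] b y by (auto simp: is_adjoint_def)
    then have "cnorm A ?y * cnorm A ?y \<le> cnorm A b * (fnorm F * cnorm A ?y)"
      using norm_star_mult[OF y] mult_bound[of "star A b" "F t ?y"] fnorm_apply[OF F y, of t] F b y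
      by (simp add: power2_eq_square)
    then show ?thesis using False norm_nonneg[OF y] by (simp add: mult_ac)
  qed
qed (rule fnorm_nonneg[OF F])

lemma family_adjoint_eq:
  "\<lbrakk>F \<in> multiplier_families A; a \<in> carrier A; b \<in> carrier A\<rbrakk>
    \<Longrightarrow> star A (F t a) \<otimes>\<^bsub>A\<^esub> b = star A a \<otimes>\<^bsub>A\<^esub> adjoint A (F t) b"
  using family_adjoint[of F t] by (simp add: is_adjoint_def)

lemma multiplier_families_unary:
  assumes F: "F \<in> multiplier_families A"
  shows "k \<odot>\<^bsub>multiplier_algebra A\<^esub> F \<in> multiplier_families A"
    and "star (multiplier_algebra A) F \<in> multiplier_families A"
    and "family_bound A (k \<odot>\<^bsub>multiplier_algebra A\<^esub> F) (cmod k * fnorm F)"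
proof -
  note ext = multiplier_algebra_extensional and adj = family_adjoint_eq
  show b3: "family_bound A (k \<odot>\<^bsub>multiplier_algebra A\<^esub> F) (cmod k * fnorm F)"
    unfolding family_bound_def
  proof (intro conjI allI ballI)
    fix t b assume b: "b \<in> carrier A"
    then show "cnorm A ((k \<odot>\<^bsub>multiplier_algebra A\<^esub> F) t b) \<le> cmod k * fnorm F * cnorm A b"
      using mult_left_mono[OF fnorm_apply[OF F b, of t], of "cmod k"] F by (simp add: norm_smult)
  qed (use fnorm_nonneg[OF F] in auto)
  show "k \<odot>\<^bsub>multiplier_algebra A\<^esub> F \<in> multiplier_families A"
    by (rule multiplier_familiesI[OF ext(4), where F' = "\<lambda>t b. cnj k \<odot> adjoint A (F t) b"])
      (use F b3 in \<open>auto simp: is_adjoint_def adj star_smult smult_mult_l smult_mult_r\<close>)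
  show "star (multiplier_algebra A) F \<in> multiplier_families A"
    by (rule multiplier_familiesI[OF ext(5), where F' = F and K = "fnorm F"])
      (use family_adjoint_bound[OF F] is_adjoint_sym[OF family_adjoint[OF F]] in
        \<open>auto simp: multiplier_algebra_def\<close>)
qed

lemma multiplier_families_binary:
  assumes F: "F \<in> multiplier_families A" and G: "G \<in> multiplier_families A"
  shows "F \<oplus>\<^bsub>multiplier_algebra A\<^esub> G \<in> multiplier_families A"
    and "F \<otimes>\<^bsub>multiplier_algebra A\<^esub> G \<in> multiplier_families A"
    and "family_bound A (F \<oplus>\<^bsub>multiplier_algebra A\<^esub> G) (fnorm F + fnorm G)"
    and "family_bound A (F \<otimes>\<^bsub>multiplier_algebra A\<^esub> G) (fnorm F * fnorm G)"
proof -
  note ext = multiplier_algebra_extensional and adj = family_adjoint_eq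
  show b1: "family_bound A (F \<oplus>\<^bsub>multiplier_algebra A\<^esub> G) (fnorm F + fnorm G)"
    unfolding family_bound_def
  proof (intro conjI allI ballI)
    fix t b assume b: "b \<in> carrier A"
    then show "cnorm A ((F \<oplus>\<^bsub>multiplier_algebra A\<^esub> G) t b) \<le> (fnorm F + fnorm G) * cnorm A b"
      using norm_add[of "F t b" "G t b"] fnorm_apply[OF F b, of t] fnorm_apply[OF G b, of t] F G
      by (simp add: distrib_right)
  qed (use fnorm_nonneg[OF F] fnorm_nonneg[OF G] in auto)
  show b2: "family_bound A (F \<otimes>\<^bsub>multiplier_algebra A\<^esub> G) (fnorm F * fnorm G)"
    unfolding family_bound_def
  proof (intro conjI allI ballI)
    fix t b assume b: "b \<in> carrier A"
    then show "cnorm A ((F \<otimes>\<^bsub>multiplier_algebra A\<^esub> G) t b) \<le> (fnorm F * fnorm G) * cnorm A b"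
      using fnorm_apply[OF F, of "G t b" t]
        mult_left_mono[OF fnorm_apply[OF G b, of t] fnorm_nonneg[OF F]] G by simp
  qed (use fnorm_nonneg[OF F] fnorm_nonneg[OF G] in auto)
  show "F \<oplus>\<^bsub>multiplier_algebra A\<^esub> G \<in> multiplier_families A"
    by (rule multiplier_familiesI[OF ext(3), where F' = "\<lambda>t b. adjoint A (F t) b \<oplus>\<^bsub>A\<^esub> adjoint A (G t) b"])
      (use F G b1 in \<open>auto simp: is_adjoint_def adj mult_r_distr star_add mult_l_distr\<close>)
  show "F \<otimes>\<^bsub>multiplier_algebra A\<^esub> G \<in> multiplier_families A"
    by (rule multiplier_familiesI[OF ext(1), where F' = "\<lambda>t b. adjoint A (G t) (adjoint A (F t) b)"])
      (use F G b2 in \<open>auto simp: is_adjoint_def adj\<close>)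
qed

lemma zero_family: "\<zero>\<^bsub>multiplier_algebra A\<^esub> \<in> multiplier_families A"
    "family_bound A \<zero>\<^bsub>multiplier_algebra A\<^esub> 0"
proof -
  show b: "family_bound A \<zero>\<^bsub>multiplier_algebra A\<^esub> 0" by (auto simp: family_bound_def)
  show "\<zero>\<^bsub>multiplier_algebra A\<^esub> \<in> multiplier_families A"
    by (rule multiplier_familiesI[OF multiplier_algebra_extensional(2), where F' = "\<lambda>t b. \<zero>\<^bsub>A\<^esub>"])
      (use b in \<open>auto simp: is_adjoint_def\<close>)
qed

lemma multiplier_algebra_pre_cstar:
  "pre_cstar_algebra (multiplier_algebra A :: ('i \<Rightarrow> 'a \<Rightarrow> 'a) cstar_algebra)"
proof -
  let ?M = "multiplier_algebra A :: ('i \<Rightarrow> 'a \<Rightarrow> 'a) cstar_algebra"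
  note closed = multiplier_families_unary multiplier_families_binary
  note lin = family_linear
  have ab: "abelian_group ?M"
  proof (rule abelian_groupI)
    fix F assume F: "F \<in> carrier ?M"
    show "\<exists>y\<in>carrier ?M. y \<oplus>\<^bsub>?M\<^esub> F = \<zero>\<^bsub>?M\<^esub>"
    proof (intro bexI[of _ "(-1) \<odot>\<^bsub>?M\<^esub> F"] family_ext)
      fix t b assume "b \<in> carrier A"
      then show "((-1) \<odot>\<^bsub>?M\<^esub> F \<oplus>\<^bsub>?M\<^esub> F) t b = \<zero>\<^bsub>?M\<^esub> t b"
        using F by (simp add: M.l_neg flip: minus_eq_smult)
    qed (use F in \<open>auto simp: closed zero_family\<close>)
  qed (auto simp: closed zero_family M.a_ac intro!: family_ext)
  have mod: "Module.module complex_ring ?M"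
    by (rule moduleI[OF cring_complex_ring ab])
      (auto simp: closed add_smult smult_add smult_smult intro!: family_ext)
  note adj = family_adjoint_eq
  interpret M: star_algebra ?M
  proof (intro star_algebra.intro mod, unfold_locales, goal_cases)
    case (8 F G)
    then have c: "F \<in> multiplier_families A" "G \<in> multiplier_families A" by auto
    show ?case
    proof (rule family_ext)
      fix t b assume b: "b \<in> carrier A"
      show "star ?M (F \<oplus>\<^bsub>?M\<^esub> G) t b = (star ?M F \<oplus>\<^bsub>?M\<^esub> star ?M G) t b"
        using b by (simp, intro adjoint_eq[where T' = "\<lambda>b. adjoint A (F t) b \<oplus>\<^bsub>A\<^esub> adjoint A (G t) b"])
          (use c in \<open>auto simp: is_adjoint_def adj mult_r_distr star_add mult_l_distr\<close>)
    qed (use c in \<open>auto simp: closed\<close>)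
  next
    case (9 F k)
    then have c: "F \<in> multiplier_families A" by auto
    show ?case
    proof (rule family_ext)
      fix t b assume b: "b \<in> carrier A"
      show "star ?M (k \<odot>\<^bsub>?M\<^esub> F) t b = (cnj k \<odot>\<^bsub>?M\<^esub> star ?M F) t b"
        using b by (simp, intro adjoint_eq[where T' = "\<lambda>b. cnj k \<odot> adjoint A (F t) b"])
          (use c in \<open>auto simp: is_adjoint_def adj star_smult smult_mult_l smult_mult_r\<close>)
    qed (use c in \<open>auto simp: closed\<close>)
  next
    case (10 F G)
    then have c: "F \<in> multiplier_families A" "G \<in> multiplier_families A" by auto
    show ?case
    proof (rule family_ext)
      fix t b assume b: "b \<in> carrier A"
      show "star ?M (F \<otimes>\<^bsub>?M\<^esub> G) t b = (star ?M G \<otimes>\<^bsub>?M\<^esub> star ?M F) t b"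
        using b by (simp, intro adjoint_eq[where T' = "\<lambda>b. adjoint A (G t) (adjoint A (F t) b)"])
          (use c in \<open>auto simp: is_adjoint_def adj\<close>)
    qed (use c in \<open>auto simp: closed\<close>)
  next
    case (11 F)
    then have c: "F \<in> multiplier_families A" by auto
    show ?case
    proof (rule family_ext)
      fix t b assume b: "b \<in> carrier A"
      show "star ?M (star ?M F) t b = F t b"
        using b adjoint_eq[OF is_adjoint_sym[OF family_adjoint[OF c]]] by simp
    qed (use c in \<open>auto simp: closed\<close>)
  qed (auto simp: closed lin smult_add add_smult intro!: family_ext)
  show ?thesis
  proof (intro pre_cstar_algebra.intro M.star_algebra_axioms, unfold_locales, goal_cases)
    case (1 F) then show ?case by (simp add: fnorm_nonneg)
  next
    case (2 F)
    then have F: "F \<in> multiplier_families A" by auto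
    show ?case
    proof
      assume 0: "cnorm ?M F = 0"
      show "F = \<zero>\<^bsub>?M\<^esub>"
      proof (rule family_ext[OF F zero_family(1)])
        fix t b assume "b \<in> carrier A"
        then show "F t b = \<zero>\<^bsub>?M\<^esub> t b"
          using fnorm_apply[OF F, of b t] 0 norm_eq_0_iff[of "F t b"] norm_nonneg[of "F t b"] F
          by (simp add: order_antisym)
      qed
    next
      assume "F = \<zero>\<^bsub>?M\<^esub>"
      then show "cnorm ?M F = 0"
        using fnorm_le[OF zero_family(2)] fnorm_nonneg[OF zero_family(1)] by (metis order_antisym)
    qed
  next
    case (3 F G) then show ?case by (simp add: fnorm_le closed(6))
  next
    case (4 F k)
    then have F: "F \<in> multiplier_families A" by auto
    show ?case
    proof (cases "k = 0")
      case True
      then show ?thesis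
        using fnorm_le[OF closed(3)[OF F], of k] fnorm_nonneg[OF closed(1)[OF F], of k] by simp
    next
      case False
      have "inverse k \<odot>\<^bsub>?M\<^esub> (k \<odot>\<^bsub>?M\<^esub> F) = F"
        using F False by (intro family_ext) (auto simp: closed smult_smult)
      then have "cnorm ?M F \<le> inverse (cmod k) * cnorm ?M (k \<odot>\<^bsub>?M\<^esub> F)"
        using fnorm_le[OF closed(3)[OF closed(1)[OF F]], of "inverse k" k] by (simp add: norm_inverse)
      then have "cmod k * cnorm ?M F \<le> cnorm ?M (k \<odot>\<^bsub>?M\<^esub> F)"
        using False by (simp add: field_simps)
      then show ?thesis using fnorm_le[OF closed(3)[OF F], of k] by simp
    qed
  next
    case (5 F G) then show ?case by (simp add: fnorm_le closed(7))
  next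
    case (6 F)
    then have F: "F \<in> multiplier_families A" by auto
    let ?H = "star ?M F \<otimes>\<^bsub>?M\<^esub> F"
    have H: "?H \<in> multiplier_families A" using F by (simp add: closed)
    have "family_bound A F (sqrt (cnorm ?M ?H))"
      unfolding family_bound_def
    proof (intro conjI allI ballI)
      fix t b assume b: "b \<in> carrier A"
      have "star A (F t b) \<otimes>\<^bsub>A\<^esub> F t b = star A b \<otimes>\<^bsub>A\<^esub> ?H t b"
        using adj[OF F b, of "F t b" t] F b by simp
      then have "(cnorm A (F t b))\<^sup>2 \<le> cnorm A b * (cnorm ?M ?H * cnorm A b)"
        using norm_star_mult[of "F t b"] mult_bound[of "star A b" "?H t b"] fnorm_apply[OF H b, of t]
          F H b by auto
      also have "\<dots> = (sqrt (cnorm ?M ?H) * cnorm A b)\<^sup>2"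
        using fnorm_nonneg[OF H] by (simp add: power_mult_distrib power2_eq_square)
      finally show "cnorm A (F t b) \<le> sqrt (cnorm ?M ?H) * cnorm A b"
        by (rule power2_le_imp_le) (use fnorm_nonneg[OF H] norm_nonneg[OF b] in simp)
    qed (use fnorm_nonneg[OF H] in simp)
    then have "cnorm ?M F \<le> sqrt (cnorm ?M ?H)" by (rule fnorm_le)
    then have "(cnorm ?M F)\<^sup>2 \<le> cnorm ?M ?H"
      using fnorm_nonneg[OF H] fnorm_nonneg[OF F] by (metis power_mono real_sqrt_pow2)
    moreover have "cnorm ?M ?H \<le> cnorm ?M F * cnorm ?M F"
    proof -
      have "cnorm ?M (star ?M F) \<le> cnorm ?M F"
        using fnorm_le[OF family_adjoint_bound[OF F]] by (simp add: multiplier_algebra_def)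
      moreover have "cnorm ?M ?H \<le> cnorm ?M (star ?M F) * cnorm ?M F"
        using fnorm_le[OF closed(7)[OF closed(2)[OF F] F]] .
      ultimately show ?thesis
        using mult_right_mono[OF _ fnorm_nonneg[OF F]] by (meson order_trans)
    qed
    ultimately show ?case by (simp add: power2_eq_square)
  qed
qed


end

context cstar_algebra begin

lemma multiplier_families_diff:
  assumes F: "F \<in> multiplier_families A" and G: "G \<in> multiplier_families A" and b: "b \<in> carrier A"
  shows "(F \<ominus>\<^bsub>multiplier_algebra A\<^esub> G) t b = F t b \<ominus>\<^bsub>A\<^esub> G t b"
proof -
  interpret M: pre_cstar_algebra "multiplier_algebra A :: ('b \<Rightarrow> 'a \<Rightarrow> 'a) cstar_algebra"
    by (rule multiplier_algebra_pre_cstar)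
  show ?thesis using M.diff_eq_smult[of F G] F G b by (simp add: diff_eq_smult)
qed

text \<open>The limit is taken pointwise and is then uniform.  That it is again adjointable is not asserted here: this
  follows by applying the lemma to the adjoint families, too.\<close>

lemma family_cauchy_limit:
  fixes \<eta> :: "nat \<Rightarrow> 'i \<Rightarrow> 'a \<Rightarrow> 'a"
  assumes \<eta>: "\<And>n. \<eta> n \<in> multiplier_families A"
    and cau: "\<And>e. e > 0 \<Longrightarrow> \<exists>N. \<forall>m\<ge>N. \<forall>n\<ge>N. fnorm (\<eta> m \<ominus>\<^bsub>multiplier_algebra A\<^esub> \<eta> n) < e"
  obtains L where "\<And>t. L t \<in> extensional (carrier A)"
    and "\<And>t b. b \<in> carrier A \<Longrightarrow> L t b \<in> carrier A"
    and "\<And>e. e > 0 \<Longrightarrow> \<exists>N. \<forall>n\<ge>N. \<forall>t. \<forall>b\<in>carrier A. cnorm A (\<eta> n t b \<ominus>\<^bsub>A\<^esub> L t b) \<le> e * cnorm A b"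
proof -
  interpret M: pre_cstar_algebra "multiplier_algebra A :: ('i \<Rightarrow> 'a \<Rightarrow> 'a) cstar_algebra"
    by (rule multiplier_algebra_pre_cstar)
  have diff_le: "cnorm A (\<eta> m t b \<ominus>\<^bsub>A\<^esub> \<eta> n t b) \<le> fnorm (\<eta> m \<ominus>\<^bsub>multiplier_algebra A\<^esub> \<eta> n) * cnorm A b"
    if b: "b \<in> carrier A" for m n t b
    using fnorm_apply[of "\<eta> m \<ominus>\<^bsub>multiplier_algebra A\<^esub> \<eta> n" b t] M.M.minus_closed[of "\<eta> m" "\<eta> n"] \<eta> b
    by (simp add: multiplier_families_diff)
  have ex: "\<exists>l. l \<in> carrier A \<and> (\<lambda>n. cnorm A (\<eta> n t b \<ominus>\<^bsub>A\<^esub> l)) \<longlonglongrightarrow> 0" if b: "b \<in> carrier A" for t b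
  proof (rule cauchy_limit[of "\<lambda>n. \<eta> n t b"])
    fix e :: real assume e: "e > 0"
    have pos: "0 < 1 + cnorm A b" using norm_nonneg[OF b] by linarith
    then obtain N where N: "\<forall>m\<ge>N. \<forall>n\<ge>N. fnorm (\<eta> m \<ominus>\<^bsub>multiplier_algebra A\<^esub> \<eta> n) < e / (1 + cnorm A b)"
      using cau[of "e / (1 + cnorm A b)"] e by auto
    have "cnorm A (\<eta> m t b \<ominus>\<^bsub>A\<^esub> \<eta> n t b) < e" if mn: "m \<ge> N" "n \<ge> N" for m n
    proof -
      have "cnorm A (\<eta> m t b \<ominus>\<^bsub>A\<^esub> \<eta> n t b) \<le> e / (1 + cnorm A b) * cnorm A b"
        using diff_le[OF b, of m t n] N mn mult_right_mono[OF less_imp_le norm_nonneg[OF b]]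
        by (meson order_trans)
      also have "\<dots> < e" using pos e by (simp add: field_simps)
      finally show ?thesis .
    qed
    then show "\<exists>N. \<forall>m\<ge>N. \<forall>n\<ge>N. cnorm A (\<eta> m t b \<ominus>\<^bsub>A\<^esub> \<eta> n t b) < e" by blast
  qed (use \<eta> b in auto)
  define L where "L t = (\<lambda>b\<in>carrier A. SOME l. l \<in> carrier A \<and> (\<lambda>n. cnorm A (\<eta> n t b \<ominus>\<^bsub>A\<^esub> l)) \<longlonglongrightarrow> 0)" for t
  have L: "L t b \<in> carrier A" "(\<lambda>n. cnorm A (\<eta> n t b \<ominus>\<^bsub>A\<^esub> L t b)) \<longlonglongrightarrow> 0" if "b \<in> carrier A" for t b
    using someI_ex[OF ex[OF that, of t]] that by (simp_all add: L_def)
  show thesis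
  proof (rule that[of L])
    fix e :: real assume "e > 0"
    then obtain N where N: "\<forall>m\<ge>N. \<forall>n\<ge>N. fnorm (\<eta> m \<ominus>\<^bsub>multiplier_algebra A\<^esub> \<eta> n) < e"
      using cau by blast
    have "cnorm A (\<eta> n t b \<ominus>\<^bsub>A\<^esub> L t b) \<le> e * cnorm A b" if n: "n \<ge> N" and b: "b \<in> carrier A" for n t b
    proof (rule LIMSEQ_le_const)
      show "(\<lambda>m. e * cnorm A b + cnorm A (\<eta> m t b \<ominus>\<^bsub>A\<^esub> L t b)) \<longlonglongrightarrow> e * cnorm A b"
        using tendsto_add[OF tendsto_const L(2)[OF b, of t], of "e * cnorm A b"] by simp
      have "cnorm A (\<eta> n t b \<ominus>\<^bsub>A\<^esub> L t b) \<le> e * cnorm A b + cnorm A (\<eta> m t b \<ominus>\<^bsub>A\<^esub> L t b)"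
        if m: "m \<ge> N" for m
      proof -
        have "fnorm (\<eta> n \<ominus>\<^bsub>multiplier_algebra A\<^esub> \<eta> m) * cnorm A b \<le> e * cnorm A b"
          using N n m norm_nonneg[OF b] by (intro mult_right_mono) (auto intro: less_imp_le)
        then show ?thesis
          using norm_diff_triangle[of "\<eta> n t b" "\<eta> m t b" "L t b"] diff_le[OF b, of n t m] L(1)[OF b] \<eta> b
          by fastforce
      qed
      then show "\<exists>M. \<forall>m\<ge>M. cnorm A (\<eta> n t b \<ominus>\<^bsub>A\<^esub> L t b) \<le> e * cnorm A b + cnorm A (\<eta> m t b \<ominus>\<^bsub>A\<^esub> L t b)"
        by blast
    qed
    then show "\<exists>N. \<forall>n\<ge>N. \<forall>t. \<forall>b\<in>carrier A. cnorm A (\<eta> n t b \<ominus>\<^bsub>A\<^esub> L t b) \<le> e * cnorm A b" by blast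
  next
    show "L t \<in> extensional (carrier A)" for t unfolding L_def by (rule restrict_extensional)
  qed (rule L(1))
qed

theorem multiplier_algebra_cstar:
  "cstar_algebra (multiplier_algebra A :: ('i \<Rightarrow> 'a \<Rightarrow> 'a) cstar_algebra)"
proof -
  let ?M = "multiplier_algebra A :: ('i \<Rightarrow> 'a \<Rightarrow> 'a) cstar_algebra"
  interpret M: pre_cstar_algebra ?M by (rule multiplier_algebra_pre_cstar)
  have "Metric_space.mcomplete (carrier ?M) (cdist ?M)"
    unfolding M.mcomplete_iff
  proof (intro allI impI)
    fix \<xi> :: "nat \<Rightarrow> 'i \<Rightarrow> 'a \<Rightarrow> 'a"
    assume "\<forall>n. \<xi> n \<in> carrier ?M"
      and cau: "\<forall>e>0. \<exists>N. \<forall>m\<ge>N. \<forall>n\<ge>N. cnorm ?M (\<xi> m \<ominus>\<^bsub>?M\<^esub> \<xi> n) < e"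
    then have \<xi>: "\<xi> n \<in> multiplier_families A" and \<xi>s: "star ?M (\<xi> n) \<in> multiplier_families A" for n
      using M.star_closed[of "\<xi> n"] by auto
    obtain L where L: "\<And>t. L t \<in> extensional (carrier A)"
        "\<And>t b. b \<in> carrier A \<Longrightarrow> L t b \<in> carrier A"
      and L_lim: "\<And>e. e > 0 \<Longrightarrow>
        \<exists>N. \<forall>n\<ge>N. \<forall>t. \<forall>b\<in>carrier A. cnorm A (\<xi> n t b \<ominus>\<^bsub>A\<^esub> L t b) \<le> e * cnorm A b"
      using family_cauchy_limit[of \<xi>] \<xi> cau by metis
    have cau': "\<exists>N. \<forall>m\<ge>N. \<forall>n\<ge>N. cnorm ?M (star ?M (\<xi> m) \<ominus>\<^bsub>?M\<^esub> star ?M (\<xi> n)) < e" if "e > 0" for e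
    proof -
      have "cnorm ?M (star ?M (\<xi> m) \<ominus>\<^bsub>?M\<^esub> star ?M (\<xi> n)) = cnorm ?M (\<xi> m \<ominus>\<^bsub>?M\<^esub> \<xi> n)" for m n
        using M.norm_star[of "\<xi> m \<ominus>\<^bsub>?M\<^esub> \<xi> n"] M.star_diff[of "\<xi> m" "\<xi> n"] M.M.minus_closed[of "\<xi> m" "\<xi> n"] \<xi>
        by simp
      then show ?thesis using cau that by simp
    qed
    obtain L' where L': "\<And>t. L' t \<in> extensional (carrier A)"
        "\<And>t b. b \<in> carrier A \<Longrightarrow> L' t b \<in> carrier A"
      and L'_lim: "\<And>e. e > 0 \<Longrightarrow>
        \<exists>N. \<forall>n\<ge>N. \<forall>t. \<forall>b\<in>carrier A. cnorm A (star ?M (\<xi> n) t b \<ominus>\<^bsub>A\<^esub> L' t b) \<le> e * cnorm A b"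
      using family_cauchy_limit[of "\<lambda>n. star ?M (\<xi> n)"] \<xi>s cau' by metis
    have adj: "is_adjoint A (L t) (L' t)" for t
      unfolding is_adjoint_def
    proof (intro conjI ballI)
      fix a b assume a: "a \<in> carrier A" and b: "b \<in> carrier A"
      let ?x = "star A (L t a) \<otimes>\<^bsub>A\<^esub> b" and ?y = "star A a \<otimes>\<^bsub>A\<^esub> L' t b"
      have xy: "?x \<in> carrier A" "?y \<in> carrier A" using a b L L' by auto
      have "cnorm A (?x \<ominus>\<^bsub>A\<^esub> ?y) \<le> 0"
      proof (rule field_le_epsilon)
        fix e :: real assume "e > 0"
        define e' where "e' = e / (2 * (1 + cnorm A a * cnorm A b))"
        have pos: "0 < 1 + cnorm A a * cnorm A b"
          using norm_nonneg[OF a] norm_nonneg[OF b] by (simp add: add_pos_nonneg)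
        then have e': "e' > 0" using \<open>e > 0\<close> by (simp add: e'_def)
        obtain N1 where N1: "\<forall>n\<ge>N1. \<forall>t. \<forall>b\<in>carrier A. cnorm A (\<xi> n t b \<ominus>\<^bsub>A\<^esub> L t b) \<le> e' * cnorm A b"
          using L_lim[OF e'] by blast
        obtain N2 where N2: "\<forall>n\<ge>N2. \<forall>t. \<forall>b\<in>carrier A. cnorm A (star ?M (\<xi> n) t b \<ominus>\<^bsub>A\<^esub> L' t b) \<le> e' * cnorm A b"
          using L'_lim[OF e'] by blast
        define n where "n = max N1 N2"
        let ?z = "star A (\<xi> n t a) \<otimes>\<^bsub>A\<^esub> b"
        have \<xi>c: "\<xi> n t a \<in> carrier A" "star ?M (\<xi> n) t b \<in> carrier A" using \<xi> \<xi>s a b by blast+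
        have z: "?z = star A a \<otimes>\<^bsub>A\<^esub> star ?M (\<xi> n) t b"
          using family_adjoint[OF \<xi>, of n t] a b by (simp add: is_adjoint_def)
        have "cnorm A (?x \<ominus>\<^bsub>A\<^esub> ?z) \<le> (e' * cnorm A a) * cnorm A b"
        proof -
          have "?x \<ominus>\<^bsub>A\<^esub> ?z = star A (L t a \<ominus>\<^bsub>A\<^esub> \<xi> n t a) \<otimes>\<^bsub>A\<^esub> b"
            using a b L \<xi>c by (simp add: star_diff mult_l_diff)
          moreover have "cnorm A (L t a \<ominus>\<^bsub>A\<^esub> \<xi> n t a) \<le> e' * cnorm A a"
            using N1 a L \<xi>c norm_diff_commute[of "L t a" "\<xi> n t a"] by (simp add: n_def)
          ultimately show ?thesis using mult_bound a b L \<xi>c by simp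
        qed
        moreover have "cnorm A (?z \<ominus>\<^bsub>A\<^esub> ?y) \<le> cnorm A a * (e' * cnorm A b)"
        proof -
          have "?z \<ominus>\<^bsub>A\<^esub> ?y = star A a \<otimes>\<^bsub>A\<^esub> (star ?M (\<xi> n) t b \<ominus>\<^bsub>A\<^esub> L' t b)"
            unfolding z using a b L' \<xi>c(2) by (subst mult_r_diff) auto
          moreover have "cnorm A (star ?M (\<xi> n) t b \<ominus>\<^bsub>A\<^esub> L' t b) \<le> e' * cnorm A b"
            using N2 b by (simp add: n_def del: multiplier_algebra_simps)
          ultimately show ?thesis
            using mult_bound[of "star A a" "star ?M (\<xi> n) t b \<ominus>\<^bsub>A\<^esub> L' t b"] a b L' \<xi>c(2)
            by (simp del: multiplier_algebra_simps)
        qed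
        ultimately have "cnorm A (?x \<ominus>\<^bsub>A\<^esub> ?y) \<le> 2 * e' * (cnorm A a * cnorm A b)"
          using norm_diff_triangle[of ?x ?z ?y] xy \<xi>c b by (simp add: algebra_simps)
        also have "\<dots> \<le> e" using pos \<open>e > 0\<close> by (simp add: e'_def field_simps)
        finally show "cnorm A (?x \<ominus>\<^bsub>A\<^esub> ?y) \<le> 0 + e" by simp
      qed
      then have "cnorm A (?x \<ominus>\<^bsub>A\<^esub> ?y) = 0" using xy by (intro order_antisym norm_nonneg) auto
      then show "?x = ?y" using xy by (simp add: norm_eq_0_iff diff_zero_iff)
    qed (use L L' in auto)
    have "\<exists>K. family_bound A L K"
    proof -
      obtain N where N: "\<forall>n\<ge>N. \<forall>t. \<forall>b\<in>carrier A. cnorm A (\<xi> n t b \<ominus>\<^bsub>A\<^esub> L t b) \<le> 1 * cnorm A b"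
        using L_lim[of 1] by auto
      have "family_bound A L (fnorm (\<xi> N) + 1)"
        unfolding family_bound_def
      proof (intro conjI allI ballI)
        fix t b assume b: "b \<in> carrier A"
        have "cnorm A (L t b) \<le> cnorm A (\<xi> N t b) + cnorm A (\<xi> N t b \<ominus>\<^bsub>A\<^esub> L t b)"
          using norm_le_diff[of "L t b" "\<xi> N t b"] norm_diff_commute[of "L t b" "\<xi> N t b"] L b \<xi> by simp
        then show "cnorm A (L t b) \<le> (fnorm (\<xi> N) + 1) * cnorm A b"
          using N[rule_format, of N b t] b fnorm_apply[OF \<xi> b, of N t] by (simp add: distrib_right)
      qed (use fnorm_nonneg[OF \<xi>, of N] in simp)
      then show ?thesis by blast
    qed
    then obtain K where "family_bound A L K" by blast
    then have LM: "L \<in> multiplier_families A" by (rule multiplier_familiesI[OF L(1) adj])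
    have "(\<lambda>n. fnorm (\<xi> n \<ominus>\<^bsub>?M\<^esub> L)) \<longlonglongrightarrow> 0"
    proof (rule LIMSEQ_I)
      fix e :: real assume "e > 0"
      then obtain N where N: "\<forall>n\<ge>N. \<forall>t. \<forall>b\<in>carrier A. cnorm A (\<xi> n t b \<ominus>\<^bsub>A\<^esub> L t b) \<le> e / 2 * cnorm A b"
        using L_lim[of "e / 2"] by auto
      have "norm (fnorm (\<xi> n \<ominus>\<^bsub>?M\<^esub> L) - 0) < e" if "n \<ge> N" for n
      proof -
        have "family_bound A (\<xi> n \<ominus>\<^bsub>?M\<^esub> L) (e / 2)"
          using N that \<open>e > 0\<close> \<xi> LM by (simp add: family_bound_def multiplier_families_diff)
        then show ?thesis
          using fnorm_le[of "\<xi> n \<ominus>\<^bsub>?M\<^esub> L" "e / 2"] \<open>e > 0\<close> M.norm_nonneg[of "\<xi> n \<ominus>\<^bsub>?M\<^esub> L"] \<xi> LM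
            M.M.minus_closed[of "\<xi> n" L] by simp
      qed
      then show "\<exists>no. \<forall>n\<ge>no. norm (fnorm (\<xi> n \<ominus>\<^bsub>?M\<^esub> L) - 0) < e" by blast
    qed
    then show "\<exists>l\<in>carrier ?M. (\<lambda>n. cnorm ?M (\<xi> n \<ominus>\<^bsub>?M\<^esub> l)) \<longlonglongrightarrow> 0" using LM by auto
  qed
  then show ?thesis
    by (intro cstar_algebra.intro cstar_algebra_axioms.intro M.star_algebra_axioms)
      (auto simp: M.norm_eq_0_iff M.norm_add M.norm_smult M.norm_mult M.norm_star_mult
        simp del: multiplier_algebra_simps)
qed

end

section \<open>Partial actions on C*-algebras\<close>

locale cstar_partial = cstar_algebra A
  for A :: "('a, 'm) cstar_algebra_scheme" (structure) +
  fixes D :: "'g::topological_group_add \<Rightarrow> 'a set" and \<alpha> :: "'g \<Rightarrow> 'a \<Rightarrow> 'a"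
  assumes action: "cstar_partial_action A D \<alpha>"
begin

lemma D_ideal: "star_ideal (D t) A"
  using action by (auto simp: cstar_partial_action_def star_partial_action_def)

lemmas D_carrier [simp] = star_idealD(1)[OF D_ideal]
  and D_zero [simp] = star_idealD(2)[OF D_ideal]
  and D_smult [simp] = star_idealD(4)[OF D_ideal]
  and D_diff [simp] = star_idealD(5)[OF D_ideal]
  and D_star [simp] = star_idealD(6)[OF D_ideal]
  and D_mult [simp] = star_idealD(7)[OF D_ideal]
  and D_mult' [simp] = star_idealD(8)[OF D_ideal]

lemma D_add [simp]: "\<lbrakk>x \<in> D t; y \<in> D t\<rbrakk> \<Longrightarrow> x \<oplus>\<^bsub>A\<^esub> y \<in> D t"
  by (rule star_idealD(3)[OF D_ideal])

lemma D_closed: "closedin (norm_topology A) (D t)"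
  using action by (auto simp: cstar_partial_action_def)

lemma D_0 [simp]: "D 0 = carrier A" and \<alpha>_0 [simp]: "x \<in> carrier A \<Longrightarrow> \<alpha> 0 x = x"
  using action
  by (auto simp: cstar_partial_action_def star_partial_action_def set_partial_action_def)

lemma \<alpha>_closed [simp]: "x \<in> D (- t) \<Longrightarrow> \<alpha> t x \<in> D t"
  using action
  by (auto simp: cstar_partial_action_def star_partial_action_def set_partial_action_def)

lemma \<alpha>_closed' [simp]: "x \<in> D t \<Longrightarrow> \<alpha> (- t) x \<in> D (- t)"
  using \<alpha>_closed[of x "- t"] by simp

lemma \<alpha>_carrier [simp]:
  "x \<in> D (- t) \<Longrightarrow> \<alpha> t x \<in> carrier A" "x \<in> D t \<Longrightarrow> \<alpha> (- t) x \<in> carrier A"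
  by (blast intro: D_carrier \<alpha>_closed \<alpha>_closed')+

lemma \<alpha>_comp:
  assumes "x \<in> D (- t)" "\<alpha> t x \<in> D (- s)"
  shows "x \<in> D (- (s + t))" and "\<alpha> s (\<alpha> t x) = \<alpha> (s + t) x"
proof -
  have "set_partial_action (carrier A) D \<alpha>"
    using action by (simp add: cstar_partial_action_def star_partial_action_def)
  then have *: "\<forall>s t x. x \<in> D (- t) \<and> \<alpha> t x \<in> D (- s) \<longrightarrow>
      x \<in> D (- t + - s) \<and> \<alpha> s (\<alpha> t x) = \<alpha> (s + t) x"
    unfolding set_partial_action_def by (elim conjE) assumption
  show "x \<in> D (- (s + t))" "\<alpha> s (\<alpha> t x) = \<alpha> (s + t) x"
    using *[rule_format, of x t s] assms unfolding group_add_class.minus_add[of s t] by blast+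
qed

lemma \<alpha>_inverse [simp]: "x \<in> D (- t) \<Longrightarrow> \<alpha> (- t) (\<alpha> t x) = x"
  using \<alpha>_comp(2)[of x t "- t"] by simp

lemma \<alpha>_inverse' [simp]: "x \<in> D t \<Longrightarrow> \<alpha> t (\<alpha> (- t) x) = x"
  using \<alpha>_inverse[of x "- t"] by simp

lemma
  shows \<alpha>_add: "\<lbrakk>x \<in> D (- t); y \<in> D (- t)\<rbrakk> \<Longrightarrow> \<alpha> t (x \<oplus>\<^bsub>A\<^esub> y) = \<alpha> t x \<oplus>\<^bsub>A\<^esub> \<alpha> t y"
    and \<alpha>_smult: "x \<in> D (- t) \<Longrightarrow> \<alpha> t (k \<odot> x) = k \<odot> \<alpha> t x"
    and \<alpha>_mult: "\<lbrakk>x \<in> D (- t); y \<in> D (- t)\<rbrakk> \<Longrightarrow> \<alpha> t (x \<otimes>\<^bsub>A\<^esub> y) = \<alpha> t x \<otimes>\<^bsub>A\<^esub> \<alpha> t y"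
    and \<alpha>_star: "x \<in> D (- t) \<Longrightarrow> \<alpha> t (star A x) = star A (\<alpha> t x)"
  using action unfolding cstar_partial_action_def star_partial_action_def star_hom_def by simp_all

text \<open>The familiar \<open>\<alpha>\<^sub>r(A\<^bsub>-r\<^esub> \<inter> A\<^sub>t) \<subseteq> A\<^sub>r \<inter> A\<^bsub>r+t\<^esub>\<close>, with the accompanying composition law.\<close>

lemma \<alpha>_domain:
  assumes "x \<in> D (- r)" "x \<in> D t"
  shows "\<alpha> (- t) x \<in> D (- (r + t))" and "\<alpha> (r + t) (\<alpha> (- t) x) = \<alpha> r x"
    and "\<alpha> r x \<in> D (r + t)"
proof -
  show 1: "\<alpha> (- t) x \<in> D (- (r + t))" and 2: "\<alpha> (r + t) (\<alpha> (- t) x) = \<alpha> r x"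
    using \<alpha>_comp[of "\<alpha> (- t) x" t r] assms by auto
  show "\<alpha> r x \<in> D (r + t)" using \<alpha>_closed[OF 1] 2 by simp
qed

text \<open>Joint continuity of the action at the point \<open>(t, 0)\<close> bounds \<open>\<alpha> t\<close> near \<open>0\<close>; homogeneity does the
  rest.\<close>

lemma \<alpha>_bounded: "\<exists>K\<ge>0. \<forall>x\<in>D (- t). cnorm A (\<alpha> t x) \<le> K * cnorm A x"
proof -
  let ?X = "subtopology (prod_topology euclidean (norm_topology A)) {(t, a). a \<in> D (- t)}"
  let ?B = "{y \<in> carrier A. cnorm A (y \<ominus>\<^bsub>A\<^esub> \<zero>\<^bsub>A\<^esub>) < 1}"
  have \<alpha>z: "\<alpha> t \<zero>\<^bsub>A\<^esub> = \<zero>\<^bsub>A\<^esub>" using \<alpha>_smult[of "\<zero>\<^bsub>A\<^esub>" t 0] \<alpha>_carrier(1)[of "\<zero>\<^bsub>A\<^esub>" t] by simp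
  have cont: "continuous_map ?X (norm_topology A) (\<lambda>(t, a). \<alpha> t a)"
    using action by (simp add: cstar_partial_action_def)
  have "openin ?X {p \<in> topspace ?X. (case p of (t, a) \<Rightarrow> \<alpha> t a) \<in> ?B}"
    by (rule openin_continuous_map_preimage[OF cont openin_norm_ball]) auto
  then obtain W where W: "openin (prod_topology euclidean (norm_topology A)) W"
    and W_eq: "{p \<in> topspace ?X. (case p of (t, a) \<Rightarrow> \<alpha> t a) \<in> ?B} = W \<inter> {(t, a). a \<in> D (- t)}"
    unfolding openin_subtopology by blast
  have "(t, \<zero>\<^bsub>A\<^esub>) \<in> {p \<in> topspace ?X. (case p of (t, a) \<Rightarrow> \<alpha> t a) \<in> ?B}"
    by (auto simp: \<alpha>z a_minus_def M.r_neg)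
  then have "(t, \<zero>\<^bsub>A\<^esub>) \<in> W" unfolding W_eq by simp
  then obtain U V where UV: "openin (norm_topology A) V" "t \<in> U" "\<zero>\<^bsub>A\<^esub> \<in> V" "U \<times> V \<subseteq> W"
    using W[unfolded openin_prod_topology_alt, rule_format, of t "\<zero>\<^bsub>A\<^esub>"] by auto
  obtain r where r: "r > 0" and rV: "\<forall>y\<in>carrier A. cnorm A (y \<ominus>\<^bsub>A\<^esub> \<zero>\<^bsub>A\<^esub>) < r \<longrightarrow> y \<in> V"
    using UV(1,3) unfolding openin_norm_iff by blast
  have small: "cnorm A (\<alpha> t x) < 1" if x: "x \<in> D (- t)" "cnorm A x < r" for x
  proof -
    have "x \<in> V" using rV x by (simp add: diff_eq_smult)
    then have "(t, x) \<in> W \<inter> {(t, a). a \<in> D (- t)}" using UV x by auto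
    then have "\<alpha> t x \<in> ?B" unfolding W_eq[symmetric] by simp
    then show ?thesis using \<alpha>_carrier(1)[OF x(1)] by (simp add: diff_eq_smult)
  qed
  have "cnorm A (\<alpha> t x) \<le> (2 / r) * cnorm A x" if x: "x \<in> D (- t)" for x
  proof (cases "cnorm A x = 0")
    case True
    then show ?thesis using \<alpha>z norm_eq_0_iff[of x] x by simp
  next
    case False
    then have pos: "cnorm A x > 0" using x norm_nonneg[of x] by (simp add: less_le)
    define c where "c = r / (2 * cnorm A x)"
    have c: "c > 0" using pos r by (simp add: c_def)
    have "cnorm A (complex_of_real c \<odot> x) < r"
      using x r pos c by (simp add: norm_smult) (simp add: c_def)
    then have "cnorm A (\<alpha> t (complex_of_real c \<odot> x)) < 1" using x by (intro small) auto
    then have "c * cnorm A (\<alpha> t x) < 1" using x c by (simp add: \<alpha>_smult norm_smult)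
    then show ?thesis using c pos r by (simp add: c_def field_simps)
  qed
  then show ?thesis using r by (intro exI[of _ "2 / r"]) auto
qed

text \<open>That *-homomorphisms between C*-algebras are contractive needs no spectral theory for a bounded
  one: a bound \<open>\<parallel>\<alpha> h\<parallel> \<le> K \<parallel>h\<parallel>\<close>, applied to the \<open>2\<^sup>n\<close>-th powers of a self-adjoint \<open>h\<close>, whose norms are
  the \<open>2\<^sup>n\<close>-th powers of \<open>\<parallel>h\<parallel>\<close>, improves itself to \<open>K = 1\<close> as \<open>n\<close> grows.\<close>

lemma \<alpha>_norm_le:
  assumes x: "x \<in> D (- t)" shows "cnorm A (\<alpha> t x) \<le> cnorm A x"
proof -
  obtain K where K: "K \<ge> 0" "\<And>x. x \<in> D (- t) \<Longrightarrow> cnorm A (\<alpha> t x) \<le> K * cnorm A x"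
    using \<alpha>_bounded by blast
  have pow: "cnorm A (\<alpha> t h) ^ (2 ^ n) \<le> K * cnorm A h ^ (2 ^ n)"
    if "h \<in> D (- t)" "star A h = h" for n h
    using that
  proof (induction n arbitrary: h)
    case 0 then show ?case using K by simp
  next
    case (Suc n)
    have "star A (\<alpha> t h) = \<alpha> t h" using Suc.prems \<alpha>_star[of h t] by simp
    then have "cnorm A (\<alpha> t h) ^ 2 = cnorm A (\<alpha> t (h \<otimes>\<^bsub>A\<^esub> h))" and "cnorm A h ^ 2 = cnorm A (h \<otimes>\<^bsub>A\<^esub> h)"
      using norm_star_mult[of h] norm_star_mult[of "\<alpha> t h"] Suc.prems by (simp_all add: \<alpha>_mult)
    moreover have "cnorm A (\<alpha> t (h \<otimes>\<^bsub>A\<^esub> h)) ^ (2 ^ n) \<le> K * cnorm A (h \<otimes>\<^bsub>A\<^esub> h) ^ (2 ^ n)"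
      using Suc.prems by (intro Suc.IH) (auto simp: star_mult)
    ultimately show ?case by (simp add: power_mult[symmetric] mult.commute flip: power_mult)
      (metis power_mult)
  qed
  have sa: "cnorm A (\<alpha> t h) \<le> cnorm A h" if h: "h \<in> D (- t)" "star A h = h" for h
  proof (rule ccontr)
    assume "\<not> ?thesis"
    then have less: "cnorm A h < cnorm A (\<alpha> t h)" by simp
    have pos: "cnorm A h > 0"
    proof (rule ccontr)
      assume "\<not> ?thesis"
      then have "cnorm A h = 0" using h by (simp add: order_antisym)
      then show False using less K(2)[OF h(1)] by simp
    qed
    define q where "q = cnorm A (\<alpha> t h) / cnorm A h"
    have q: "q > 1" using less pos by (simp add: q_def)
    obtain n where n: "K < q ^ n" using real_arch_pow[OF q] by blast
    also have "q ^ n \<le> q ^ (2 ^ n)" using q by (intro power_increasing) (auto intro: less_imp_le)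
    also have "q ^ (2 ^ n) \<le> K" using pow[OF h, of n] pos by (simp add: q_def power_divide field_simps)
    finally show False by simp
  qed
  have "(cnorm A (\<alpha> t x))\<^sup>2 = cnorm A (\<alpha> t (star A x \<otimes>\<^bsub>A\<^esub> x))"
    using x norm_star_mult[of "\<alpha> t x"] by (simp add: \<alpha>_mult \<alpha>_star)
  also have "\<dots> \<le> cnorm A (star A x \<otimes>\<^bsub>A\<^esub> x)"
    using x by (intro sa) (auto simp: star_mult)
  also have "\<dots> = (cnorm A x)\<^sup>2" using x norm_star_mult[of x] by simp
  finally show ?thesis by (rule power2_le_imp_le) (use x in simp)
qed

end

section \<open>Products of translates with elements of the algebra\<close>

locale globalizable_partial = cstar_partial A D \<alpha>
  for A :: "('a, 'm) cstar_algebra_scheme" (structure)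
    and D :: "'g::topological_group_add \<Rightarrow> 'a set" and \<alpha> :: "'g \<Rightarrow> 'a \<Rightarrow> 'a" +
  assumes globalizable: "\<And>t a b. \<lbrakk>a \<in> carrier A; b \<in> carrier A\<rbrakk> \<Longrightarrow>
    \<exists>u\<in>D t. \<forall>c\<in>D (- t). \<alpha> t c \<otimes>\<^bsub>A\<^esub> u = \<alpha> t (c \<otimes>\<^bsub>A\<^esub> a) \<otimes>\<^bsub>A\<^esub> b"
begin

text \<open>In a globalization this is the product \<open>\<beta>\<^sub>t(a) b\<close>.\<close>

definition tprod :: "'g \<Rightarrow> 'a \<Rightarrow> 'a \<Rightarrow> 'a"
  where "tprod t a b = (SOME u. u \<in> D t \<and>
    (\<forall>c\<in>D (- t). \<alpha> t c \<otimes>\<^bsub>A\<^esub> u = \<alpha> t (c \<otimes>\<^bsub>A\<^esub> a) \<otimes>\<^bsub>A\<^esub> b))"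

lemma
  assumes "a \<in> carrier A" "b \<in> carrier A"
  shows tprod_in [simp]: "tprod t a b \<in> D t"
    and tprod_test: "c \<in> D (- t) \<Longrightarrow> \<alpha> t c \<otimes>\<^bsub>A\<^esub> tprod t a b = \<alpha> t (c \<otimes>\<^bsub>A\<^esub> a) \<otimes>\<^bsub>A\<^esub> b"
proof -
  have "\<exists>u. u \<in> D t \<and> (\<forall>c\<in>D (- t). \<alpha> t c \<otimes>\<^bsub>A\<^esub> u = \<alpha> t (c \<otimes>\<^bsub>A\<^esub> a) \<otimes>\<^bsub>A\<^esub> b)"
    using globalizable[OF assms] by blast
  from someI_ex[OF this, folded tprod_def]
  show "tprod t a b \<in> D t"
    and "c \<in> D (- t) \<Longrightarrow> \<alpha> t c \<otimes>\<^bsub>A\<^esub> tprod t a b = \<alpha> t (c \<otimes>\<^bsub>A\<^esub> a) \<otimes>\<^bsub>A\<^esub> b" by auto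
qed

lemma tprod_closed [simp]:
  "\<lbrakk>a \<in> carrier A; b \<in> carrier A\<rbrakk> \<Longrightarrow> tprod t a b \<in> carrier A"
  using tprod_in D_carrier by blast

lemma tprod_eqI:
  assumes "a \<in> carrier A" "b \<in> carrier A" "w \<in> D t"
    and w: "\<And>c. c \<in> D (- t) \<Longrightarrow> \<alpha> t c \<otimes>\<^bsub>A\<^esub> w = \<alpha> t (c \<otimes>\<^bsub>A\<^esub> a) \<otimes>\<^bsub>A\<^esub> b"
  shows "tprod t a b = w"
proof (rule star_ideal_eqI[OF D_ideal])
  fix x assume "x \<in> D t"
  then show "x \<otimes>\<^bsub>A\<^esub> tprod t a b = x \<otimes>\<^bsub>A\<^esub> w"
    using w[of "\<alpha> (- t) x"] tprod_test[OF assms(1,2), of "\<alpha> (- t) x" t] by simp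
qed (use assms in auto)

lemma tprod_add_left:
  "\<lbrakk>a \<in> carrier A; a' \<in> carrier A; b \<in> carrier A\<rbrakk>
    \<Longrightarrow> tprod t (a \<oplus>\<^bsub>A\<^esub> a') b = tprod t a b \<oplus>\<^bsub>A\<^esub> tprod t a' b"
  by (rule tprod_eqI) (auto simp: mult_r_distr \<alpha>_add mult_l_distr tprod_test)

lemma tprod_smult_left:
  "\<lbrakk>a \<in> carrier A; b \<in> carrier A\<rbrakk> \<Longrightarrow> tprod t (k \<odot> a) b = k \<odot> tprod t a b"
  by (rule tprod_eqI) (auto simp: smult_mult_r \<alpha>_smult smult_mult_l tprod_test)

lemma tprod_mult_left:
  "\<lbrakk>a \<in> carrier A; a' \<in> carrier A; b \<in> carrier A\<rbrakk>
    \<Longrightarrow> tprod t (a \<otimes>\<^bsub>A\<^esub> a') b = tprod t a (tprod t a' b)"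
  by (rule tprod_eqI) (auto simp: tprod_test simp flip: mult_assoc)

lemma tprod_mult_right:
  "\<lbrakk>a \<in> carrier A; b \<in> carrier A; d \<in> carrier A\<rbrakk>
    \<Longrightarrow> tprod t a (b \<otimes>\<^bsub>A\<^esub> d) = tprod t a b \<otimes>\<^bsub>A\<^esub> d"
  by (rule tprod_eqI) (auto simp: tprod_test simp flip: mult_assoc)

lemma tprod_0: "\<lbrakk>a \<in> carrier A; b \<in> carrier A\<rbrakk> \<Longrightarrow> tprod 0 a b = a \<otimes>\<^bsub>A\<^esub> b"
  by (rule tprod_eqI) (auto simp: mult_assoc)

lemma tprod_domain_left:
  "\<lbrakk>x \<in> D (- t); b \<in> carrier A\<rbrakk> \<Longrightarrow> tprod t x b = \<alpha> t x \<otimes>\<^bsub>A\<^esub> b"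
  by (rule tprod_eqI) (auto simp: \<alpha>_mult mult_assoc)

lemma tprod_domain_right:
  "\<lbrakk>a \<in> carrier A; v \<in> D t\<rbrakk> \<Longrightarrow> tprod t a v = \<alpha> t (a \<otimes>\<^bsub>A\<^esub> \<alpha> (- t) v)"
proof (rule tprod_eqI)
  fix c assume *: "a \<in> carrier A" "v \<in> D t" "c \<in> D (- t)"
  have "\<alpha> t (c \<otimes>\<^bsub>A\<^esub> a) \<otimes>\<^bsub>A\<^esub> v = \<alpha> t (c \<otimes>\<^bsub>A\<^esub> a \<otimes>\<^bsub>A\<^esub> \<alpha> (- t) v)"
    using * by (subst \<alpha>_mult) auto
  then show "\<alpha> t c \<otimes>\<^bsub>A\<^esub> \<alpha> t (a \<otimes>\<^bsub>A\<^esub> \<alpha> (- t) v) = \<alpha> t (c \<otimes>\<^bsub>A\<^esub> a) \<otimes>\<^bsub>A\<^esub> v"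
    using * D_carrier[OF \<alpha>_closed', of v t] by (simp add: mult_assoc flip: \<alpha>_mult)
qed auto

text \<open>In a globalization, \<open>(\<beta>\<^sub>t(a) b)\<^sup>* d = b\<^sup>* (\<beta>\<^sub>t(a\<^sup>*) d)\<close>.  Both sides lie in \<open>D t\<close>, so they may be compared
  after multiplication by \<open>x \<in> D t\<close>; then \<open>x b\<^sup>*\<close> is in the range of \<open>\<alpha> t\<close>, and the defining property of \<open>tprod\<close>
  applies.\<close>

lemma tprod_adjoint:
  assumes a: "a \<in> carrier A" and b: "b \<in> carrier A" and d: "d \<in> carrier A"
  shows "star A (tprod t a b) \<otimes>\<^bsub>A\<^esub> d = star A b \<otimes>\<^bsub>A\<^esub> tprod t (star A a) d"
proof (rule star_ideal_eqI[OF D_ideal[of t]])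
  fix x assume x: "x \<in> D t"
  define c where "c = \<alpha> (- t) (x \<otimes>\<^bsub>A\<^esub> star A b)"
  have c: "c \<in> D (- t)" using x b by (simp add: c_def)
  have cs: "star A c = \<alpha> (- t) (b \<otimes>\<^bsub>A\<^esub> star A x)"
    using \<alpha>_star[of "x \<otimes>\<^bsub>A\<^esub> star A b" "- t"] x b by (simp add: c_def star_mult)
  have "tprod t a b \<otimes>\<^bsub>A\<^esub> star A x = \<alpha> t (a \<otimes>\<^bsub>A\<^esub> star A c)"
    using tprod_mult_right[of a b "star A x" t] tprod_domain_right[of a "b \<otimes>\<^bsub>A\<^esub> star A x" t] a b x
    by (simp add: cs)
  then have "star A (tprod t a b \<otimes>\<^bsub>A\<^esub> star A x) = \<alpha> t (c \<otimes>\<^bsub>A\<^esub> star A a)"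
    using a c by (simp add: star_mult flip: \<alpha>_star)
  then have "x \<otimes>\<^bsub>A\<^esub> star A (tprod t a b) = \<alpha> t (c \<otimes>\<^bsub>A\<^esub> star A a)"
    using a b x by (simp add: star_mult)
  then have "x \<otimes>\<^bsub>A\<^esub> (star A (tprod t a b) \<otimes>\<^bsub>A\<^esub> d) = \<alpha> t (c \<otimes>\<^bsub>A\<^esub> star A a) \<otimes>\<^bsub>A\<^esub> d"
    using a b x d by (simp flip: mult_assoc)
  also have "\<dots> = \<alpha> t c \<otimes>\<^bsub>A\<^esub> tprod t (star A a) d"
    using c a d by (simp add: tprod_test)
  also have "\<dots> = x \<otimes>\<^bsub>A\<^esub> (star A b \<otimes>\<^bsub>A\<^esub> tprod t (star A a) d)"
    using a b x d by (simp add: c_def mult_assoc)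
  finally show "x \<otimes>\<^bsub>A\<^esub> (star A (tprod t a b) \<otimes>\<^bsub>A\<^esub> d)
    = x \<otimes>\<^bsub>A\<^esub> (star A b \<otimes>\<^bsub>A\<^esub> tprod t (star A a) d)" .
qed (use assms in auto)

text \<open>With \<open>u = \<beta>\<^sub>t(a) b\<close> one has \<open>u\<^sup>* u = b\<^sup>* (\<beta>\<^sub>t(a\<^sup>*) u)\<close>, where \<open>u \<in> D t\<close> makes the inner product an
  honest value of \<open>\<alpha> t\<close>.\<close>

lemma tprod_norm:
  assumes a: "a \<in> carrier A" and b: "b \<in> carrier A"
  shows "cnorm A (tprod t a b) \<le> cnorm A a * cnorm A b"
proof (cases "cnorm A (tprod t a b) = 0")
  case True then show ?thesis using a b by simp
next
  case False
  let ?u = "tprod t a b"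
  have u: "?u \<in> D t" using a b by simp
  have "cnorm A (\<alpha> t (star A a \<otimes>\<^bsub>A\<^esub> \<alpha> (- t) ?u)) \<le> cnorm A (star A a \<otimes>\<^bsub>A\<^esub> \<alpha> (- t) ?u)"
    using u a by (intro \<alpha>_norm_le) auto
  also have "\<dots> \<le> cnorm A a * cnorm A ?u"
    using u a \<alpha>_norm_le[of ?u "- t"] D_carrier[OF \<alpha>_closed'[OF u]] by (intro mult_bound) auto
  finally have "cnorm A (tprod t (star A a) ?u) \<le> cnorm A a * cnorm A ?u"
    using u a by (simp add: tprod_domain_right)
  then have "cnorm A ?u * cnorm A ?u \<le> cnorm A b * (cnorm A a * cnorm A ?u)"
    using norm_star_mult[of ?u] tprod_adjoint[of a b ?u t] a b
      mult_bound[of "star A b" "tprod t (star A a) ?u"] by (simp add: power2_eq_square)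
  moreover have "cnorm A ?u > 0" using False norm_nonneg[of ?u] a b by (simp add: less_le del: norm_nonneg)
  ultimately show ?thesis by (simp add: mult.assoc[symmetric]) (simp add: mult.commute)
qed

text \<open>The identity \<open>\<beta>\<^sub>r(\<beta>\<^sub>t(a) b) d = \<beta>\<^sub>r\<^sub>t(a) (\<beta>\<^sub>r(b) d)\<close> cannot be tested directly, because the right-hand
  side is only known to lie in \<open>A\<^sub>r\<^sub>t\<close> and the left-hand side in \<open>A\<^sub>r\<close>.  Its adjoint form,
  proved first, has both sides in \<open>A\<^sub>r\<close>.\<close>

lemma tprod_tprod_adjoint_form:
  assumes a: "a \<in> carrier A" and b: "b \<in> carrier A" and g: "g \<in> carrier A"
  shows "tprod r b (tprod (r + t) a g) = tprod r (star A (tprod t (star A a) (star A b))) g"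
proof (rule tprod_eqI)
  define n where "n = star A (tprod t (star A a) (star A b))"
  have n: "n \<in> D t" using a b by (simp add: n_def)
  \<comment> \<open>\<open>n\<close> plays the role of \<open>b \<beta>\<^sub>t(a)\<close>.\<close>
  have qn: "q \<otimes>\<^bsub>A\<^esub> n = \<alpha> t (\<alpha> (- t) (q \<otimes>\<^bsub>A\<^esub> b) \<otimes>\<^bsub>A\<^esub> a)" if q: "q \<in> D t" for q
  proof -
    have "tprod t (star A a) (star A b) \<otimes>\<^bsub>A\<^esub> star A q
        = \<alpha> t (star A a \<otimes>\<^bsub>A\<^esub> \<alpha> (- t) (star A b \<otimes>\<^bsub>A\<^esub> star A q))"
      using tprod_mult_right[of "star A a" "star A b" "star A q" t]
        tprod_domain_right[of "star A a" "star A b \<otimes>\<^bsub>A\<^esub> star A q" t] a b q by simp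
    also have "\<alpha> (- t) (star A b \<otimes>\<^bsub>A\<^esub> star A q) = star A (\<alpha> (- t) (q \<otimes>\<^bsub>A\<^esub> b))"
      using \<alpha>_star[of "q \<otimes>\<^bsub>A\<^esub> b" "- t"] b q by (simp add: star_mult)
    finally have "star A (tprod t (star A a) (star A b) \<otimes>\<^bsub>A\<^esub> star A q)
        = \<alpha> t (\<alpha> (- t) (q \<otimes>\<^bsub>A\<^esub> b) \<otimes>\<^bsub>A\<^esub> a)"
      using \<alpha>_star[of "star A a \<otimes>\<^bsub>A\<^esub> star A (\<alpha> (- t) (q \<otimes>\<^bsub>A\<^esub> b))" t] a b q
        D_carrier[OF \<alpha>_closed', of "q \<otimes>\<^bsub>A\<^esub> b" t] by (simp add: star_mult)
    then show ?thesis using a b q by (simp add: star_mult n_def)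
  qed
  fix c assume c: "c \<in> D (- r)"
  \<comment> \<open>On \<open>D r \<inter> D (r + t)\<close> the maps \<open>\<alpha> r\<close> and \<open>\<alpha> (r + t) \<circ> \<alpha> (- t)\<close> agree, so both sides can be tested there.\<close>
  have J: "star_ideal (D r \<inter> D (r + t)) A"
  proof -
    have "submodule (D r \<inter> D (r + t)) complex_ring A"
      by (rule submoduleI) (auto simp: minus_eq_smult)
    then show ?thesis unfolding star_ideal_def
      by (auto simp: image_iff) (metis D_carrier D_star IntI star_star)
  qed
  have "\<alpha> r (c \<otimes>\<^bsub>A\<^esub> n) \<otimes>\<^bsub>A\<^esub> g = \<alpha> r (c \<otimes>\<^bsub>A\<^esub> b) \<otimes>\<^bsub>A\<^esub> tprod (r + t) a g"
  proof (rule star_ideal_eqI[OF J])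
    show "\<alpha> r (c \<otimes>\<^bsub>A\<^esub> n) \<otimes>\<^bsub>A\<^esub> g \<in> D r \<inter> D (r + t)"
      using \<alpha>_domain(3)[of "c \<otimes>\<^bsub>A\<^esub> n" r t] c n g by simp
    have "\<alpha> r (c \<otimes>\<^bsub>A\<^esub> b) \<in> D r" using b c by simp
    then show "\<alpha> r (c \<otimes>\<^bsub>A\<^esub> b) \<otimes>\<^bsub>A\<^esub> tprod (r + t) a g \<in> D r \<inter> D (r + t)"
      using D_mult'[of "tprod (r + t) a g" "r + t"] a g by simp
  next
    fix x assume "x \<in> D r \<inter> D (r + t)"
    then have x: "x \<in> D r" "x \<in> D (r + t)" by auto
    define y where "y = \<alpha> (- r) x"
    have y: "y \<in> D (- r)" "y \<in> D t" and xy: "\<alpha> r y = x"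
      using \<alpha>_domain(3)[of x "- r" "r + t"] x by (auto simp: y_def simp flip: add.assoc)
    have q: "y \<otimes>\<^bsub>A\<^esub> c \<in> D t" "y \<otimes>\<^bsub>A\<^esub> c \<in> D (- r)" using y c by auto
    have trans: "\<alpha> r z = \<alpha> (r + t) (\<alpha> (- t) z)" if "z \<in> D (- r)" "z \<in> D t" for z
      using \<alpha>_domain(2)[OF that] by simp
    have z: "\<alpha> (- t) (y \<otimes>\<^bsub>A\<^esub> c \<otimes>\<^bsub>A\<^esub> b) \<in> D (- (r + t))"
      using q b by (intro \<alpha>_domain(1)) auto
    have zt: "\<alpha> (- t) (y \<otimes>\<^bsub>A\<^esub> c \<otimes>\<^bsub>A\<^esub> b) \<in> D (- t)" using q b by simp
    have "x \<otimes>\<^bsub>A\<^esub> \<alpha> r (c \<otimes>\<^bsub>A\<^esub> n) = \<alpha> r (y \<otimes>\<^bsub>A\<^esub> c \<otimes>\<^bsub>A\<^esub> n)"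
      using y c n \<alpha>_mult[of y r "c \<otimes>\<^bsub>A\<^esub> n"] by (simp add: xy mult_assoc)
    also have "\<dots> = \<alpha> (r + t) (\<alpha> (- t) (y \<otimes>\<^bsub>A\<^esub> c \<otimes>\<^bsub>A\<^esub> n))"
      using q n by (intro trans) auto
    also have "\<alpha> (- t) (y \<otimes>\<^bsub>A\<^esub> c \<otimes>\<^bsub>A\<^esub> n) = \<alpha> (- t) (y \<otimes>\<^bsub>A\<^esub> c \<otimes>\<^bsub>A\<^esub> b) \<otimes>\<^bsub>A\<^esub> a"
      unfolding qn[OF q(1)] using zt a by simp
    finally have l: "x \<otimes>\<^bsub>A\<^esub> \<alpha> r (c \<otimes>\<^bsub>A\<^esub> n) = \<alpha> (r + t) (\<alpha> (- t) (y \<otimes>\<^bsub>A\<^esub> c \<otimes>\<^bsub>A\<^esub> b) \<otimes>\<^bsub>A\<^esub> a)" .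
    have "x \<otimes>\<^bsub>A\<^esub> \<alpha> r (c \<otimes>\<^bsub>A\<^esub> b) = \<alpha> r (y \<otimes>\<^bsub>A\<^esub> c \<otimes>\<^bsub>A\<^esub> b)"
      using y c b \<alpha>_mult[of y r "c \<otimes>\<^bsub>A\<^esub> b"] by (simp add: xy mult_assoc)
    also have "\<dots> = \<alpha> (r + t) (\<alpha> (- t) (y \<otimes>\<^bsub>A\<^esub> c \<otimes>\<^bsub>A\<^esub> b))"
      using q b by (intro trans) auto
    finally have r: "x \<otimes>\<^bsub>A\<^esub> \<alpha> r (c \<otimes>\<^bsub>A\<^esub> b) = \<alpha> (r + t) (\<alpha> (- t) (y \<otimes>\<^bsub>A\<^esub> c \<otimes>\<^bsub>A\<^esub> b))" .
    have "\<alpha> r (c \<otimes>\<^bsub>A\<^esub> n) \<in> carrier A" "\<alpha> r (c \<otimes>\<^bsub>A\<^esub> b) \<in> carrier A"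
      using D_carrier[OF \<alpha>_closed] c n b by auto
    then show "x \<otimes>\<^bsub>A\<^esub> (\<alpha> r (c \<otimes>\<^bsub>A\<^esub> n) \<otimes>\<^bsub>A\<^esub> g)
        = x \<otimes>\<^bsub>A\<^esub> (\<alpha> r (c \<otimes>\<^bsub>A\<^esub> b) \<otimes>\<^bsub>A\<^esub> tprod (r + t) a g)"
      using x a g tprod_test[OF a g z] by (simp add: l r flip: mult_assoc)
  qed
  then show "\<alpha> r c \<otimes>\<^bsub>A\<^esub> tprod r (star A (tprod t (star A a) (star A b))) g
      = \<alpha> r (c \<otimes>\<^bsub>A\<^esub> b) \<otimes>\<^bsub>A\<^esub> tprod (r + t) a g"
    using tprod_test[of n g c r] n g c by (simp add: n_def)
qed (use assms in auto)

lemma tprod_tprod: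
  assumes a: "a \<in> carrier A" and b: "b \<in> carrier A" and d: "d \<in> carrier A"
  shows "tprod (r + t) a (tprod r b d) = tprod r (tprod t a b) d"
proof (rule carrier_eqI)
  fix x assume x: "x \<in> carrier A"
  have adj: "x \<otimes>\<^bsub>A\<^esub> tprod s a' b' = star A (tprod s (star A a') (star A x)) \<otimes>\<^bsub>A\<^esub> b'"
    if "a' \<in> carrier A" "b' \<in> carrier A" "x \<in> carrier A" for s a' b' x
    using tprod_adjoint[of "star A a'" "star A x" b' s] that by simp
  have "x \<otimes>\<^bsub>A\<^esub> tprod (r + t) a (tprod r b d)
      = star A (tprod r (star A b) (tprod (r + t) (star A a) (star A x))) \<otimes>\<^bsub>A\<^esub> d"
    using a b d x by (simp add: adj)
  also have "\<dots> = x \<otimes>\<^bsub>A\<^esub> tprod r (tprod t a b) d"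
    using a b d x by (simp add: adj tprod_tprod_adjoint_form)
  finally show "x \<otimes>\<^bsub>A\<^esub> tprod (r + t) a (tprod r b d) = x \<otimes>\<^bsub>A\<^esub> tprod r (tprod t a b) d" .
qed (use assms in auto)

end

section \<open>The globalization inside the algebra of multiplier families\<close>

context globalizable_partial begin

text \<open>\<open>\<beta>\<^sub>t\<close> extends \<open>\<alpha>\<^sub>t\<close>: the difference of \<open>\<beta>\<^sub>t(x)\<close> and \<open>\<alpha>\<^sub>t(x)\<close> annihilates both \<open>A\<close> and \<open>\<beta>\<^sub>t(A)\<close>, and it lies
  in their sum, so it vanishes.\<close>

lemma tprod_transport:
  assumes x: "x \<in> D (- t)" and b: "b \<in> carrier A"
  shows "tprod (r + t) x b = tprod r (\<alpha> t x) b"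
proof -
  \<comment> \<open>\<open>\<beta>\<^sub>t(v)\<close> and \<open>\<alpha>\<^sub>t(v)\<close> have the same products with \<open>\<beta>\<^sub>r(c) d\<close> and with \<open>\<beta>\<^sub>r\<^sub>t(c) d\<close>.\<close>
  have f1: "tprod (r + t) v (tprod r c d) = tprod r (\<alpha> t v) (tprod r c d)"
    if v: "v \<in> D (- t)" and c: "c \<in> carrier A" "d \<in> carrier A" for v c d
    using that by (simp add: tprod_tprod tprod_domain_left flip: tprod_mult_left)
  have f2: "tprod r (\<alpha> t v) (tprod (r + t) c d) = tprod (r + t) v (tprod (r + t) c d)"
    if v: "v \<in> D (- t)" and c: "c \<in> carrier A" "d \<in> carrier A" for v c d
  proof -
    have "tprod r (\<alpha> t v) (tprod (r + t) c d) = tprod (r + t) (tprod (- t) (\<alpha> t v) c) d"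
      using tprod_tprod[of "\<alpha> t v" c d "r + t" "- t"] that by (simp add: add.assoc)
    also have "tprod (- t) (\<alpha> t v) c = v \<otimes>\<^bsub>A\<^esub> c"
      using tprod_domain_left[of "\<alpha> t v" "- t" c] that by simp
    finally show ?thesis using that by (simp add: tprod_mult_left)
  qed
  define p where "p = tprod (r + t) x b"
  define q where "q = tprod r (\<alpha> t x) b"
  have pq: "p \<in> carrier A" "q \<in> carrier A" using x b by (simp_all add: p_def q_def)
  have xs: "star A x \<in> D (- t)" "\<alpha> t (star A x) = star A (\<alpha> t x)"
    using x by (simp_all add: \<alpha>_star)
  have "star A p \<otimes>\<^bsub>A\<^esub> d = star A b \<otimes>\<^bsub>A\<^esub> tprod (r + t) (star A x) d"
    and "star A q \<otimes>\<^bsub>A\<^esub> d = star A b \<otimes>\<^bsub>A\<^esub> tprod r (star A (\<alpha> t x)) d" if "d \<in> carrier A" for d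
    using that x b by (simp_all add: p_def q_def tprod_adjoint)
  moreover have "tprod (r + t) (star A x) p = tprod r (star A (\<alpha> t x)) p"
    using f2[OF xs(1), of x b] x b by (simp add: p_def xs)
  moreover have "tprod (r + t) (star A x) q = tprod r (star A (\<alpha> t x)) q"
    using f1[OF xs(1), of "\<alpha> t x" b] x b by (simp add: q_def xs)
  ultimately have "star A (p \<ominus>\<^bsub>A\<^esub> q) \<otimes>\<^bsub>A\<^esub> p = \<zero>\<^bsub>A\<^esub>" "star A (p \<ominus>\<^bsub>A\<^esub> q) \<otimes>\<^bsub>A\<^esub> q = \<zero>\<^bsub>A\<^esub>"
    using pq x b by (simp_all add: star_diff mult_l_diff diff_zero_iff)
  then have "star A (p \<ominus>\<^bsub>A\<^esub> q) \<otimes>\<^bsub>A\<^esub> (p \<ominus>\<^bsub>A\<^esub> q) = \<zero>\<^bsub>A\<^esub>"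
    using pq by (simp add: mult_r_diff diff_zero_iff)
  then have "p = q" using star_mult_self_eq_zero[of "p \<ominus>\<^bsub>A\<^esub> q"] pq by (simp add: diff_zero_iff)
  then show ?thesis by (simp add: p_def q_def)
qed

abbreviation MA :: "('g \<Rightarrow> 'a \<Rightarrow> 'a) cstar_algebra" where "MA \<equiv> multiplier_algebra A"

abbreviation MF :: "('g \<Rightarrow> 'a \<Rightarrow> 'a) set" where "MF \<equiv> multiplier_families A"

interpretation MA: cstar_algebra MA
  by (rule multiplier_algebra_cstar)

lemmas MF_closed [simp] = multiplier_families_unary(1,2) multiplier_families_binary(1,2) zero_family(1)

lemma MF_diff [simp]: "F \<in> MF \<Longrightarrow> G \<in> MF \<Longrightarrow> F \<ominus>\<^bsub>MA\<^esub> G \<in> MF"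
  using MA.M.minus_closed[of F G] by simp

text \<open>As \<open>emb a r\<close> below stands for the multiplier \<open>\<beta>\<^sub>r(a)\<close>, and \<open>\<beta>\<^sub>r(\<beta>\<^sub>s(a)) = \<beta>\<^sub>r\<^sub>s(a)\<close>, the global action has to
  translate the index on the right.\<close>

definition shift :: "'g \<Rightarrow> ('g \<Rightarrow> 'a \<Rightarrow> 'a) \<Rightarrow> 'g \<Rightarrow> 'a \<Rightarrow> 'a"
  where "shift s F = (\<lambda>r. F (r + s))"

lemma shift_apply [simp]: "shift s F r = F (r + s)"
  by (simp add: shift_def)

lemma shift_0 [simp]: "shift 0 F = F"
  by (simp add: shift_def)

lemma shift_shift [simp]: "shift s (shift t F) = shift (s + t) F"
  by (simp add: shift_def add.assoc)

lemma shift_closed [simp]: "F \<in> MF \<Longrightarrow> shift s F \<in> MF"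
  unfolding multiplier_families_def family_bound_def by (auto simp: shift_def)

lemma shift_hom:
  "shift s (F \<oplus>\<^bsub>MA\<^esub> G) = shift s F \<oplus>\<^bsub>MA\<^esub> shift s G"
  "shift s (F \<otimes>\<^bsub>MA\<^esub> G) = shift s F \<otimes>\<^bsub>MA\<^esub> shift s G"
  "shift s (k \<odot>\<^bsub>MA\<^esub> F) = k \<odot>\<^bsub>MA\<^esub> shift s F"
  "shift s (star MA F) = star MA (shift s F)"
  by (simp_all add: multiplier_algebra_def shift_def restrict_def)

lemma shift_diff:
  "\<lbrakk>F \<in> MF; G \<in> MF\<rbrakk> \<Longrightarrow> shift s (F \<ominus>\<^bsub>MA\<^esub> G) = shift s F \<ominus>\<^bsub>MA\<^esub> shift s G"
  by (simp add: MA.diff_eq_smult shift_hom)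

lemma fnorm_shift [simp]:
  assumes F: "F \<in> MF" shows "fnorm (shift s F) = fnorm F"
proof -
  have le: "fnorm (shift s F) \<le> fnorm F" if "F \<in> MF" for s F
    using fnorm_bound[OF that] by (intro fnorm_le) (auto simp: family_bound_def)
  show ?thesis using le[OF F, of s] le[of "shift s F" "- s"] F by simp
qed

definition emb :: "'a \<Rightarrow> 'g \<Rightarrow> 'a \<Rightarrow> 'a"
  where "emb a = (\<lambda>r. \<lambda>b\<in>carrier A. tprod r a b)"

lemma emb_apply [simp]: "b \<in> carrier A \<Longrightarrow> emb a r b = tprod r a b"
  by (simp add: emb_def)

lemma emb_is_adjoint: "a \<in> carrier A \<Longrightarrow> is_adjoint A (emb a r) (emb (star A a) r)"
  unfolding is_adjoint_def by (auto simp: tprod_adjoint)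

lemma emb_bound: "a \<in> carrier A \<Longrightarrow> family_bound A (emb a) (cnorm A a)"
  unfolding family_bound_def by (auto simp: tprod_norm)

lemma emb_closed [simp]: "a \<in> carrier A \<Longrightarrow> emb a \<in> MF"
  by (rule multiplier_familiesI[OF _ emb_is_adjoint emb_bound]) (auto simp: emb_def)

lemma emb_hom:
  "\<lbrakk>a \<in> carrier A; b \<in> carrier A\<rbrakk> \<Longrightarrow> emb (a \<oplus>\<^bsub>A\<^esub> b) = emb a \<oplus>\<^bsub>MA\<^esub> emb b"
  "a \<in> carrier A \<Longrightarrow> emb (k \<odot> a) = k \<odot>\<^bsub>MA\<^esub> emb a"
  "\<lbrakk>a \<in> carrier A; b \<in> carrier A\<rbrakk> \<Longrightarrow> emb (a \<otimes>\<^bsub>A\<^esub> b) = emb a \<otimes>\<^bsub>MA\<^esub> emb b"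
  "a \<in> carrier A \<Longrightarrow> emb (star A a) = star MA (emb a)"
  by (auto intro!: family_ext simp: tprod_add_left tprod_smult_left tprod_mult_left
      adjoint_eq[OF emb_is_adjoint])

lemma emb_diff: "\<lbrakk>a \<in> carrier A; b \<in> carrier A\<rbrakk> \<Longrightarrow> emb (a \<ominus>\<^bsub>A\<^esub> b) = emb a \<ominus>\<^bsub>MA\<^esub> emb b"
  by (simp add: diff_eq_smult MA.diff_eq_smult emb_hom)

lemma fnorm_emb [simp]:
  assumes a: "a \<in> carrier A" shows "fnorm (emb a) = cnorm A a"
proof (rule antisym)
  show "fnorm (emb a) \<le> cnorm A a" using a by (intro fnorm_le emb_bound)
  show "cnorm A a \<le> fnorm (emb a)"
  proof (cases "cnorm A a = 0")
    case True then show ?thesis using a fnorm_nonneg[of "emb a"] by simp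
  next
    case False
    then have "cnorm A a > 0" using norm_nonneg[OF a] by (simp add: less_le del: norm_nonneg)
    moreover have "cnorm A a * cnorm A a \<le> fnorm (emb a) * cnorm A a"
      using fnorm_apply[of "emb a" "star A a" 0] norm_mult_star[OF a] a
      by (simp add: tprod_0 power2_eq_square)
    ultimately show ?thesis by simp
  qed
qed

lemma emb_inj: "inj_on emb (carrier A)"
proof (rule inj_onI)
  fix a b assume ab: "a \<in> carrier A" "b \<in> carrier A" "emb a = emb b"
  then have "emb (a \<ominus>\<^bsub>A\<^esub> b) = \<zero>\<^bsub>MA\<^esub>"
    using MA.diff_zero_iff[of "emb b" "emb b"] by (simp add: emb_diff)
  then have "cnorm A (a \<ominus>\<^bsub>A\<^esub> b) = 0"
    using fnorm_emb[of "a \<ominus>\<^bsub>A\<^esub> b"] ab by simp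
  then show "a = b" using ab by (simp add: norm_eq_0_iff diff_zero_iff)
qed

lemma shift_emb_mult_emb:
  "\<lbrakk>a \<in> carrier A; b \<in> carrier A\<rbrakk> \<Longrightarrow> shift t (emb a) \<otimes>\<^bsub>MA\<^esub> emb b = emb (tprod t a b)"
  by (rule family_ext) (simp_all add: tprod_tprod)

lemma shift_emb_domain: "x \<in> D (- t) \<Longrightarrow> shift t (emb x) = emb (\<alpha> t x)"
  by (rule family_ext) (simp_all add: tprod_transport)

text \<open>The range of \<open>emb\<close> is complete, because \<open>A\<close> is complete and \<open>emb\<close> is isometric.\<close>

lemma emb_range_closed: "closedin (norm_topology MA) (emb ` carrier A)"
  unfolding MA.closedin_norm_iff
proof (intro conjI ballI impI)
  fix H assume "H \<in> carrier MA" and approx: "\<forall>e>0. \<exists>G\<in>emb ` carrier A. fnorm (G \<ominus>\<^bsub>MA\<^esub> H) < e"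
  then have H: "H \<in> MF" by simp
  have "\<exists>a\<in>carrier A. fnorm (emb a \<ominus>\<^bsub>MA\<^esub> H) < 1 / real (Suc n)" for n
    using approx[rule_format, of "1 / real (Suc n)"] by auto
  then obtain \<xi> where \<xi>: "\<And>n. \<xi> n \<in> carrier A" "\<And>n. fnorm (emb (\<xi> n) \<ominus>\<^bsub>MA\<^esub> H) < 1 / real (Suc n)"
    by metis
  have le: "cnorm A (a \<ominus>\<^bsub>A\<^esub> b) \<le> fnorm (emb a \<ominus>\<^bsub>MA\<^esub> H) + fnorm (emb b \<ominus>\<^bsub>MA\<^esub> H)"
    if "a \<in> carrier A" "b \<in> carrier A" for a b
    using MA.norm_diff_triangle[of "emb a" H "emb b"] MA.norm_diff_commute[of H "emb b"] that H
      fnorm_emb[of "a \<ominus>\<^bsub>A\<^esub> b"] by (simp add: emb_diff)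
  obtain l where l: "l \<in> carrier A" "(\<lambda>n. cnorm A (\<xi> n \<ominus>\<^bsub>A\<^esub> l)) \<longlonglongrightarrow> 0"
  proof (rule cauchy_limit[of \<xi>])
    fix e :: real assume "e > 0"
    then obtain N where N: "1 / real (Suc N) < e / 2" using nat_approx_posE[of "e / 2"] by auto
    have "cnorm A (\<xi> m \<ominus>\<^bsub>A\<^esub> \<xi> n) < e" if "m \<ge> N" "n \<ge> N" for m n
    proof -
      have "1 / real (Suc m) \<le> 1 / real (Suc N)" "1 / real (Suc n) \<le> 1 / real (Suc N)"
        using that by (auto simp: frac_le)
      then show ?thesis using le[OF \<xi>(1) \<xi>(1), of m n] \<xi>(2)[of m] \<xi>(2)[of n] N by linarith
    qed
    then show "\<exists>N. \<forall>m\<ge>N. \<forall>n\<ge>N. cnorm A (\<xi> m \<ominus>\<^bsub>A\<^esub> \<xi> n) < e" by blast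
  qed (use \<xi> in auto)
  have "fnorm (emb l \<ominus>\<^bsub>MA\<^esub> H) \<le> 0"
  proof (rule LIMSEQ_le_const)
    have "(\<lambda>n. 1 / real (Suc n)) \<longlonglongrightarrow> 0" by (rule LIMSEQ_Suc[OF lim_1_over_n])
    from tendsto_add[OF l(2) this]
    show "(\<lambda>n. cnorm A (\<xi> n \<ominus>\<^bsub>A\<^esub> l) + 1 / real (Suc n)) \<longlonglongrightarrow> 0" by simp
    have "fnorm (emb l \<ominus>\<^bsub>MA\<^esub> H) \<le> cnorm A (\<xi> n \<ominus>\<^bsub>A\<^esub> l) + 1 / real (Suc n)" for n
      using MA.norm_diff_triangle[of "emb l" "emb (\<xi> n)" H] MA.norm_diff_commute[of "emb l" "emb (\<xi> n)"]
        \<xi>(1)[of n] \<xi>(2)[of n] l(1) H fnorm_emb[of "\<xi> n \<ominus>\<^bsub>A\<^esub> l"] by (simp add: emb_diff)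
    then show "\<exists>N. \<forall>n\<ge>N. fnorm (emb l \<ominus>\<^bsub>MA\<^esub> H) \<le> cnorm A (\<xi> n \<ominus>\<^bsub>A\<^esub> l) + 1 / real (Suc n)" by blast
  qed
  then have "fnorm (emb l \<ominus>\<^bsub>MA\<^esub> H) = 0" using l H by (intro order_antisym fnorm_nonneg) auto
  then have "emb l = H"
    using l H MA.norm_eq_0_iff[of "emb l \<ominus>\<^bsub>MA\<^esub> H"] by (simp add: MA.diff_zero_iff)
  then show "H \<in> emb ` carrier A" using l by blast
qed auto

text \<open>Up to a translation this says that \<open>F\<close> multiplies each translate of \<open>emb ` carrier A\<close> into itself from the left;
  for the right-hand side the condition is imposed on the adjoint of \<open>F\<close>.\<close>

definition left_stable :: "('g \<Rightarrow> 'a \<Rightarrow> 'a) \<Rightarrow> bool"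
  where "left_stable F \<longleftrightarrow> (\<forall>s. \<forall>a\<in>carrier A. shift s F \<otimes>\<^bsub>MA\<^esub> emb a \<in> emb ` carrier A)"

definition orbit_continuous :: "('g \<Rightarrow> 'a \<Rightarrow> 'a) \<Rightarrow> bool"
  where "orbit_continuous F \<longleftrightarrow> ((\<lambda>t. fnorm (shift t F \<ominus>\<^bsub>MA\<^esub> F)) \<longlongrightarrow> 0) (nhds 0)"

text \<open>The algebra of the globalization: the idealizer of all translates of \<open>emb ` carrier A\<close>, cut down
  to the families on which translation is continuous.  The closed span of the translates
  of \<open>emb ` carrier A\<close> would do as well, but membership in it is much harder to verify.\<close>

definition glob :: "('g \<Rightarrow> 'a \<Rightarrow> 'a) set"
  where "glob = {F \<in> MF. left_stable F \<and> left_stable (star MA F) \<and> orbit_continuous F}"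

lemma emb_range_add:
  "\<lbrakk>F \<in> emb ` carrier A; G \<in> emb ` carrier A\<rbrakk> \<Longrightarrow> F \<oplus>\<^bsub>MA\<^esub> G \<in> emb ` carrier A"
  by (auto simp flip: emb_hom)

lemma left_stable_add:
  "\<lbrakk>F \<in> MF; G \<in> MF; left_stable F; left_stable G\<rbrakk> \<Longrightarrow> left_stable (F \<oplus>\<^bsub>MA\<^esub> G)"
  unfolding left_stable_def by (auto simp: shift_hom MA.mult_l_distr intro!: emb_range_add)

lemma left_stable_smult:
  "\<lbrakk>F \<in> MF; left_stable F\<rbrakk> \<Longrightarrow> left_stable (k \<odot>\<^bsub>MA\<^esub> F)"
  unfolding left_stable_def
  by (auto simp: shift_hom MA.smult_mult_l image_iff) (metis emb_hom(2) smult_cl)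

lemma left_stable_mult:
  assumes "F \<in> MF" "G \<in> MF" "left_stable F" "left_stable G"
  shows "left_stable (F \<otimes>\<^bsub>MA\<^esub> G)"
  unfolding left_stable_def
proof (intro allI ballI)
  fix s a assume a: "a \<in> carrier A"
  then obtain b where b: "b \<in> carrier A" "shift s G \<otimes>\<^bsub>MA\<^esub> emb a = emb b"
    using assms(4) unfolding left_stable_def by blast
  then have "shift s (F \<otimes>\<^bsub>MA\<^esub> G) \<otimes>\<^bsub>MA\<^esub> emb a = shift s F \<otimes>\<^bsub>MA\<^esub> emb b"
    using assms a by (simp add: shift_hom MA.mult_assoc)
  then show "shift s (F \<otimes>\<^bsub>MA\<^esub> G) \<otimes>\<^bsub>MA\<^esub> emb a \<in> emb ` carrier A"
    using assms(3) b(1) unfolding left_stable_def by simp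
qed

lemma left_stable_shift: "left_stable F \<Longrightarrow> left_stable (shift t F)"
  unfolding left_stable_def by simp

lemma left_stable_emb: "a \<in> carrier A \<Longrightarrow> left_stable (emb a)"
  unfolding left_stable_def by (auto simp: shift_emb_mult_emb)

lemma left_stable_limit:
  assumes H: "H \<in> MF"
    and approx: "\<And>e. e > 0 \<Longrightarrow> \<exists>F\<in>MF. left_stable F \<and> fnorm (F \<ominus>\<^bsub>MA\<^esub> H) < e"
  shows "left_stable H"
  unfolding left_stable_def
proof (intro allI ballI)
  fix s a assume a: "a \<in> carrier A"
  have HM: "shift s H \<otimes>\<^bsub>MA\<^esub> emb a \<in> carrier MA" using H a by simp
  show "shift s H \<otimes>\<^bsub>MA\<^esub> emb a \<in> emb ` carrier A"
  proof (rule MA.closedin_norm_iff[THEN iffD1, OF emb_range_closed, THEN conjunct2, rule_format, OF HM])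
    fix e :: real assume e: "e > 0"
    have pos: "0 < 1 + cnorm A a" using norm_nonneg[OF a] by linarith
    obtain F where F: "F \<in> MF" "left_stable F" "fnorm (F \<ominus>\<^bsub>MA\<^esub> H) < e / (1 + cnorm A a)"
      using approx[of "e / (1 + cnorm A a)"] e pos by auto
    have "shift s F \<otimes>\<^bsub>MA\<^esub> emb a \<ominus>\<^bsub>MA\<^esub> shift s H \<otimes>\<^bsub>MA\<^esub> emb a = shift s (F \<ominus>\<^bsub>MA\<^esub> H) \<otimes>\<^bsub>MA\<^esub> emb a"
      using F H a by (simp add: shift_diff MA.mult_l_diff)
    then have "fnorm (shift s F \<otimes>\<^bsub>MA\<^esub> emb a \<ominus>\<^bsub>MA\<^esub> shift s H \<otimes>\<^bsub>MA\<^esub> emb a)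
        \<le> e / (1 + cnorm A a) * cnorm A a"
      using F H a MA.mult_bound[of "shift s (F \<ominus>\<^bsub>MA\<^esub> H)" "emb a" "e / (1 + cnorm A a)" "cnorm A a"] by simp
    also have "\<dots> < e" using pos e by (simp add: field_simps)
    finally show "\<exists>G\<in>emb ` carrier A. fnorm (G \<ominus>\<^bsub>MA\<^esub> shift s H \<otimes>\<^bsub>MA\<^esub> emb a) < e"
      using F(2) a unfolding left_stable_def by blast
  qed
qed

lemma orbit_continuous_le:
  assumes "(g \<longlongrightarrow> 0) (nhds 0)"
    and "F \<in> MF" and "\<And>t. fnorm (shift t F \<ominus>\<^bsub>MA\<^esub> F) \<le> g t"
  shows "orbit_continuous F"
  unfolding orbit_continuous_def
  using tendsto_const assms(1)
  by (rule tendsto_sandwich[rotated 2]) (use assms in \<open>auto simp: fnorm_nonneg\<close>)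

lemma orbit_continuous_add:
  assumes F: "F \<in> MF" "orbit_continuous F" and G: "G \<in> MF" "orbit_continuous G"
  shows "orbit_continuous (F \<oplus>\<^bsub>MA\<^esub> G)"
proof (rule orbit_continuous_le)
  show "((\<lambda>t. fnorm (shift t F \<ominus>\<^bsub>MA\<^esub> F) + fnorm (shift t G \<ominus>\<^bsub>MA\<^esub> G)) \<longlongrightarrow> 0) (nhds 0)"
    using tendsto_add[OF F(2)[unfolded orbit_continuous_def] G(2)[unfolded orbit_continuous_def]] by simp
  fix t
  have "shift t (F \<oplus>\<^bsub>MA\<^esub> G) \<ominus>\<^bsub>MA\<^esub> (F \<oplus>\<^bsub>MA\<^esub> G) = (shift t F \<ominus>\<^bsub>MA\<^esub> F) \<oplus>\<^bsub>MA\<^esub> (shift t G \<ominus>\<^bsub>MA\<^esub> G)"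
    using F G by (simp add: shift_hom MA.diff_eq_smult MA.smult_add MA.M.a_ac)
  then show "fnorm (shift t (F \<oplus>\<^bsub>MA\<^esub> G) \<ominus>\<^bsub>MA\<^esub> (F \<oplus>\<^bsub>MA\<^esub> G))
      \<le> fnorm (shift t F \<ominus>\<^bsub>MA\<^esub> F) + fnorm (shift t G \<ominus>\<^bsub>MA\<^esub> G)"
    using MA.norm_add[of "shift t F \<ominus>\<^bsub>MA\<^esub> F" "shift t G \<ominus>\<^bsub>MA\<^esub> G"] F G by simp
qed (use F G in simp)

lemma orbit_continuous_smult:
  assumes F: "F \<in> MF" "orbit_continuous F" shows "orbit_continuous (k \<odot>\<^bsub>MA\<^esub> F)"
proof (rule orbit_continuous_le)
  show "((\<lambda>t. cmod k * fnorm (shift t F \<ominus>\<^bsub>MA\<^esub> F)) \<longlongrightarrow> 0) (nhds 0)"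
    using tendsto_mult_left[OF F(2)[unfolded orbit_continuous_def], of "cmod k"] by simp
  fix t
  have "shift t (k \<odot>\<^bsub>MA\<^esub> F) \<ominus>\<^bsub>MA\<^esub> k \<odot>\<^bsub>MA\<^esub> F = k \<odot>\<^bsub>MA\<^esub> (shift t F \<ominus>\<^bsub>MA\<^esub> F)"
    using F by (simp add: shift_hom MA.diff_eq_smult MA.smult_add MA.smult_smult)
  then show "fnorm (shift t (k \<odot>\<^bsub>MA\<^esub> F) \<ominus>\<^bsub>MA\<^esub> k \<odot>\<^bsub>MA\<^esub> F) \<le> cmod k * fnorm (shift t F \<ominus>\<^bsub>MA\<^esub> F)"
    using F by (simp add: MA.norm_smult)
qed (use F in simp)

lemma orbit_continuous_mult:
  assumes F: "F \<in> MF" "orbit_continuous F" and G: "G \<in> MF" "orbit_continuous G"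
  shows "orbit_continuous (F \<otimes>\<^bsub>MA\<^esub> G)"
proof (rule orbit_continuous_le)
  show "((\<lambda>t. fnorm (shift t F \<ominus>\<^bsub>MA\<^esub> F) * fnorm G + fnorm F * fnorm (shift t G \<ominus>\<^bsub>MA\<^esub> G)) \<longlongrightarrow> 0) (nhds 0)"
    using tendsto_add[OF tendsto_mult_right[OF F(2)[unfolded orbit_continuous_def], of "fnorm G"]
        tendsto_mult_left[OF G(2)[unfolded orbit_continuous_def], of "fnorm F"]] by simp
  fix t
  let ?f = "shift t F" and ?g = "shift t G"
  have "?f \<otimes>\<^bsub>MA\<^esub> ?g \<ominus>\<^bsub>MA\<^esub> F \<otimes>\<^bsub>MA\<^esub> ?g = (?f \<ominus>\<^bsub>MA\<^esub> F) \<otimes>\<^bsub>MA\<^esub> ?g"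
    and "F \<otimes>\<^bsub>MA\<^esub> ?g \<ominus>\<^bsub>MA\<^esub> F \<otimes>\<^bsub>MA\<^esub> G = F \<otimes>\<^bsub>MA\<^esub> (?g \<ominus>\<^bsub>MA\<^esub> G)"
    using F G by (simp_all add: MA.mult_l_diff MA.mult_r_diff)
  then have "fnorm (shift t (F \<otimes>\<^bsub>MA\<^esub> G) \<ominus>\<^bsub>MA\<^esub> F \<otimes>\<^bsub>MA\<^esub> G)
      \<le> fnorm ((?f \<ominus>\<^bsub>MA\<^esub> F) \<otimes>\<^bsub>MA\<^esub> ?g) + fnorm (F \<otimes>\<^bsub>MA\<^esub> (?g \<ominus>\<^bsub>MA\<^esub> G))"
    using MA.norm_diff_triangle[of "?f \<otimes>\<^bsub>MA\<^esub> ?g" "F \<otimes>\<^bsub>MA\<^esub> ?g" "F \<otimes>\<^bsub>MA\<^esub> G"] F G by (simp add: shift_hom)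
  then show "fnorm (shift t (F \<otimes>\<^bsub>MA\<^esub> G) \<ominus>\<^bsub>MA\<^esub> F \<otimes>\<^bsub>MA\<^esub> G)
      \<le> fnorm (?f \<ominus>\<^bsub>MA\<^esub> F) * fnorm G + fnorm F * fnorm (?g \<ominus>\<^bsub>MA\<^esub> G)"
    using MA.norm_mult[of "?f \<ominus>\<^bsub>MA\<^esub> F" ?g] MA.norm_mult[of F "?g \<ominus>\<^bsub>MA\<^esub> G"] F G by simp
qed (use F G in simp)

lemma orbit_continuous_star:
  assumes F: "F \<in> MF" "orbit_continuous F" shows "orbit_continuous (star MA F)"
proof (rule orbit_continuous_le)
  fix t
  have "shift t (star MA F) \<ominus>\<^bsub>MA\<^esub> star MA F = star MA (shift t F \<ominus>\<^bsub>MA\<^esub> F)"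
    using F by (simp add: shift_hom MA.star_diff)
  then show "fnorm (shift t (star MA F) \<ominus>\<^bsub>MA\<^esub> star MA F) \<le> fnorm (shift t F \<ominus>\<^bsub>MA\<^esub> F)"
    using F MA.norm_star[of "shift t F \<ominus>\<^bsub>MA\<^esub> F"] by simp
qed (use F in \<open>simp_all add: orbit_continuous_def\<close>)

lemma orbit_continuous_shift:
  assumes F: "F \<in> MF" "orbit_continuous F" shows "orbit_continuous (shift s F)"
proof (rule orbit_continuous_le)
  have "((\<lambda>t. - s + t + s) \<longlongrightarrow> - s + 0 + s) (nhds 0)"
    by (intro tendsto_intros filterlim_ident)
  then have "filterlim (\<lambda>t. - s + t + s) (nhds 0) (nhds 0)" by simp
  then show "((\<lambda>t. fnorm (shift (- s + t + s) F \<ominus>\<^bsub>MA\<^esub> F)) \<longlongrightarrow> 0) (nhds 0)"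
    using F(2) unfolding orbit_continuous_def by (rule filterlim_compose[rotated])
  fix t
  have "shift t (shift s F) \<ominus>\<^bsub>MA\<^esub> shift s F = shift s (shift (- s + t + s) F \<ominus>\<^bsub>MA\<^esub> F)"
    using F by (simp add: shift_diff add.assoc[symmetric])
  then show "fnorm (shift t (shift s F) \<ominus>\<^bsub>MA\<^esub> shift s F) \<le> fnorm (shift (- s + t + s) F \<ominus>\<^bsub>MA\<^esub> F)"
    using F by simp
qed (use F in simp)

lemma orbit_continuous_limit:
  assumes H: "H \<in> MF"
    and approx: "\<And>e. e > 0 \<Longrightarrow> \<exists>F\<in>MF. orbit_continuous F \<and> fnorm (F \<ominus>\<^bsub>MA\<^esub> H) < e"
  shows "orbit_continuous H"
  unfolding orbit_continuous_def
proof (rule tendstoI)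
  fix e :: real assume e: "e > 0"
  obtain F where F: "F \<in> MF" "orbit_continuous F" "fnorm (F \<ominus>\<^bsub>MA\<^esub> H) < e / 3"
    using approx[of "e / 3"] e by auto
  have "\<forall>\<^sub>F t in nhds 0. fnorm (shift t F \<ominus>\<^bsub>MA\<^esub> F) < e / 3"
    using F(2) e unfolding orbit_continuous_def by (intro order_tendstoD) auto
  then show "\<forall>\<^sub>F t in nhds 0. dist (fnorm (shift t H \<ominus>\<^bsub>MA\<^esub> H)) 0 < e"
  proof eventually_elim
    case (elim t)
    have "shift t F \<ominus>\<^bsub>MA\<^esub> shift t H = shift t (F \<ominus>\<^bsub>MA\<^esub> H)" using F H by (simp add: shift_diff)
    then have "fnorm (shift t H \<ominus>\<^bsub>MA\<^esub> shift t F) = fnorm (F \<ominus>\<^bsub>MA\<^esub> H)"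
      using MA.norm_diff_commute[of "shift t H" "shift t F"] F H by simp
    then have "fnorm (shift t H \<ominus>\<^bsub>MA\<^esub> H) < e"
      using MA.norm_diff_triangle[of "shift t H" "shift t F" H] MA.norm_diff_triangle[of "shift t F" F H]
        F H elim by simp
    then show ?case using fnorm_nonneg[of "shift t H \<ominus>\<^bsub>MA\<^esub> H"] H by simp
  qed
qed

text \<open>This is where the continuity of the family of ideals enters.  As \<open>D 0\<close> is the whole algebra, for
  small \<open>t\<close> the ideal \<open>D (- t)\<close> contains some \<open>x\<close> close to \<open>a\<close>, and then
  \<open>\<beta>\<^sub>t(a) \<approx> \<beta>\<^sub>t(x) = \<alpha>\<^sub>t(x) \<approx> a\<close>.  The first approximation is in norm because translations
  and \<open>emb\<close> are isometric, so no uniformity over the group has to be checked.\<close>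

lemma orbit_continuous_emb:
  assumes a: "a \<in> carrier A" shows "orbit_continuous (emb a)"
  unfolding orbit_continuous_def
proof (rule tendstoI)
  fix e :: real assume e: "e > 0"
  let ?X = "subtopology (prod_topology euclidean (norm_topology A)) {(t, a). a \<in> D (- t)}"
  let ?B = "{y \<in> carrier A. cnorm A (y \<ominus>\<^bsub>A\<^esub> a) < e / 2}"
  have cont: "continuous_map ?X (norm_topology A) (\<lambda>(t, a). \<alpha> t a)"
    and lsc: "\<And>U. openin (norm_topology A) U \<Longrightarrow> open {t. D t \<inter> U \<noteq> {}}"
    using action by (simp_all add: cstar_partial_action_def)
  have aB: "a \<in> ?B" using a e by (simp add: a_minus_def M.r_neg)
  have "openin ?X {p \<in> topspace ?X. (case p of (t, a) \<Rightarrow> \<alpha> t a) \<in> ?B}"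
    by (rule openin_continuous_map_preimage[OF cont openin_norm_ball[OF a]])
  then obtain W where W: "openin (prod_topology euclidean (norm_topology A)) W"
    and W_eq: "{p \<in> topspace ?X. (case p of (t, a) \<Rightarrow> \<alpha> t a) \<in> ?B} = W \<inter> {(t, a). a \<in> D (- t)}"
    unfolding openin_subtopology by blast
  have "(0, a) \<in> {p \<in> topspace ?X. (case p of (t, a) \<Rightarrow> \<alpha> t a) \<in> ?B}"
    using a aB by simp
  then have "(0, a) \<in> W" unfolding W_eq by simp
  then obtain U V where UV: "open U" "openin (norm_topology A) V" "0 \<in> U" "a \<in> V" "U \<times> V \<subseteq> W"
    using W[unfolded openin_prod_topology_alt, rule_format, of 0 a] by auto
  have op: "openin (norm_topology A) (V \<inter> ?B)"
    using UV(2) openin_norm_ball[OF a] by (rule openin_Int)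
  have "a \<in> D 0 \<inter> (V \<inter> ?B)" using a aB UV(4) by simp
  then have "0 \<in> {t. D t \<inter> (V \<inter> ?B) \<noteq> {}}" by blast
  then have "\<forall>\<^sub>F t in nhds 0. t \<in> {t. D t \<inter> (V \<inter> ?B) \<noteq> {}}"
    using lsc[OF op] by (rule eventually_nhds_in_open[rotated])
  moreover have "((\<lambda>t. - t) \<longlongrightarrow> - 0) (nhds (0::'g))"
    by (intro tendsto_intros filterlim_ident)
  then have "filterlim uminus (nhds 0) (nhds (0::'g))" by simp
  ultimately have "\<forall>\<^sub>F t in nhds 0. - t \<in> {t. D t \<inter> (V \<inter> ?B) \<noteq> {}}"
    by (rule eventually_compose_filterlim)
  moreover have "\<forall>\<^sub>F t in nhds 0. t \<in> U" using UV(1,3) by (rule eventually_nhds_in_open)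
  ultimately show "\<forall>\<^sub>F t in nhds 0. dist (fnorm (shift t (emb a) \<ominus>\<^bsub>MA\<^esub> emb a)) 0 < e"
  proof eventually_elim
    case (elim t)
    then obtain x where x: "x \<in> D (- t)" "x \<in> V" "cnorm A (x \<ominus>\<^bsub>A\<^esub> a) < e / 2" by auto
    have "(t, x) \<in> W \<inter> {(t, a). a \<in> D (- t)}" using x UV(5) elim by auto
    then have \<alpha>x: "cnorm A (\<alpha> t x \<ominus>\<^bsub>A\<^esub> a) < e / 2" unfolding W_eq[symmetric] by simp
    have c: "x \<in> carrier A" "\<alpha> t x \<in> carrier A" using x by auto
    have "fnorm (shift t (emb a) \<ominus>\<^bsub>MA\<^esub> emb (\<alpha> t x)) = cnorm A (x \<ominus>\<^bsub>A\<^esub> a)"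
    proof -
      have "shift t (emb a) \<ominus>\<^bsub>MA\<^esub> emb (\<alpha> t x) = shift t (emb (a \<ominus>\<^bsub>A\<^esub> x))"
        using a x c by (simp add: emb_diff shift_diff shift_emb_domain)
      then show ?thesis using a c norm_diff_commute[of a x] by simp
    qed
    moreover have "fnorm (emb (\<alpha> t x) \<ominus>\<^bsub>MA\<^esub> emb a) = cnorm A (\<alpha> t x \<ominus>\<^bsub>A\<^esub> a)"
      using a c fnorm_emb[of "\<alpha> t x \<ominus>\<^bsub>A\<^esub> a"] by (simp add: emb_diff)
    ultimately have "fnorm (shift t (emb a) \<ominus>\<^bsub>MA\<^esub> emb a) < e"
      using MA.norm_diff_triangle[of "shift t (emb a)" "emb (\<alpha> t x)" "emb a"] a c x \<alpha>x by simp
    then show ?case using fnorm_nonneg[of "shift t (emb a) \<ominus>\<^bsub>MA\<^esub> emb a"] a by simp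
  qed
qed

lemma emb_glob [simp]: "a \<in> carrier A \<Longrightarrow> emb a \<in> glob"
  using left_stable_emb[of "star A a"]
  by (simp add: glob_def left_stable_emb orbit_continuous_emb emb_hom(4))

lemma glob_add: "\<lbrakk>F \<in> glob; G \<in> glob\<rbrakk> \<Longrightarrow> F \<oplus>\<^bsub>MA\<^esub> G \<in> glob"
  by (simp add: glob_def left_stable_add orbit_continuous_add MA.star_add)

lemma glob_smult: "F \<in> glob \<Longrightarrow> k \<odot>\<^bsub>MA\<^esub> F \<in> glob"
  by (simp add: glob_def left_stable_smult orbit_continuous_smult MA.star_smult)

lemma glob_mult: "\<lbrakk>F \<in> glob; G \<in> glob\<rbrakk> \<Longrightarrow> F \<otimes>\<^bsub>MA\<^esub> G \<in> glob"
  by (simp add: glob_def left_stable_mult orbit_continuous_mult MA.star_mult)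

lemma glob_star: "F \<in> glob \<Longrightarrow> star MA F \<in> glob"
  using MA.star_star[of F] by (simp add: glob_def orbit_continuous_star)

lemma glob_shift [simp]: "F \<in> glob \<Longrightarrow> shift s F \<in> glob"
  using left_stable_shift[of "star MA F" s]
  by (simp add: glob_def left_stable_shift orbit_continuous_shift shift_hom(4))

lemma glob_MF [simp]: "F \<in> glob \<Longrightarrow> F \<in> MF"
  by (simp add: glob_def)

lemma glob_submodule: "submodule glob complex_ring MA"
proof (rule MA.submoduleI)
  show "\<zero>\<^bsub>MA\<^esub> \<in> glob" using glob_smult[of "emb \<zero>\<^bsub>A\<^esub>" 0] MA.smult_0[of "emb \<zero>\<^bsub>A\<^esub>"] by simp
  show "\<ominus>\<^bsub>MA\<^esub> F \<in> glob" if "F \<in> glob" for F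
    using MA.minus_eq_smult[of F] glob_smult[of F "-1"] that by simp
qed (auto simp: glob_add glob_smult)

lemma glob_closed: "closedin (norm_topology MA) glob"
  unfolding MA.closedin_norm_iff
proof (intro conjI ballI impI)
  fix H assume "H \<in> carrier MA" and approx: "\<forall>e>0. \<exists>F\<in>glob. fnorm (F \<ominus>\<^bsub>MA\<^esub> H) < e"
  then have H: "H \<in> MF" by simp
  have "left_stable H"
    by (rule left_stable_limit[OF H]) (use approx in \<open>auto simp: glob_def simp del: glob_MF\<close>)
  moreover have "orbit_continuous H"
    by (rule orbit_continuous_limit[OF H]) (use approx in \<open>auto simp: glob_def simp del: glob_MF\<close>)
  moreover have "left_stable (star MA H)"
  proof (rule left_stable_limit)
    fix e :: real assume "e > 0"
    then obtain F where F: "F \<in> glob" "fnorm (F \<ominus>\<^bsub>MA\<^esub> H) < e" using approx by blast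
    have "fnorm (star MA F \<ominus>\<^bsub>MA\<^esub> star MA H) = fnorm (F \<ominus>\<^bsub>MA\<^esub> H)"
      using MA.norm_star[of "F \<ominus>\<^bsub>MA\<^esub> H"] F H by (simp add: MA.star_diff)
    then show "\<exists>G\<in>MF. left_stable G \<and> fnorm (G \<ominus>\<^bsub>MA\<^esub> star MA H) < e"
      using F by (intro bexI[of _ "star MA F"]) (auto simp: glob_def simp del: glob_MF)
  qed (use H in simp)
  ultimately show "H \<in> glob" using H unfolding glob_def by simp
qed auto

abbreviation GA :: "('g \<Rightarrow> 'a \<Rightarrow> 'a) cstar_algebra" where "GA \<equiv> MA\<lparr>carrier := glob\<rparr>"

lemma GA_cstar: "cstar_algebra GA"
  by (rule MA.closed_subalgebra[OF glob_submodule glob_closed glob_mult glob_star])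

interpretation GA: cstar_algebra GA
  by (rule GA_cstar)

lemma GA_diff [simp]: "\<lbrakk>F \<in> glob; G \<in> glob\<rbrakk> \<Longrightarrow> F \<ominus>\<^bsub>GA\<^esub> G = F \<ominus>\<^bsub>MA\<^esub> G"
  using GA.diff_eq_smult[of F G] by (simp add: MA.diff_eq_smult)

lemma orbit_continuous_at:
  assumes F: "F \<in> glob" and e: "e > 0"
  shows "\<forall>\<^sub>F t in nhds t0. fnorm (shift t F \<ominus>\<^bsub>MA\<^esub> shift t0 F) < e"
proof -
  have "((\<lambda>t. - t0 + t) \<longlongrightarrow> - t0 + t0) (nhds t0)" by (intro tendsto_intros filterlim_ident)
  then have "filterlim (\<lambda>t. - t0 + t) (nhds 0) (nhds t0)" by simp
  then have "((\<lambda>t. fnorm (shift (- t0 + t) F \<ominus>\<^bsub>MA\<^esub> F)) \<longlongrightarrow> 0) (nhds t0)"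
    using F unfolding glob_def orbit_continuous_def by (auto intro: filterlim_compose)
  then have "\<forall>\<^sub>F t in nhds t0. fnorm (shift (- t0 + t) F \<ominus>\<^bsub>MA\<^esub> F) < e"
    using e by (rule order_tendstoD)
  moreover have "fnorm (shift t F \<ominus>\<^bsub>MA\<^esub> shift t0 F) = fnorm (shift (- t0 + t) F \<ominus>\<^bsub>MA\<^esub> F)" for t
  proof -
    have "shift t F \<ominus>\<^bsub>MA\<^esub> shift t0 F = shift t0 (shift (- t0 + t) F \<ominus>\<^bsub>MA\<^esub> F)"
      using F by (simp add: shift_diff add.assoc[symmetric])
    then show ?thesis using F by simp
  qed
  ultimately show ?thesis by simp
qed

lemma shift_continuous:
  "continuous_map (prod_topology euclidean (norm_topology GA)) (norm_topology GA) (\<lambda>(t, F). shift t F)"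
  unfolding continuous_map
proof (intro conjI allI impI)
  let ?X = "prod_topology (euclidean :: 'g topology) (norm_topology GA)"
  show "(\<lambda>(t, F). shift t F) ` topspace ?X \<subseteq> topspace (norm_topology GA)" by auto
  fix U assume U: "openin (norm_topology GA) U"
  show "openin ?X {p \<in> topspace ?X. (case p of (t, F) \<Rightarrow> shift t F) \<in> U}"
    unfolding openin_prod_topology_alt
  proof (intro allI impI)
    fix t0 F0 assume "(t0, F0) \<in> {p \<in> topspace ?X. (case p of (t, F) \<Rightarrow> shift t F) \<in> U}"
    then have F0: "F0 \<in> glob" and in_U: "shift t0 F0 \<in> U" by auto
    obtain e where e: "e > 0"
      and eU: "\<And>G. G \<in> glob \<Longrightarrow> fnorm (G \<ominus>\<^bsub>MA\<^esub> shift t0 F0) < e \<Longrightarrow> G \<in> U"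
      using U[unfolded GA.openin_norm_iff, THEN conjunct2, rule_format, OF in_U] F0 by auto
    have "\<forall>\<^sub>F t in nhds t0. fnorm (shift t F0 \<ominus>\<^bsub>MA\<^esub> shift t0 F0) < e / 2"
      using e by (intro orbit_continuous_at[OF F0]) simp
    then obtain V where V: "open V" "t0 \<in> V"
      and V_less: "\<And>t. t \<in> V \<Longrightarrow> fnorm (shift t F0 \<ominus>\<^bsub>MA\<^esub> shift t0 F0) < e / 2"
      unfolding eventually_nhds by blast
    let ?W = "{F \<in> carrier GA. cnorm GA (F \<ominus>\<^bsub>GA\<^esub> F0) < e / 2}"
    have "shift t F \<in> U" if t: "t \<in> V" and F: "F \<in> ?W" for t F
    proof (rule eU)
      have Fg: "F \<in> glob" "fnorm (F \<ominus>\<^bsub>MA\<^esub> F0) < e / 2" using F F0 by auto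
      have "shift t F \<ominus>\<^bsub>MA\<^esub> shift t F0 = shift t (F \<ominus>\<^bsub>MA\<^esub> F0)" using Fg F0 by (simp add: shift_diff)
      then have "fnorm (shift t F \<ominus>\<^bsub>MA\<^esub> shift t F0) < e / 2" using Fg F0 by simp
      then show "fnorm (shift t F \<ominus>\<^bsub>MA\<^esub> shift t0 F0) < e"
        using MA.norm_diff_triangle[of "shift t F" "shift t F0" "shift t0 F0"] V_less[OF t] Fg F0 by simp
    qed (use F in simp)
    moreover have "F0 \<in> ?W" using F0 e MA.diff_zero_iff[of F0 F0] by simp
    ultimately show "\<exists>V W. openin euclidean V \<and> openin (norm_topology GA) W \<and> t0 \<in> V \<and> F0 \<in> W \<and>
        V \<times> W \<subseteq> {p \<in> topspace ?X. (case p of (t, F) \<Rightarrow> shift t F) \<in> U}"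
      using V GA.openin_norm_ball[of F0 "e / 2"] F0
      by (intro exI[of _ V] exI[of _ ?W]) auto
  qed
qed

lemma shift_global_action: "cstar_global_action GA shift"
proof -
  have set: "set_partial_action (carrier GA) (\<lambda>_. carrier GA) shift"
    unfolding set_partial_action_def by auto
  have star: "star_partial_action GA (\<lambda>_. carrier GA) shift"
    unfolding star_partial_action_def star_hom_def
    using set GA.star_ideal_carrier by (auto simp: shift_hom)
  have "{t. carrier GA \<inter> U \<noteq> {}} = (if U = {} then {} else UNIV)"
    if "openin (norm_topology GA) U" for U
    using openin_subset[OF that] by auto
  then have "open {t :: 'g. carrier GA \<inter> U \<noteq> {}}" if "openin (norm_topology GA) U" for U
    using that by simp
  moreover have "subtopology (prod_topology euclidean (norm_topology GA)) {(t :: 'g, F). F \<in> carrier GA}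
      = prod_topology euclidean (norm_topology GA)"
    by (rule subtopology_superset) auto
  ultimately show ?thesis
    unfolding cstar_global_action_def cstar_partial_action_def
    using star shift_continuous closedin_topspace[of "norm_topology GA"] by simp
qed

lemma emb_range_ideal: "cstar_ideal (emb ` carrier A) GA"
  unfolding cstar_ideal_def
proof (intro conjI ballI)
  show "submodule (emb ` carrier A) complex_ring GA"
  proof (rule GA.submoduleI)
    show "emb ` carrier A \<subseteq> carrier GA" by auto
    show "\<zero>\<^bsub>GA\<^esub> \<in> emb ` carrier A"
    proof (rule image_eqI)
      show "\<zero>\<^bsub>GA\<^esub> = emb \<zero>\<^bsub>A\<^esub>"
        using emb_hom(2)[of "\<zero>\<^bsub>A\<^esub>" 0] MA.smult_0[of "emb \<zero>\<^bsub>A\<^esub>"] by simp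
    qed simp
    show "\<ominus>\<^bsub>GA\<^esub> F \<in> emb ` carrier A" if "F \<in> emb ` carrier A" for F
      using that GA.minus_eq_smult[of F] by (auto simp flip: emb_hom)
    show "F \<oplus>\<^bsub>GA\<^esub> G \<in> emb ` carrier A" if "F \<in> emb ` carrier A" "G \<in> emb ` carrier A" for F G
      using that emb_range_add by simp
    show "k \<odot>\<^bsub>GA\<^esub> F \<in> emb ` carrier A" if "F \<in> emb ` carrier A" for k F
      using that by (auto simp flip: emb_hom)
  qed
  show "closedin (norm_topology GA) (emb ` carrier A)"
    unfolding GA.closedin_norm_iff
  proof (intro conjI ballI impI)
    fix H assume H: "H \<in> carrier GA"
      and approx: "\<forall>e>0. \<exists>G\<in>emb ` carrier A. cnorm GA (G \<ominus>\<^bsub>GA\<^esub> H) < e"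
    then have "\<forall>e>0. \<exists>G\<in>emb ` carrier A. fnorm (G \<ominus>\<^bsub>MA\<^esub> H) < e" by auto
    then show "H \<in> emb ` carrier A"
      using emb_range_closed H unfolding MA.closedin_norm_iff by auto
  qed auto
  have left: "F \<otimes>\<^bsub>MA\<^esub> emb a \<in> emb ` carrier A" if "F \<in> glob" "a \<in> carrier A" for F a
    using that shift_0[of F] unfolding glob_def left_stable_def by (metis (no_types, lifting) mem_Collect_eq)
  fix F G assume F: "F \<in> emb ` carrier A" and G: "G \<in> carrier GA"
  then obtain a where a: "a \<in> carrier A" "F = emb a" by auto
  show "G \<otimes>\<^bsub>GA\<^esub> F \<in> emb ` carrier A" using left a G by simp
  obtain b where b: "b \<in> carrier A" "star MA G \<otimes>\<^bsub>MA\<^esub> emb (star A a) = emb b"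
    using left[of "star MA G" "star A a"] G a glob_star by auto
  have "F \<otimes>\<^bsub>MA\<^esub> G = star MA (star MA G \<otimes>\<^bsub>MA\<^esub> emb (star A a))"
    using a G MA.star_star[of G] MA.star_star[of "emb a"] by (simp add: emb_hom MA.star_mult)
  then show "F \<otimes>\<^bsub>GA\<^esub> G \<in> emb ` carrier A" using b by (simp flip: emb_hom)
qed

text \<open>An \<open>x\<close> with \<open>x = \<beta>\<^sub>t(y)\<close> multiplies \<open>A\<close> into \<open>A\<^sub>t\<close>; in particular \<open>x x\<^sup>* \<in> A\<^sub>t\<close>, hence \<open>x \<in> A\<^sub>t\<close>.\<close>

lemma restr_dom_shift: "restr_dom shift (emb ` carrier A) t = emb ` D t"
proof (intro equalityI subsetI)
  fix F assume "F \<in> restr_dom shift (emb ` carrier A) t"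
  then obtain x y where x: "x \<in> carrier A" "F = emb x" and y: "y \<in> carrier A" "emb x = shift t (emb y)"
    unfolding restr_dom_def by auto
  have "emb x 0 (star A x) = shift t (emb y) 0 (star A x)" by (simp only: y(2))
  then have "x \<otimes>\<^bsub>A\<^esub> star A x = tprod t y (star A x)"
    using x(1) by (simp add: tprod_0)
  then have "x \<otimes>\<^bsub>A\<^esub> star A x \<in> D t" using x y by simp
  then have "x \<in> D t" by (rule closed_star_ideal_self_mult_star[OF D_ideal D_closed x(1)])
  then show "F \<in> emb ` D t" using x by simp
next
  fix F assume "F \<in> emb ` D t"
  then obtain x where x: "x \<in> D t" "F = emb x" by auto
  have "emb x = shift t (emb (\<alpha> (- t) x))" using x shift_emb_domain[of "\<alpha> (- t) x" t] by simp
  then have "emb x \<in> shift t ` emb ` carrier A" 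
    by (rule image_eqI[of _ "shift t" "emb (\<alpha> (- t) x)"]) (use x in simp)
  then show "F \<in> restr_dom shift (emb ` carrier A) t"
    unfolding restr_dom_def using x by simp
qed

lemma emb_iso:
  "star_partial_action_iso A D \<alpha> (GA\<lparr>carrier := emb ` carrier A\<rparr>)
    (restr_dom shift (emb ` carrier A)) (restr_map shift (emb ` carrier A)) emb"
  unfolding star_partial_action_iso_def
proof (intro conjI allI ballI)
  show "star_hom A (GA\<lparr>carrier := emb ` carrier A\<rparr>) emb"
    unfolding star_hom_def by (auto simp: emb_hom)
  show "bij_betw emb (carrier A) (carrier (GA\<lparr>carrier := emb ` carrier A\<rparr>))"
    using emb_inj by (simp add: bij_betw_def)
  show "emb ` D t = restr_dom shift (emb ` carrier A) t" for t by (simp add: restr_dom_shift)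
  show "emb (\<alpha> t x) = restr_map shift (emb ` carrier A) t (emb x)" if "x \<in> D (- t)" for t x
    using that restr_dom_shift[of "- t"] unfolding restr_dom_def restr_map_def
    by (simp add: shift_emb_domain)
qed

theorem cstar_globalization_glob:
  "cstar_globalization A D \<alpha> GA shift (emb ` carrier A) emb"
  unfolding cstar_globalization_def
  using GA_cstar shift_global_action emb_range_ideal emb_iso by simp

end

section \<open>Necessity of the condition\<close>

text \<open>\<open>u\<close> is the element of \<open>A\<close> that corresponds to the product \<open>\<beta>\<^sub>t(a) b\<close>.\<close>

lemma star_globalization_products:
  assumes A: "star_algebra A" and pa: "star_partial_action A D \<alpha>"
    and glob: "star_globalization A D \<alpha> B \<beta> I \<iota>"
    and a: "a \<in> carrier A" and b: "b \<in> carrier A"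
  shows "\<exists>u\<in>D t. \<forall>c\<in>D (- t). \<alpha> t c \<otimes>\<^bsub>A\<^esub> u = \<alpha> t (c \<otimes>\<^bsub>A\<^esub> a) \<otimes>\<^bsub>A\<^esub> b"
proof -
  interpret A: star_algebra A by (rule A)
  interpret B: star_algebra B using glob by (simp add: star_globalization_def)
  have act: "star_partial_action B (\<lambda>_. carrier B) \<beta>" and I: "star_ideal I B"
    and iso: "star_partial_action_iso A D \<alpha> (B\<lparr>carrier := I\<rparr>) (restr_dom \<beta> I) (restr_map \<beta> I) \<iota>"
    using glob by (auto simp: star_globalization_def star_global_action_def)
  have D: "star_ideal (D s) A" for s using pa by (simp add: star_partial_action_def)
  note DD = A.star_idealD[OF D] and ID = B.star_idealD[OF I]
  have \<beta>: "\<beta> s x \<in> carrier B" "\<beta> 0 x = x" "\<beta> s (\<beta> r x) = \<beta> (s + r) x"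
      "y \<in> carrier B \<Longrightarrow> \<beta> s (x \<otimes>\<^bsub>B\<^esub> y) = \<beta> s x \<otimes>\<^bsub>B\<^esub> \<beta> s y"
    if "x \<in> carrier B" for s r x y
    using act that
    by (auto simp: star_partial_action_def set_partial_action_def star_hom_def Pi_iff)
  have \<iota>: "\<iota> x \<in> I" "y \<in> carrier A \<Longrightarrow> \<iota> (x \<otimes>\<^bsub>A\<^esub> y) = \<iota> x \<otimes>\<^bsub>B\<^esub> \<iota> y" if "x \<in> carrier A" for x y
    using iso that by (auto simp: star_partial_action_iso_def star_hom_def)
  have inj: "inj_on \<iota> (carrier A)"
    using iso by (auto simp: star_partial_action_iso_def bij_betw_def)
  have dom: "\<iota> ` D s = I \<inter> \<beta> s ` I" for s
    using iso by (simp add: star_partial_action_iso_def restr_dom_def)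
  have equiv: "\<iota> (\<alpha> s x) = \<beta> s (\<iota> x)" if "x \<in> D (- s)" for s x
  proof -
    have "\<iota> x \<in> I \<inter> \<beta> (- s) ` I" using that dom[of "- s"] by blast
    then show ?thesis using iso that by (simp add: star_partial_action_iso_def restr_map_def)
  qed
  have \<alpha>: "\<alpha> s x \<in> D s" if "x \<in> D (- s)" for s x
    using pa that by (auto simp: star_partial_action_def set_partial_action_def)
  have IB: "x \<in> carrier B" if "x \<in> I" for x using ID(1) that .
  define p where "p = \<beta> t (\<iota> a) \<otimes>\<^bsub>B\<^esub> \<iota> b"
  have aI: "\<iota> a \<in> I" and bI: "\<iota> b \<in> I" using \<iota> a b by auto
  have "p \<in> I" unfolding p_def using ID(8)[OF bI] \<beta>(1) aI IB by simp
  moreover have "p \<in> \<beta> t ` I"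
  proof
    show "p = \<beta> t (\<iota> a \<otimes>\<^bsub>B\<^esub> \<beta> (- t) (\<iota> b))"
      using aI bI IB \<beta> by (simp add: p_def)
    show "\<iota> a \<otimes>\<^bsub>B\<^esub> \<beta> (- t) (\<iota> b) \<in> I" using ID(7)[OF aI] \<beta>(1) bI IB by simp
  qed
  ultimately obtain u where u: "u \<in> D t" "\<iota> u = p" using dom[of t] by (metis IntI imageE)
  have "\<alpha> t c \<otimes>\<^bsub>A\<^esub> u = \<alpha> t (c \<otimes>\<^bsub>A\<^esub> a) \<otimes>\<^bsub>A\<^esub> b" if c: "c \<in> D (- t)" for c
  proof -
    have ca: "c \<otimes>\<^bsub>A\<^esub> a \<in> D (- t)" using DD(7)[OF c a] .
    have mem: "c \<in> carrier A" "\<alpha> t c \<in> carrier A" "\<alpha> t (c \<otimes>\<^bsub>A\<^esub> a) \<in> carrier A" "u \<in> carrier A"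
      using DD(1) \<alpha> c ca u by blast+
    have "\<iota> (\<alpha> t c \<otimes>\<^bsub>A\<^esub> u) = \<beta> t (\<iota> c) \<otimes>\<^bsub>B\<^esub> (\<beta> t (\<iota> a) \<otimes>\<^bsub>B\<^esub> \<iota> b)"
      using \<iota>(2)[OF mem(2,4)] equiv[OF c] u by (simp add: p_def)
    also have "\<dots> = \<beta> t (\<iota> c \<otimes>\<^bsub>B\<^esub> \<iota> a) \<otimes>\<^bsub>B\<^esub> \<iota> b"
      using \<iota>(1)[OF mem(1)] aI bI IB \<beta> by (simp add: B.mult_assoc)
    also have "\<dots> = \<iota> (\<alpha> t (c \<otimes>\<^bsub>A\<^esub> a) \<otimes>\<^bsub>A\<^esub> b)"
      using \<iota>(2)[OF mem(1) a] \<iota>(2)[OF mem(3) b] equiv[OF ca] by simp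
    finally show ?thesis
      using inj mem b by (auto dest: inj_onD)
  qed
  then show ?thesis using u by blast
qed

lemma truncate_simps [simp]:
  "carrier (star_algebra.truncate B) = carrier B" "add (star_algebra.truncate B) = add B"
  "zero (star_algebra.truncate B) = zero B" "monoid.mult (star_algebra.truncate B) = monoid.mult B"
  "smult (star_algebra.truncate B) = smult B" "star (star_algebra.truncate B) = star B"
  by (simp_all add: star_algebra.truncate_def)

lemma star_algebra_truncate:
  assumes "star_algebra B" shows "star_algebra (star_algebra.truncate B)"
proof -
  let ?T = "star_algebra.truncate B"
  interpret B: star_algebra B by (rule assms)
  have "abelian_group ?T"
    by (rule abelian_groupI) (auto simp: B.M.a_ac intro!: bexI[of _ "\<ominus>\<^bsub>B\<^esub> _"] B.M.l_neg)
  then have "Module.module complex_ring ?T"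
    by (rule moduleI[OF cring_complex_ring]) (auto simp: B.add_smult B.smult_add B.smult_smult)
  then show ?thesis
    by (rule star_algebra.intro, unfold_locales)
      (auto simp: B.mult_assoc B.mult_l_distr B.mult_r_distr B.smult_mult_l B.smult_mult_r
        B.star_add B.star_smult B.star_mult)
qed

lemma cstar_globalization_imp_star_globalization:
  assumes A: "star_algebra A" and glob: "cstar_globalization A D \<alpha> B \<beta> I \<iota>"
  shows "star_globalization A D \<alpha> (star_algebra.truncate B) \<beta> I \<iota>"
proof -
  let ?T = "star_algebra.truncate B"
  interpret A: star_algebra A by (rule A)
  interpret B: cstar_algebra B using glob by (simp add: cstar_globalization_def)
  interpret T: star_algebra ?T by (rule star_algebra_truncate) (rule B.star_algebra_axioms)
  have act: "star_partial_action B (\<lambda>_. carrier B) \<beta>" and I: "cstar_ideal I B"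
    and iso: "star_partial_action_iso A D \<alpha> (B\<lparr>carrier := I\<rparr>) (restr_dom \<beta> I) (restr_map \<beta> I) \<iota>"
    using glob by (auto simp: cstar_globalization_def cstar_global_action_def cstar_partial_action_def)
  have subB: "submodule I complex_ring B" using I by (simp add: cstar_ideal_def)
  note IB = B.submoduleE(1)[OF subB]
  have subT: "submodule I complex_ring ?T"
  proof (rule T.submoduleI)
    show k: "k \<odot>\<^bsub>?T\<^esub> x \<in> I" if "x \<in> I" for k x
      using B.submoduleE(4)[OF subB, of k x] that by simp
    show "\<ominus>\<^bsub>?T\<^esub> x \<in> I" if "x \<in> I" for x
      using k[OF that] T.minus_eq_smult[of x] IB that by auto
    show "\<zero>\<^bsub>?T\<^esub> \<in> I"
      using B.submoduleE(2)[OF subB] k[of _ 0] IB B.smult_0 by (metis all_not_in_conv subsetD truncate_simps(3,5))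
  qed (use IB B.submoduleE(5)[OF subB] in auto)
  \<comment> \<open>A closed ideal of a C*-algebra is self-adjoint; here this comes for free, because \<open>I\<close> is the
    range of the *-homomorphism \<open>\<iota>\<close>.\<close>
  have star_in: "star B x \<in> I" if "x \<in> I" for x
  proof -
    have bij: "bij_betw \<iota> (carrier A) I" and hom: "star_hom A (B\<lparr>carrier := I\<rparr>) \<iota>"
      using iso by (auto simp: star_partial_action_iso_def)
    from bij that obtain y where y: "y \<in> carrier A" "x = \<iota> y" by (auto simp: bij_betw_def)
    then have "star B x = \<iota> (star A y)" using hom by (simp add: star_hom_def)
    then show ?thesis using bij y by (auto simp: bij_betw_def)
  qed
  have "star_ideal I ?T"
    unfolding star_ideal_def
  proof (intro conjI ballI)
    show "star ?T ` I = I"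
    proof
      show "I \<subseteq> star ?T ` I" using star_in IB B.star_star by (auto intro!: image_eqI[of _ _ "star B _"])
    qed (use star_in in auto)
  qed (use I subT in \<open>auto simp: cstar_ideal_def\<close>)
  moreover have "star_global_action ?T \<beta>"
    using act T.star_ideal_carrier
    unfolding star_global_action_def star_partial_action_def star_hom_def by simp
  moreover have "star_partial_action_iso A D \<alpha> (?T\<lparr>carrier := I\<rparr>) (restr_dom \<beta> I) (restr_map \<beta> I) \<iota>"
    using iso unfolding star_partial_action_iso_def star_hom_def by simp
  ultimately show ?thesis using T.star_algebra_axioms by (simp add: star_globalization_def)
qed

section \<open>The characterization of globalizable C*-partial actions\<close>

theorem theorem3p5:
  fixes A :: "'a cstar_algebra"
    and D :: "'g::topological_group_add \<Rightarrow> 'a set"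
    and \<alpha> :: "'g \<Rightarrow> 'a \<Rightarrow> 'a"
  assumes "cstar_algebra A"
    and "cstar_partial_action A D \<alpha>"
  shows "(has_cstar_globalization TYPE(('g, 'a) univ) A D \<alpha> \<longleftrightarrow>
          has_star_globalization TYPE(('g, 'a) univ) A D \<alpha>) \<and>
         (has_star_globalization TYPE(('g, 'a) univ) A D \<alpha> \<longleftrightarrow>
          (\<forall>t. \<forall>a\<in>carrier A. \<forall>b\<in>carrier A. \<exists>u\<in>D t. \<forall>c\<in>D (- t).
             \<alpha> t c \<otimes>\<^bsub>A\<^esub> u = \<alpha> t (c \<otimes>\<^bsub>A\<^esub> a) \<otimes>\<^bsub>A\<^esub> b)) \<and>
         (has_cstar_globalization TYPE('b) A D \<alpha> \<longrightarrow>
          has_cstar_globalization TYPE(('g, 'a) univ) A D \<alpha>) \<and>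
         (has_star_globalization TYPE('b) A D \<alpha> \<longrightarrow>
          has_star_globalization TYPE(('g, 'a) univ) A D \<alpha>)"
proof -
  interpret A: cstar_algebra A by (rule assms)
  let ?P = "\<forall>t. \<forall>a\<in>carrier A. \<forall>b\<in>carrier A. \<exists>u\<in>D t. \<forall>c\<in>D (- t).
             \<alpha> t c \<otimes>\<^bsub>A\<^esub> u = \<alpha> t (c \<otimes>\<^bsub>A\<^esub> a) \<otimes>\<^bsub>A\<^esub> b"
  have pa: "star_partial_action A D \<alpha>" using assms by (simp add: cstar_partial_action_def)
  have suff: "has_cstar_globalization TYPE(('g, 'a) univ) A D \<alpha>" if ?P
  proof -
    interpret globalizable_partial A D \<alpha>
      using that assms by unfold_locales auto
    show ?thesis unfolding has_cstar_globalization_def using cstar_globalization_glob by blast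
  qed
  have star_u: "has_star_globalization TYPE(('g, 'a) univ) A D \<alpha>"
    if "has_cstar_globalization TYPE(('g, 'a) univ) A D \<alpha>"
    using that cstar_globalization_imp_star_globalization[OF A.star_algebra_axioms]
    unfolding has_cstar_globalization_def has_star_globalization_def by blast
  have star_b: "has_star_globalization TYPE('b) A D \<alpha>" if "has_cstar_globalization TYPE('b) A D \<alpha>"
    using that cstar_globalization_imp_star_globalization[OF A.star_algebra_axioms]
    unfolding has_cstar_globalization_def has_star_globalization_def by blast
  have nec_u: ?P if "has_star_globalization TYPE(('g, 'a) univ) A D \<alpha>"
    using that star_globalization_products[OF A.star_algebra_axioms pa]
    unfolding has_star_globalization_def by blast
  have nec_b: ?P if "has_star_globalization TYPE('b) A D \<alpha>"
    using that star_globalization_products[OF A.star_algebra_axioms pa]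
    unfolding has_star_globalization_def by blast
  show ?thesis using suff star_u star_b nec_u nec_b by blast
qed

end
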